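(* For every integer $t\ge 0$, with $n=18\cdot 2^t+1$, there exists a simple affine arrangement of $n$ straight lines in $\mathbb{R}^2$ having exactly $$\left\lfloor \frac{n(n-2)}{3}\right\rfloor = 108\cdot 4^t-1$$ bounded triangular faces.
   Context: An arrangement of lines in the real affine plane is simple if no point lies on more than two of its lines (and no two lines are parallel). A bounded triangular face is a bounded connected component of the complement of the union of the lines that is a triangle. *)

theory Defs
  imports "HOL-Analysis.Analysis"
begin

type_synonym plane = "real^2"

definition is_line :: "plane set \<Rightarrow> bool" where
  "is_line L \<longleftrightarrow> affine L \<and> aff_dim L = 1"

definition line_arrangement :: "plane set set \<Rightarrow> bool" where
  "line_arrangement \<A> \<longleftrightarrow> finite \<A> \<and> (\<forall>L\<in>\<A>. is_line L)"

definition simple_arrangement :: "plane set set \<Rightarrow> bool" where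
  "simple_arrangement \<A> \<longleftrightarrow>
     line_arrangement \<A> \<and>
     (\<forall>p. card {L \<in> \<A>. p \<in> L} \<le> 2) \<and>
     (\<forall>L\<in>\<A>. \<forall>M\<in>\<A>. L \<noteq> M \<longrightarrow> \<not> affine_parallel L M)"

definition faces :: "plane set set \<Rightarrow> plane set set" where
  "faces \<A> = components (- \<Union>\<A>)"

text \<open>Faces are open sets, so a triangular face is the interior of a nondegenerate triangle.\<close>

definition open_triangle :: "plane set \<Rightarrow> bool" where
  "open_triangle F \<longleftrightarrow>
     (\<exists>a b c. \<not> collinear {a, b, c} \<and> F = interior (convex hull {a, b, c}))"

definition bounded_triangular_faces :: "plane set set \<Rightarrow> plane set set" where
  "bounded_triangular_faces \<A> = {F \<in> faces \<A>. bounded F \<and> open_triangle F}"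

end

theory Submission
  imports Defs
begin

text \<open>In a simple arrangement the bounded triangular faces correspond to the triples of lines whose triangle is
  met by no further line. On a line carrying n - 1 vertices at most n - 2 pairs of vertices are adjacent, which gives
  the bound n (n - 2) / 3.

  For the existence, let the lines other than one fixed axis cross the axis in m = n - 1 points that are projectively
  equidistant, and such that consecutive lines form triangles with the axis, alternately above and below it. Squeeze
  the arrangement away from the axis until all these lines are almost vertical, and add m further lines close to the
  axis, namely the tangents of a conic in regular position, which cross the old lines like the sides of a regular
  polygon cross its symmetry axes. Every old triangle survives (the triangles at the axis with the axis replaced by
  the nearest new line), m^2 new ones appear, and the m old and m new points on the axis are again projectively
  equidistant, so that the construction can be iterated. The number \<rho> records the position of the point at infinity
  between two of the equidistant points; it is doubled modulo 1 in each step, so it must not be dyadic.\<close>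

section \<open>Triangular faces and empty triples of lines\<close>

text \<open>No face ever has to be excluded. With m lines besides the axis the general bound is 3N
  \<le> m^2 - 1, and the induction carries a lower bound only: m(m - 3)/3 triangles off the axis and
  m - 1 at it, so 3N \<ge> m^2 - 3. As 3 divides m, one value is left. Doubling keeps this since m(m
  - 3)/3 + (m - 1) + (m - 1)^2 = 2m(2m - 3)/3: old triangles off the axis, old ones at the axis with
  a new side, and triangles at crossings of two new lines. The obstacle: in regular position the
  crossing of new lines k and l lies on the vertical old line k + l, read modulo m. It lies below
  the axis if k + l \<le> m and above it otherwise. Tilting all old lines the same way therefore
  moves it to the right of its line in the first case and to the left in the second, so the gap it
  falls into is the sum modulo m + 1, and different l give different gaps on line k. The new axis
  points are angular midpoints, and the last one precedes the point at infinity only if \<rho> >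
  1/2. Otherwise a mirror image replaces \<rho> by 1 - \<rho>; as m is even, the sides still
  alternate correctly.\<close>

type_synonym lin = "plane \<times> real"

definition ev :: "lin \<Rightarrow> plane \<Rightarrow> real" where
  "ev l p = fst l \<bullet> p - snd l"

definition line_of :: "lin \<Rightarrow> plane set" where
  "line_of l = {p. ev l p = 0}"

definition det2 :: "plane \<Rightarrow> plane \<Rightarrow> real" where
  "det2 u v = u $ 1 * v $ 2 - u $ 2 * v $ 1"

lemma line_of_hyperplane: "line_of l = {p. fst l \<bullet> p = snd l}"
  by (auto simp: line_of_def ev_def)

lemma ev_combination:
  assumes "u + v + w = 1"
  shows "ev l (u *\<^sub>R A + v *\<^sub>R B + w *\<^sub>R C) = u * ev l A + v * ev l B + w * ev l C"
proof -
  have "snd l = (u + v + w) * snd l" using assms by simp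
  then show ?thesis by (simp add: ev_def inner_add_right algebra_simps)
qed

lemma ev_convex2:
  "ev l ((1 - u) *\<^sub>R A + u *\<^sub>R B) = (1 - u) * ev l A + u * ev l B"
  by (simp add: ev_def inner_add_right algebra_simps)

lemma continuous_on_ev: "continuous_on S (ev l)"
  unfolding ev_def by (intro continuous_intros)

lemma inner_plane: "(u::plane) \<bullet> v = u $ 1 * v $ 1 + u $ 2 * v $ 2"
  by (simp add: inner_vec_def sum_2)

lemma common_point_unique:
  assumes "det2 (fst l) (fst k) \<noteq> 0" "ev l A = 0" "ev k A = 0" "ev l B = 0" "ev k B = 0"
  shows "A = B"
proof -
  define x y where "x = A $ 1 - B $ 1" and "y = A $ 2 - B $ 2"
  have 1: "fst l $ 1 * x + fst l $ 2 * y = 0" "fst k $ 1 * x + fst k $ 2 * y = 0"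
    using assms by (auto simp: ev_def inner_plane x_def y_def algebra_simps)
  have "det2 (fst l) (fst k) * x = fst k $ 2 * (fst l $ 1 * x + fst l $ 2 * y) - fst l $ 2 * (fst k $ 1 * x + fst k $ 2 * y)"
    "det2 (fst l) (fst k) * y = fst l $ 1 * (fst k $ 1 * x + fst k $ 2 * y) - fst k $ 1 * (fst l $ 1 * x + fst l $ 2 * y)"
    by (auto simp: det2_def algebra_simps)
  then have "x = 0" "y = 0" using 1 assms(1) by auto
  then show ?thesis by (simp add: x_def y_def vec_eq_iff forall_2)
qed

text \<open>Lines are indexed rather than collected in a set, so that triangles are triples of
  indices with sign conditions on \<open>ev\<close>; \<open>inj_on_line_of\<close> transfers
  cardinalities to the set of lines.\<close>

locale simple_family =
  fixes F :: "'i \<Rightarrow> lin" and I :: "'i set"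
  assumes finite_index: "finite I"
    and normal_nonzero: "i \<in> I \<Longrightarrow> fst (F i) \<noteq> 0"
    and nonparallel: "\<lbrakk>i \<in> I; j \<in> I; i \<noteq> j\<rbrakk> \<Longrightarrow> det2 (fst (F i)) (fst (F j)) \<noteq> 0"
    and not_concurrent: "\<lbrakk>i \<in> I; j \<in> I; k \<in> I; i \<noteq> j; j \<noteq> k; i \<noteq> k;
        ev (F i) A = 0; ev (F j) A = 0; ev (F k) A = 0\<rbrakk> \<Longrightarrow> False"
begin

abbreviation "arr \<equiv> (\<lambda>i. line_of (F i)) ` I"

lemma is_line: "i \<in> I \<Longrightarrow> is_line (line_of (F i))"
  unfolding is_line_def line_of_hyperplane
  using normal_nonzero[of i] by (simp add: affine_hyperplane aff_dim_hyperplane)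

lemma not_affine_parallel:
  assumes "i \<in> I" "j \<in> I" "i \<noteq> j"
  shows "\<not> affine_parallel (line_of (F i)) (line_of (F j))"
proof
  assume "affine_parallel (line_of (F i)) (line_of (F j))"
  then obtain a where a: "line_of (F j) = (\<lambda>x. a + x) ` line_of (F i)"
    unfolding affine_parallel_def by auto
  define n d where "n = fst (F i)" and "d = snd (F i)"
  have n: "n \<noteq> 0" using normal_nonzero assms n_def by auto
  define p :: plane where "p = (d / (n \<bullet> n)) *\<^sub>R n"
  define v :: plane where "v = vector [- n $ 2, n $ 1]"
  have nv: "n \<bullet> v = 0" by (simp add: inner_plane v_def)
  have "p \<in> line_of (F i)" "p + v \<in> line_of (F i)"
    using n nv by (auto simp: line_of_def ev_def n_def[symmetric] d_def[symmetric] p_def inner_add_right)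
  then have "a + p \<in> line_of (F j)" "a + (p + v) \<in> line_of (F j)" using a by auto
  then have "fst (F j) \<bullet> v = 0" by (auto simp: line_of_def ev_def inner_add_right)
  then have "det2 n (fst (F j)) = 0" by (auto simp: inner_plane det2_def v_def algebra_simps)
  then show False using nonparallel[OF assms] n_def by auto
qed

lemma inj_on_line_of: "inj_on (\<lambda>i. line_of (F i)) I"
proof (rule inj_onI, rule ccontr)
  fix i j assume "i \<in> I" "j \<in> I" "line_of (F i) = line_of (F j)" "i \<noteq> j"
  then show False using not_affine_parallel[of i j] affine_parallel_reflex[of "line_of (F j)"] by simp
qed

lemma card_arr: "card arr = card I"
  by (rule card_image[OF inj_on_line_of])

lemma simple_arrangement_arr: "simple_arrangement arr"
  unfolding simple_arrangement_def line_arrangement_def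
proof (intro conjI allI ballI impI)
  show "finite arr" using finite_index by simp
  show "is_line L" if "L \<in> arr" for L using that is_line by auto
  show "\<not> affine_parallel L M" if "L \<in> arr" "M \<in> arr" "L \<noteq> M" for L M
    using that not_affine_parallel by blast
  show "card {L \<in> arr. p \<in> L} \<le> 2" for p
  proof (rule ccontr)
    assume "\<not> card {L \<in> arr. p \<in> L} \<le> 2"
    moreover define J where "J = {i \<in> I. p \<in> line_of (F i)}"
    have "{L \<in> arr. p \<in> L} = (\<lambda>i. line_of (F i)) ` J" by (auto simp: J_def)
    moreover have "card ((\<lambda>i. line_of (F i)) ` J) = card J"
      by (rule card_image, rule inj_on_subset[OF inj_on_line_of]) (auto simp: J_def)
    ultimately have "\<not> card J \<le> 2" by simp
    then have "3 \<le> card J" by linarith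
    then obtain S where "S \<subseteq> J" "card S = 3"
      by (meson obtain_subset_with_card_n)
    then obtain i j k where "i \<in> I" "j \<in> I" "k \<in> I" "i \<noteq> j" "j \<noteq> k" "i \<noteq> k"
      "p \<in> line_of (F i)" "p \<in> line_of (F j)" "p \<in> line_of (F k)"
      unfolding card_3_iff J_def by auto
    then show False using not_concurrent[of i j k p] by (auto simp: line_of_def)
  qed
qed

text \<open>Each vertex is named after the opposite line: A belongs to i, B to j, C to k. Strict
  equal signs at the three vertices say that a further line misses the closed triangle;
  nondegeneracy follows from \<open>not_concurrent\<close>.\<close>

definition triangle :: "'i \<Rightarrow> 'i \<Rightarrow> 'i \<Rightarrow> plane \<Rightarrow> plane \<Rightarrow> plane \<Rightarrow> bool" where
  "triangle i j k A B C \<longleftrightarrow> {i, j, k} \<subseteq> I \<and> i \<noteq> j \<and> j \<noteq> k \<and> i \<noteq> k \<and>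
     ev (F j) A = 0 \<and> ev (F k) A = 0 \<and> ev (F i) B = 0 \<and> ev (F k) B = 0 \<and> ev (F i) C = 0 \<and> ev (F j) C = 0 \<and>
     (\<forall>q \<in> I - {i, j, k}. (0 < ev (F q) A \<and> 0 < ev (F q) B \<and> 0 < ev (F q) C) \<or>
                           (ev (F q) A < 0 \<and> ev (F q) B < 0 \<and> ev (F q) C < 0))"

definition empty_triples :: "'i set set" where
  "empty_triples = {{i, j, k} | i j k. \<exists>A B C. triangle i j k A B C}"

lemma triangle_perm:
  assumes "triangle i j k A B C"
  shows "triangle j i k B A C" "triangle i k j A C B"
  using assms unfolding triangle_def by (auto simp: insert_commute)

lemma triangle_nonzero:
  assumes "triangle i j k A B C"
  shows "ev (F i) A \<noteq> 0" "ev (F j) B \<noteq> 0" "ev (F k) C \<noteq> 0"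
  using assms not_concurrent[of i j k] unfolding triangle_def by (blast, blast, blast)

lemma triangle_distinct:
  assumes "triangle i j k A B C"
  shows "A \<noteq> B" "B \<noteq> C" "A \<noteq> C"
  using triangle_nonzero[OF assms] assms unfolding triangle_def by auto

lemma triangle_not_collinear:
  assumes T: "triangle i j k A B C"
  shows "\<not> collinear {A, B, C}"
proof
  assume "collinear {A, B, C}"
  then have "collinear {B, A, C}" by (simp add: insert_commute)
  then obtain u where "A = u *\<^sub>R B + (1 - u) *\<^sub>R C"
    using triangle_distinct[OF T] collinear_3_expand[of B A C] by blast
  then have "ev (F i) A = u * ev (F i) B + (1 - u) * ev (F i) C"
    using ev_combination[of 0 u "1-u" "F i" A B C] by simp
  then show False using T triangle_nonzero[OF T] by (auto simp: triangle_def)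
qed

lemma triangle_hull_points:
  assumes T: "triangle i j k A B C" and x: "x \<in> convex hull {A, B, C}"
  obtains u v w where "0 \<le> u" "0 \<le> v" "0 \<le> w" "u + v + w = 1" "x = u *\<^sub>R A + v *\<^sub>R B + w *\<^sub>R C"
    "\<And>l. ev l x = u * ev l A + v * ev l B + w * ev l C"
  using x unfolding convex_hull_3 using ev_combination by blast

lemma other_line_misses_hull:
  assumes T: "triangle i j k A B C" and q: "q \<in> I - {i, j, k}" and x: "x \<in> convex hull {A, B, C}"
  shows "ev (F q) x \<noteq> 0"
proof -
  obtain u v w where *: "0 \<le> u" "0 \<le> v" "0 \<le> w" "u + v + w = 1"
    "\<And>l. ev l x = u * ev l A + v * ev l B + w * ev l C"
    using triangle_hull_points[OF T x] by metis
  have pos: "0 < u * a + v * b + w * c" if "0 < a" "0 < b" "0 < c" for a b c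
  proof -
    define e where "e = min a (min b c)"
    have "e > 0" "e \<le> a" "e \<le> b" "e \<le> c" using that by (auto simp: e_def)
    then have "u * e \<le> u * a" "v * e \<le> v * b" "w * e \<le> w * c"
      using * by (auto intro: mult_left_mono)
    moreover have "u * e + v * e + w * e = e" using *(4) by (metis distrib_right mult_1)
    ultimately show ?thesis using \<open>e > 0\<close> by linarith
  qed
  from T q consider "0 < ev (F q) A \<and> 0 < ev (F q) B \<and> 0 < ev (F q) C"
    | "ev (F q) A < 0 \<and> ev (F q) B < 0 \<and> ev (F q) C < 0"
    unfolding triangle_def by blast
  then show ?thesis
  proof cases
    case 1 then show ?thesis using pos *(5) by (metis less_irrefl)
  next
    case 2
    then have "0 < u * - ev (F q) A + v * - ev (F q) B + w * - ev (F q) C" by (intro pos) auto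
    then show ?thesis using *(5)[of "F q"] by auto
  qed
qed

text \<open>The three side lines remove exactly the points with a vanishing barycentric coordinate,
  and no other line meets the hull.\<close>

lemma interior_hull_eq:
  assumes T: "triangle i j k A B C"
  shows "interior (convex hull {A, B, C}) = convex hull {A, B, C} - \<Union>arr"
proof -
  have int: "interior (convex hull {A, B, C}) =
     {x. \<exists>u v w. 0 < u \<and> 0 < v \<and> 0 < w \<and> u + v + w = 1 \<and> u *\<^sub>R A + v *\<^sub>R B + w *\<^sub>R C = x}"
    using interior_convex_hull_3_minimal[OF triangle_not_collinear[OF T]] by simp
  note nz = triangle_nonzero[OF T]
  have z: "ev (F j) A = 0" "ev (F k) A = 0" "ev (F i) B = 0" "ev (F k) B = 0" "ev (F i) C = 0" "ev (F j) C = 0"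
    "i \<in> I" "j \<in> I" "k \<in> I"
    using T by (auto simp: triangle_def)
  show ?thesis
  proof (intro equalityI subsetI)
    fix x assume x: "x \<in> interior (convex hull {A, B, C})"
    then have xh: "x \<in> convex hull {A, B, C}" using interior_subset by blast
    obtain u v w where *: "0 < u" "0 < v" "0 < w" "u + v + w = 1" "x = u *\<^sub>R A + v *\<^sub>R B + w *\<^sub>R C"
      using x int by auto
    have e: "ev l x = u * ev l A + v * ev l B + w * ev l C" for l
      using ev_combination * by auto
    have "ev (F q) x \<noteq> 0" if "q \<in> I" for q
    proof (cases "q \<in> {i, j, k}")
      case True then show ?thesis using e nz z * by auto
    next
      case False then show ?thesis using other_line_misses_hull[OF T _ xh] that by auto
    qed
    then show "x \<in> convex hull {A, B, C} - \<Union>arr" using xh by (auto simp: line_of_def)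
  next
    fix x assume x: "x \<in> convex hull {A, B, C} - \<Union>arr"
    then obtain u v w where *: "0 \<le> u" "0 \<le> v" "0 \<le> w" "u + v + w = 1" "x = u *\<^sub>R A + v *\<^sub>R B + w *\<^sub>R C"
      "\<And>l. ev l x = u * ev l A + v * ev l B + w * ev l C"
      using triangle_hull_points[OF T, of x] by blast
    have "ev (F i) x \<noteq> 0" "ev (F j) x \<noteq> 0" "ev (F k) x \<noteq> 0" using x z by (auto simp: line_of_def)
    then have "u \<noteq> 0" "v \<noteq> 0" "w \<noteq> 0" using *(6) z by auto
    then show "x \<in> interior (convex hull {A, B, C})"
      unfolding int using * by (intro CollectI exI[of _ u] exI[of _ v] exI[of _ w]) auto
  qed
qed

text \<open>By \<open>interior_hull_eq\<close> the open triangle is the trace of a closed set on the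
  complement of the lines. Being also open, connected and nonempty, it is a component.\<close>

lemma triangle_face:
  assumes T: "triangle i j k A B C"
  shows "interior (convex hull {A, B, C}) \<in> bounded_triangular_faces arr"
proof -
  let ?H = "convex hull {A, B, C}" and ?U = "- \<Union>arr"
  have conv: "convex (interior ?H)" by (simp add: convex_interior)
  have ne: "interior ?H \<noteq> {}"
  proof -
    have "(1/3) *\<^sub>R A + (1/3) *\<^sub>R B + (1/3) *\<^sub>R C \<in> interior ?H"
      unfolding interior_convex_hull_3_minimal[OF triangle_not_collinear[OF T], simplified]
      by (intro CollectI exI[of _ "1/3"] conjI) auto
    then show ?thesis by blast
  qed
  have "closed ?H" by (simp add: compact_imp_closed finite_imp_compact_convex_hull)
  have eq: "interior ?H = ?U \<inter> ?H" using interior_hull_eq[OF T] by auto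
  have clo: "closedin (top_of_set ?U) (interior ?H)"
    unfolding eq using \<open>closed ?H\<close> by (rule closedin_closed_Int)
  have opn: "openin (top_of_set ?U) (interior ?H)"
    by (rule open_subset) (use eq in blast, rule open_interior)
  have "interior ?H \<in> components ?U"
    unfolding in_components_maximal
  proof (intro conjI allI impI)
    show "interior ?H \<noteq> {}" by (rule ne)
    show "interior ?H \<subseteq> ?U" using eq by auto
    show "connected (interior ?H)" using conv by (rule convex_connected)
    fix D assume D: "D \<noteq> {} \<and> interior ?H \<subseteq> D \<and> D \<subseteq> ?U \<and> connected D"
    have "openin (top_of_set D) (interior ?H)" "closedin (top_of_set D) (interior ?H)"
      using D opn clo by (meson openin_subset_trans closedin_subset_trans)+
    then show "D = interior ?H" using D ne connected_clopen by blast
  qed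
  moreover have "bounded (interior ?H)"
    by (intro bounded_interior finite_imp_bounded_convex_hull) auto
  moreover have "open_triangle (interior ?H)"
    unfolding open_triangle_def using triangle_not_collinear[OF T] by blast
  ultimately show ?thesis by (simp add: bounded_triangular_faces_def faces_def)
qed

text \<open>The closure of the face recovers the closed triangle, and only lines i, j, k meet that.
  The lines of the second triangle pass through its vertices, which lie in the same closed
  triangle.\<close>

lemma triangle_face_inj:
  assumes T: "triangle i j k A B C" and T': "triangle i' j' k' A' B' C'"
    and eq: "interior (convex hull {A, B, C}) = interior (convex hull {A', B', C'})"
  shows "{i', j', k'} \<subseteq> {i, j, k}"
proof -
  have cl: "closure (interior (convex hull {A, B, C})) = convex hull {A, B, C}"
    if "triangle i j k A B C" for i j k A B C
  proof -
    have "interior (convex hull {A, B, C}) \<noteq> {}"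
      using triangle_face[OF that] by (auto simp: bounded_triangular_faces_def faces_def in_components_maximal)
    moreover have "closed (convex hull {A, B, C})"
      by (simp add: compact_imp_closed finite_imp_compact_convex_hull)
    ultimately show ?thesis
      using convex_closure_interior[of "convex hull {A, B, C}"] by simp
  qed
  have H: "convex hull {A, B, C} = convex hull {A', B', C'}"
    by (rule trans[OF cl[OF T, symmetric]], unfold eq, rule cl[OF T'])
  have "A' \<in> convex hull {A, B, C}" "B' \<in> convex hull {A, B, C}" "C' \<in> convex hull {A, B, C}"
    unfolding H by (auto simp: hull_inc)
  then have N: "q \<notin> I - {i, j, k}" if "ev (F q) A' = 0 \<or> ev (F q) B' = 0 \<or> ev (F q) C' = 0" for q
    using that other_line_misses_hull[OF T, of q] by blast
  have "ev (F j') A' = 0" "ev (F k') A' = 0" "ev (F i') B' = 0" "{i', j', k'} \<subseteq> I"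
    using T' unfolding triangle_def by auto
  then show ?thesis using N[of i'] N[of j'] N[of k'] by auto
qed

lemma triangle_points_unique:
  assumes T: "triangle i j k A B C" and T': "triangle i' j' k' A' B' C'" and eq: "{i, j, k} = {i', j', k'}"
  shows "{A, B, C} = {A', B', C'}"
proof -
  have u: "A = A' \<and> B = B' \<and> C = C'"
    if "triangle i j k A B C" "triangle i j k A' B' C'" for i j k A B C A' B' C'
  proof -
    have "det2 (fst (F j)) (fst (F k)) \<noteq> 0" "det2 (fst (F i)) (fst (F k)) \<noteq> 0" "det2 (fst (F i)) (fst (F j)) \<noteq> 0"
      using that nonparallel unfolding triangle_def by auto
    then show ?thesis using that common_point_unique unfolding triangle_def by blast
  qed
  have T2: "triangle i' k' j' A' C' B'" and T3: "triangle j' i' k' B' A' C'" using triangle_perm T' by blast+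
  have T4: "triangle j' k' i' B' C' A'" and T5: "triangle k' i' j' C' A' B'" using triangle_perm T2 T3 by blast+
  have T6: "triangle k' j' i' C' B' A'" using triangle_perm T4 by blast
  have d: "i \<noteq> j" "j \<noteq> k" "i \<noteq> k" using T by (auto simp: triangle_def)
  have "i \<in> {i', j', k'}" "j \<in> {i', j', k'}" "k \<in> {i', j', k'}" using eq by auto
  then consider "i = i'" "j = j'" "k = k'" | "i = i'" "j = k'" "k = j'" | "i = j'" "j = i'" "k = k'"
    | "i = j'" "j = k'" "k = i'" | "i = k'" "j = i'" "k = j'" | "i = k'" "j = j'" "k = i'"
    using d by auto
  then show ?thesis
    by cases (use u T T' T2 T3 T4 T5 T6 in blast)+
qed


text \<open>Infinitely many parameters are shared among finitely many lines, so one line takes two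
  of them, and \<open>ev\<close> is affine in the parameter.\<close>

lemma segment_in_line:
  assumes sub: "closed_segment a b \<subseteq> \<Union>arr"
  shows "\<exists>i\<in>I. ev (F i) a = 0 \<and> ev (F i) b = 0"
proof -
  let ?g = "\<lambda>u. (1 - u) *\<^sub>R a + u *\<^sub>R b"
  have "\<forall>u\<in>{0..1::real}. \<exists>i\<in>I. ev (F i) (?g u) = 0"
  proof
    fix u :: real assume "u \<in> {0..1}"
    then have "?g u \<in> closed_segment a b" by (auto simp: in_segment)
    then show "\<exists>i\<in>I. ev (F i) (?g u) = 0" using sub by (auto simp: line_of_def)
  qed
  moreover have "infinite {0..1::real}" by (simp add: infinite_Icc)
  ultimately obtain i where i: "i \<in> I" "infinite {u \<in> {0..1::real}. ev (F i) (?g u) = 0}"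
    using pigeonhole_infinite_rel[of "{0..1::real}" I "\<lambda>u i. ev (F i) (?g u) = 0"] finite_index by blast
  obtain u where u: "ev (F i) (?g u) = 0"
    using i(2) by (metis (mono_tags, lifting) Collect_empty_eq finite.emptyI)
  obtain v where v: "ev (F i) (?g v) = 0" "v \<noteq> u"
  proof -
    have "infinite ({u \<in> {0..1::real}. ev (F i) (?g u) = 0} - {u})" using i(2) by simp
    then have "{u \<in> {0..1::real}. ev (F i) (?g u) = 0} - {u} \<noteq> {}" by (metis finite.emptyI)
    then show ?thesis using that by blast
  qed
  have e: "(1 - u) * ev (F i) a + u * ev (F i) b = 0" "(1 - v) * ev (F i) a + v * ev (F i) b = 0"
    using u v by (auto simp: ev_convex2)
  have "(v - u) * ev (F i) a = v * ((1 - u) * ev (F i) a + u * ev (F i) b) - u * ((1 - v) * ev (F i) a + v * ev (F i) b)"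
    "(v - u) * ev (F i) b = (1 - u) * ((1 - v) * ev (F i) a + v * ev (F i) b) - (1 - v) * ((1 - u) * ev (F i) a + u * ev (F i) b)"
    by (auto simp: algebra_simps)
  then show ?thesis using e v i by auto
qed

text \<open>Maximality of the component puts the boundary of the triangle on the lines, and then
  each edge on a single line. Any further line has constant sign on the connected face, hence weakly
  on its closure, and strictly at the vertices because two lines already pass there.\<close>

lemma face_triangle:
  assumes "G \<in> bounded_triangular_faces arr"
  obtains i j k A B C where "triangle i j k A B C" "G = interior (convex hull {A, B, C})"
proof -
  let ?U = "- \<Union>arr"
  from assms obtain a b c where nc: "\<not> collinear {a, b, c}" and G: "G = interior (convex hull {a, b, c})"
    and comp: "G \<in> components ?U"
    unfolding bounded_triangular_faces_def faces_def open_triangle_def by blast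
  let ?H = "convex hull {a, b, c}"
  have Gne: "G \<noteq> {}" and GU: "G \<subseteq> ?U" and Gmax: "\<And>D. D \<noteq> {} \<Longrightarrow> G \<subseteq> D \<Longrightarrow> D \<subseteq> ?U \<Longrightarrow> connected D \<Longrightarrow> D = G"
    using comp unfolding in_components_maximal by auto
  have "convex G" unfolding G by (simp add: convex_interior)
  then have Gc: "connected G" by (rule convex_connected)
  have "closed ?H" by (simp add: compact_imp_closed finite_imp_compact_convex_hull)
  then have clG: "closure G = ?H" using convex_closure_interior[of ?H] Gne G by simp
  \<comment> \<open>Adding a point of the closure keeps G connected, so maximality forbids points of
    the hull that are neither in G nor on a line.\<close>
  have HU: "x \<in> G" if "x \<in> ?H" "x \<in> ?U" for x
  proof -
    have "connected (insert x G)"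
      by (rule connected_intermediate_closure[OF Gc]) (use that clG closure_subset in auto)
    then have "insert x G = G" using that GU by (intro Gmax) auto
    then show ?thesis by auto
  qed
  have fr: "frontier ?H = closed_segment a b \<union> closed_segment b c \<union> closed_segment c a"
    by (rule frontier_of_triangle) simp
  have "frontier ?H \<subseteq> \<Union>arr"
  proof
    fix x assume "x \<in> frontier ?H"
    then have "x \<in> ?H" "x \<notin> G" using \<open>closed ?H\<close> G by (auto simp: frontier_def)
    then show "x \<in> \<Union>arr" using HU by blast
  qed
  then have "closed_segment a b \<subseteq> \<Union>arr" "closed_segment b c \<subseteq> \<Union>arr" "closed_segment c a \<subseteq> \<Union>arr"
    unfolding fr by auto
  then obtain p q r where pqr: "p \<in> I" "ev (F p) a = 0" "ev (F p) b = 0" "q \<in> I" "ev (F q) b = 0" "ev (F q) c = 0"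
    "r \<in> I" "ev (F r) c = 0" "ev (F r) a = 0"
    using segment_in_line by metis
  have no3: "\<not> (ev (F s) a = 0 \<and> ev (F s) b = 0 \<and> ev (F s) c = 0)" if "s \<in> I" for s
  proof
    assume "ev (F s) a = 0 \<and> ev (F s) b = 0 \<and> ev (F s) c = 0"
    then have "{a, b, c} \<subseteq> line_of (F s)" by (auto simp: line_of_def)
    then have "aff_dim {a, b, c} \<le> 1" using is_line[OF that] aff_dim_subset unfolding is_line_def by metis
    then show False using nc collinear_aff_dim by blast
  qed
  have d: "p \<noteq> q" "q \<noteq> r" "p \<noteq> r" using no3 pqr by auto
  have "triangle q r p a b c"
    unfolding triangle_def
  proof (intro conjI ballI)
    fix s assume s: "s \<in> I - {q, r, p}"
    have nz: "ev (F s) x \<noteq> 0" if "x \<in> G" for x using that GU s by (auto simp: line_of_def)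
    have cst: "(\<forall>x\<in>G. 0 < ev (F s) x) \<or> (\<forall>x\<in>G. ev (F s) x < 0)"
    proof (rule ccontr)
      assume "\<not> ?thesis"
      then obtain x y where xy: "x \<in> G" "y \<in> G" "ev (F s) x < 0" "0 < ev (F s) y"
        using nz by (metis linorder_neqE_linordered_idom)
      have "connected (ev (F s) ` G)" using connected_continuous_image[OF continuous_on_ev Gc] .
      then have "0 \<in> ev (F s) ` G"
        using xy connected_contains_Icc[of "ev (F s) ` G" "ev (F s) x" "ev (F s) y"] by auto
      then show False using nz by auto
    qed
    have ab: "a \<in> ?H" "b \<in> ?H" "c \<in> ?H" by (auto simp: hull_inc)
    have v: "ev (F s) a \<noteq> 0" "ev (F s) b \<noteq> 0" "ev (F s) c \<noteq> 0"
      using not_concurrent[of s p r a] not_concurrent[of s p q b] not_concurrent[of s q r c] pqr s d by auto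
    show "(0 < ev (F s) a \<and> 0 < ev (F s) b \<and> 0 < ev (F s) c) \<or> (ev (F s) a < 0 \<and> ev (F s) b < 0 \<and> ev (F s) c < 0)"
      using cst
    proof
      assume "\<forall>x\<in>G. 0 < ev (F s) x"
      then have "closure G \<subseteq> {x. 0 \<le> ev (F s) x}"
        by (intro closure_minimal closed_Collect_le continuous_on_ev continuous_on_const) force
      then show ?thesis using ab v clG by force
    next
      assume "\<forall>x\<in>G. ev (F s) x < 0"
      then have "closure G \<subseteq> {x. ev (F s) x \<le> 0}"
        by (intro closure_minimal closed_Collect_le continuous_on_ev continuous_on_const) force
      then show ?thesis using ab v clG by force
    qed
  qed (use pqr d in auto)
  then show ?thesis using that G by blast
qed

section \<open>Counting triangular faces by empty triples\<close>

lemma finite_empty_triples: "finite empty_triples"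
proof (rule finite_subset)
  show "empty_triples \<subseteq> Pow I" by (auto simp: empty_triples_def triangle_def)
qed (use finite_index in simp)

text \<open>The relation R between triples and faces is single-valued in both directions, so choice
  functions either way are injective; finiteness of the set of faces comes from the second
  one.\<close>

lemma card_bounded_triangular_faces: "card (bounded_triangular_faces arr) = card empty_triples"
proof -
  define R where "R T G \<longleftrightarrow> (\<exists>i j k A B C. triangle i j k A B C \<and> T = {i, j, k} \<and> G = interior (convex hull {A, B, C}))" for T G
  have R1: "T = T'" if r: "R T G" "R T' G" for T T' G
  proof -
    obtain i j k A B C where 1: "triangle i j k A B C" "T = {i, j, k}" "G = interior (convex hull {A, B, C})"
      using r(1) unfolding R_def by blast
    obtain i' j' k' A' B' C' where 2: "triangle i' j' k' A' B' C'" "T' = {i', j', k'}" "G = interior (convex hull {A', B', C'})"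
      using r(2) unfolding R_def by blast
    have "interior (convex hull {A, B, C}) = interior (convex hull {A', B', C'})"
      by (rule trans[OF 1(3)[symmetric] 2(3)])
    from triangle_face_inj[OF 1(1) 2(1) this] triangle_face_inj[OF 2(1) 1(1) this[symmetric]]
    show ?thesis unfolding 1(2) 2(2) by (intro equalityI)
  qed
  have R2: "G = G'" if r: "R T G" "R T G'" for T G G'
  proof -
    obtain i j k A B C where 1: "triangle i j k A B C" "T = {i, j, k}" "G = interior (convex hull {A, B, C})"
      using r(1) unfolding R_def by blast
    obtain i' j' k' A' B' C' where 2: "triangle i' j' k' A' B' C'" "T = {i', j', k'}" "G' = interior (convex hull {A', B', C'})"
      using r(2) unfolding R_def by blast
    have "{A, B, C} = {A', B', C'}"
      by (rule triangle_points_unique[OF 1(1) 2(1) trans[OF 1(2)[symmetric] 2(2)]])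
    then show ?thesis unfolding 1(3) 2(3) by (rule arg_cong)
  qed
  have RI: "R {i, j, k} (interior (convex hull {A, B, C}))" if "triangle i j k A B C" for i j k A B C
    unfolding R_def using that by (intro exI conjI) (assumption, rule refl, rule refl)
  have "\<forall>T\<in>empty_triples. \<exists>G. R T G \<and> G \<in> bounded_triangular_faces arr"
  proof
    fix T assume "T \<in> empty_triples"
    then obtain i j k A B C where T: "triangle i j k A B C" "T = {i, j, k}"
      unfolding empty_triples_def by blast
    show "\<exists>G. R T G \<and> G \<in> bounded_triangular_faces arr"
      unfolding T(2) by (intro exI conjI) (rule RI[OF T(1)], rule triangle_face[OF T(1)])
  qed
  from bchoice[OF this] obtain f where f: "\<forall>T\<in>empty_triples. R T (f T) \<and> f T \<in> bounded_triangular_faces arr" by blast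
  have "\<forall>G\<in>bounded_triangular_faces arr. \<exists>T. R T G \<and> T \<in> empty_triples"
  proof
    fix G assume "G \<in> bounded_triangular_faces arr"
    then obtain i j k A B C where T: "triangle i j k A B C" "G = interior (convex hull {A, B, C})"
      by (rule face_triangle)
    have "{i, j, k} \<in> empty_triples" unfolding empty_triples_def using T(1) by blast
    then show "\<exists>T. R T G \<and> T \<in> empty_triples" unfolding T(2) using RI[OF T(1)] by blast
  qed
  from bchoice[OF this] obtain g where g: "\<forall>G\<in>bounded_triangular_faces arr. R (g G) G \<and> g G \<in> empty_triples" by blast
  have ig: "inj_on g (bounded_triangular_faces arr)"
  proof (rule inj_onI)
    fix G G' assume "G \<in> bounded_triangular_faces arr" "G' \<in> bounded_triangular_faces arr" "g G = g G'"
    then have "R (g G) G" "R (g G) G'" using g by auto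
    then show "G = G'" by (rule R2)
  qed
  have gs: "g ` bounded_triangular_faces arr \<subseteq> empty_triples" using g by auto
  have fin: "finite (bounded_triangular_faces arr)"
    using finite_empty_triples ig gs by (meson finite_imageD finite_subset)
  have "inj_on f empty_triples"
  proof (rule inj_onI)
    fix T T' assume "T \<in> empty_triples" "T' \<in> empty_triples" "f T = f T'"
    then have "R T (f T)" "R T' (f T)" using f by auto
    then show "T = T'" by (rule R1)
  qed
  then have "card empty_triples \<le> card (bounded_triangular_faces arr)"
    using f fin by (intro card_inj_on_le[of f]) auto
  moreover have "card (bounded_triangular_faces arr) \<le> card empty_triples"
    using ig gs finite_empty_triples by (rule card_inj_on_le)
  ultimately show ?thesis by simp
qed

section \<open>The upper bound, by counting along each line\<close>

lemma common_point_exists: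
  assumes "i \<in> I" "j \<in> I" "i \<noteq> j"
  shows "\<exists>A. ev (F i) A = 0 \<and> ev (F j) A = 0"
proof -
  define n d m e where "n = fst (F i)" and "d = snd (F i)" and "m = fst (F j)" and "e = snd (F j)"
  define D where "D = det2 n m"
  have D: "D \<noteq> 0" using nonparallel[OF assms] by (simp add: D_def n_def m_def)
  define A :: plane where "A = vector [(d * m $ 2 - e * n $ 2) / D, (n $ 1 * e - m $ 1 * d) / D]"
  have "n $ 1 * (d * m $ 2 - e * n $ 2) + n $ 2 * (n $ 1 * e - m $ 1 * d) = d * D"
    "m $ 1 * (d * m $ 2 - e * n $ 2) + m $ 2 * (n $ 1 * e - m $ 1 * d) = e * D"
    by (auto simp: D_def det2_def algebra_simps)
  then have "n \<bullet> A = d" "m \<bullet> A = e"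
    using D by (auto simp: inner_plane A_def add_divide_distrib[symmetric] field_simps)
  then show ?thesis by (intro exI[of _ A]) (auto simp: ev_def n_def d_def m_def e_def)
qed

text \<open>The other lines cut line p in card I - 1 distinct points, and an empty triple containing
  p uses two adjacent ones. Sending it to the lower of the two is injective and never hits the last
  point.\<close>

lemma card_triples_on_line:
  assumes p: "p \<in> I"
  shows "card {T \<in> empty_triples. p \<in> T} \<le> card I - 2"
proof (cases "{T \<in> empty_triples. p \<in> T} = {}")
  case False
  define n where "n = fst (F p)"
  \<comment> \<open>A direction vector of line p; \<open>pos\<close> orders the crossing points
    along it.\<close>
  define v :: plane where "v = vector [- n $ 2, n $ 1]"
  obtain X where X: "\<And>q. q \<in> I - {p} \<Longrightarrow> ev (F p) (X q) = 0 \<and> ev (F q) (X q) = 0"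
    using common_point_exists[OF p] by (metis DiffE singletonI)
  define pos where "pos q = v \<bullet> X q" for q
  have n0: "n \<noteq> 0" using normal_nonzero p by (simp add: n_def)
  \<comment> \<open>Along line p the form of line r is affine in \<open>pos\<close> and vanishes at
    \<open>X r\<close>; the squared length of n is the normalisation.\<close>
  have evX: "(n \<bullet> n) * ev (F r) (X q) = (pos q - pos r) * (fst (F r) \<bullet> v)" if "q \<in> I - {p}" "r \<in> I - {p}" for q r
  proof -
    define x y where "x = X q $ 1 - X r $ 1" and "y = X q $ 2 - X r $ 2"
    have 0: "n $ 1 * x + n $ 2 * y = 0"
      using X[OF that(1)] X[OF that(2)] by (auto simp: ev_def inner_plane n_def x_def y_def algebra_simps)
    have e: "ev (F r) (X q) = fst (F r) $ 1 * x + fst (F r) $ 2 * y"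
      using X[OF that(2)] by (auto simp: ev_def inner_plane x_def y_def algebra_simps)
    have ps: "pos q - pos r = - n $ 2 * x + n $ 1 * y"
      by (simp add: pos_def v_def inner_plane x_def y_def algebra_simps)
    have "(n \<bullet> n) * ev (F r) (X q) - (pos q - pos r) * (fst (F r) \<bullet> v)
       = (n $ 1 * x + n $ 2 * y) * (fst (F r) $ 1 * n $ 1 + fst (F r) $ 2 * n $ 2)"
      unfolding e ps by (simp add: inner_plane v_def algebra_simps)
    then show ?thesis using 0 by simp
  qed
  have fv: "fst (F r) \<bullet> v \<noteq> 0" if "r \<in> I - {p}" for r
    using nonparallel[of p r] p that by (auto simp: inner_plane v_def det2_def n_def algebra_simps)
  have pos_ne: "pos q \<noteq> pos r" if "q \<in> I - {p}" "r \<in> I - {p}" "q \<noteq> r" for q r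
  proof
    assume "pos q = pos r"
    then have "ev (F r) (X q) = 0" using evX[OF that(1,2)] n0 by simp
    then show False using not_concurrent[of p q r "X q"] X[OF that(1)] p that by auto
  qed
  have between: False if B: "q \<in> I - {p}" "r \<in> I - {p}" "s \<in> I - {p}" "pos q < pos r" "pos r < pos s"
    "{p, q, s} \<in> empty_triples" for q r s
  proof -
    obtain i j k A B C where T: "triangle i j k A B C" and eq: "{p, q, s} = {i, j, k}"
      using B(6) unfolding empty_triples_def by blast
    have r: "r \<in> I - {i, j, k}" using B eq by auto
    have vert: "Y \<in> {A, B, C}" if Y: "ev (F a) Y = 0" "ev (F b) Y = 0" and ab: "a \<in> {i, j, k}" "b \<in> {i, j, k}" "a \<noteq> b" for a b Y
    proof -
      have u: "Y = Z" if "ev (F a) Z = 0" "ev (F b) Z = 0" for Z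
        using common_point_unique[OF nonparallel] Y that ab T unfolding triangle_def by blast
      show ?thesis using ab T u[of A] u[of B] u[of C] unfolding triangle_def by auto
    qed
    have "q \<noteq> p" "s \<noteq> p" using B by auto
    have "X q \<in> {A, B, C}" by (rule vert[of p _ q]) (use X B eq \<open>q \<noteq> p\<close> in auto)
    moreover have "X s \<in> {A, B, C}" by (rule vert[of p _ s]) (use X B eq \<open>s \<noteq> p\<close> in auto)
    ultimately have "0 < ev (F r) (X q) * ev (F r) (X s)"
      using T r unfolding triangle_def by (auto simp: zero_less_mult_iff)
    then have "0 < (n \<bullet> n) * (n \<bullet> n) * (ev (F r) (X q) * ev (F r) (X s))" using n0 by simp
    also have "\<dots> = ((n \<bullet> n) * ev (F r) (X q)) * ((n \<bullet> n) * ev (F r) (X s))" by (simp add: algebra_simps)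
    also have "\<dots> = ((pos q - pos r) * (pos s - pos r)) * (fst (F r) \<bullet> v)\<^sup>2"
      unfolding evX[OF B(1,2)] evX[OF B(3,2)] by (simp add: power2_eq_square)
    also have "\<dots> \<le> 0" using B by (intro mult_nonpos_nonneg mult_nonpos_nonneg) auto
    finally show False by simp
  qed
  let ?E = "{T \<in> empty_triples. p \<in> T}"
  have ex: "\<forall>T\<in>?E. \<exists>q r. q \<in> I - {p} \<and> r \<in> I - {p} \<and> pos q < pos r \<and> T = {p, q, r}"
  proof
    fix T assume "T \<in> ?E"
    then obtain q r where "T = {p, q, r}" "q \<in> I - {p}" "r \<in> I - {p}" "q \<noteq> r"
      unfolding empty_triples_def triangle_def by auto
    then show "\<exists>q r. q \<in> I - {p} \<and> r \<in> I - {p} \<and> pos q < pos r \<and> T = {p, q, r}"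
      using pos_ne[of q r] by (metis insert_commute linorder_neqE_linordered_idom)
  qed
  obtain lo hi where lh: "\<And>T. T \<in> ?E \<Longrightarrow> lo T \<in> I - {p} \<and> hi T \<in> I - {p} \<and> pos (lo T) < pos (hi T) \<and> T = {p, lo T, hi T}"
  proof -
    from bchoice[OF ex] obtain lo where "\<forall>T\<in>?E. \<exists>r. lo T \<in> I - {p} \<and> r \<in> I - {p} \<and> pos (lo T) < pos r \<and> T = {p, lo T, r}" by blast
    from bchoice[OF this] show ?thesis using that by blast
  qed
  \<comment> \<open>With a common lower end, the nearer of two upper ends would lie strictly between
    the ends of the other triple.\<close>
  have inj: "inj_on lo ?E"
  proof (rule inj_onI)
    fix T T' assume T: "T \<in> ?E" "T' \<in> ?E" "lo T = lo T'"
    have "hi T = hi T'"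
    proof (rule ccontr)
      assume ne: "hi T \<noteq> hi T'"
      have "{p, lo T, hi T} \<in> empty_triples" "{p, lo T, hi T'} \<in> empty_triples" using lh T by force+
      then show False
        using between[of "lo T" "hi T" "hi T'"] between[of "lo T" "hi T'" "hi T"] pos_ne[of "hi T" "hi T'"] lh T ne
        by (metis linorder_neqE_linordered_idom)
    qed
    then show "T = T'" using lh T by metis
  qed
  have fin: "finite (I - {p})" using finite_index by simp
  have ne: "I - {p} \<noteq> {}" using False lh by blast
  obtain M where M: "M \<in> I - {p}" "\<And>q. q \<in> I - {p} \<Longrightarrow> pos q \<le> pos M"
  proof -
    have "Max (pos ` (I - {p})) \<in> pos ` (I - {p})" using fin ne by (intro Max_in) auto
    then obtain M where "M \<in> I - {p}" "pos M = Max (pos ` (I - {p}))" by (metis imageE)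
    then show ?thesis using that fin by simp
  qed
  have "lo ` ?E \<subseteq> I - {p} - {M}"
  proof
    fix q assume "q \<in> lo ` ?E"
    then obtain T where T: "T \<in> ?E" "q = lo T" by auto
    then show "q \<in> I - {p} - {M}" using lh[OF T(1)] M(2)[of "hi T"] by auto
  qed
  then have "card ?E \<le> card (I - {p} - {M})" using inj fin by (intro card_inj_on_le) auto
  also have "\<dots> = card I - 2" using M(1) p fin by simp
  finally show ?thesis .
qed (metis card.empty zero_le)

lemma card_empty_triples_le: "3 * card empty_triples \<le> card I * (card I - 2)"
proof -
  have "3 * card empty_triples = (\<Sum>T\<in>empty_triples. 3)" by simp
  also have "\<dots> = (\<Sum>p\<in>I. card {T \<in> empty_triples. p \<in> T})"
  proof (rule sum_multicount_gen[symmetric])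
    show "\<forall>T\<in>empty_triples. card {i \<in> I. i \<in> T} = 3"
    proof
      fix T assume "T \<in> empty_triples"
      then obtain i j k where "T = {i, j, k}" "{i, j, k} \<subseteq> I" "i \<noteq> j" "j \<noteq> k" "i \<noteq> k"
        by (auto simp: empty_triples_def triangle_def)
      moreover from this have "{i \<in> I. i \<in> T} = {i, j, k}" by auto
      ultimately show "card {i \<in> I. i \<in> T} = 3" by simp
    qed
  qed (use finite_index finite_empty_triples in auto)
  also have "\<dots> \<le> (\<Sum>p\<in>I. card I - 2)" by (intro sum_mono card_triples_on_line)
  finally show ?thesis by simp
qed

end

section \<open>Arrangements crossing an axis at prescribed points\<close>

definition same_sign :: "real \<Rightarrow> real \<Rightarrow> real \<Rightarrow> bool" where
  "same_sign u v w \<longleftrightarrow> (0 < u \<and> 0 < v \<and> 0 < w) \<or> (u < 0 \<and> v < 0 \<and> w < 0)"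

lemma same_sign_mult_pos: "0 < r \<Longrightarrow> same_sign (r * u) (r * v) (r * w) \<longleftrightarrow> same_sign u v w"
  by (auto simp: same_sign_def zero_less_mult_iff mult_less_0_iff)

text \<open>The line is x = a + c y: a is its crossing with the axis y = 0 and c its tilt from the
  vertical. A positive value means that the point lies to the right of the line.\<close>

definition ell :: "real \<Rightarrow> real \<Rightarrow> real \<times> real \<Rightarrow> real" where
  "ell a c P = fst P - a - c * snd P"

text \<open>The axis has no index; the condition on the heights treats it as one more line that must
  miss the triangle.\<close>

definition empty_triangle :: "nat \<Rightarrow> (nat \<Rightarrow> real) \<Rightarrow> (nat \<Rightarrow> real) \<Rightarrow> nat \<Rightarrow> nat \<Rightarrow> nat \<Rightarrow> bool" where
  "empty_triangle m a c i j k \<longleftrightarrow> {i, j, k} \<subseteq> {1..m} \<and> i \<noteq> j \<and> j \<noteq> k \<and> i \<noteq> k \<and> (\<exists>A B C.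
     ell (a j) (c j) A = 0 \<and> ell (a k) (c k) A = 0 \<and>
     ell (a i) (c i) B = 0 \<and> ell (a k) (c k) B = 0 \<and>
     ell (a i) (c i) C = 0 \<and> ell (a j) (c j) C = 0 \<and>
     same_sign (snd A) (snd B) (snd C) \<and>
     (\<forall>q \<in> {1..m} - {i, j, k}. same_sign (ell (a q) (c q) A) (ell (a q) (c q) B) (ell (a q) (c q) C)))"

lemma empty_triangleI:
  assumes "{i, j, k} \<subseteq> {1..m}" "i \<noteq> j" "j \<noteq> k" "i \<noteq> k"
    "ell (a j) (c j) A = 0" "ell (a k) (c k) A = 0" "ell (a i) (c i) B = 0" "ell (a k) (c k) B = 0"
    "ell (a i) (c i) C = 0" "ell (a j) (c j) C = 0" "same_sign (snd A) (snd B) (snd C)"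
    "\<And>q. q \<in> {1..m} - {i, j, k} \<Longrightarrow> same_sign (ell (a q) (c q) A) (ell (a q) (c q) B) (ell (a q) (c q) C)"
  shows "empty_triangle m a c i j k"
  unfolding empty_triangle_def
  by (intro conjI, (fact assms)+, rule exI[of _ A], rule exI[of _ B], rule exI[of _ C]) (intro conjI ballI assms)

text \<open>Lines i, i + 1 and the axis bound an empty triangle with apex W: every other line passes
  W on the same side as it passes their two points on the axis. The parity records the alternation
  above and below the axis.\<close>

definition apex :: "nat \<Rightarrow> (nat \<Rightarrow> real) \<Rightarrow> (nat \<Rightarrow> real) \<Rightarrow> nat \<Rightarrow> bool" where
  "apex m a c i \<longleftrightarrow> (\<exists>W. ell (a i) (c i) W = 0 \<and> ell (a (i + 1)) (c (i + 1)) W = 0 \<and>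
     (if odd i then 0 < snd W else snd W < 0) \<and>
     (\<forall>q \<in> {1..m}. (q < i \<longrightarrow> 0 < ell (a q) (c q) W) \<and> (i + 1 < q \<longrightarrow> ell (a q) (c q) W < 0)))"

text \<open>The induction invariant. The counted triples avoid the axis; \<open>apex\<close>
  supplies m - 1 more triangles, for a total of at least (m^2 - 3)/3.\<close>

definition doublable :: "nat \<Rightarrow> (nat \<Rightarrow> real) \<Rightarrow> (nat \<Rightarrow> real) \<Rightarrow> bool" where
  "doublable m a c \<longleftrightarrow>
     (\<forall>i\<in>{1..m}. \<forall>j\<in>{1..m}. i < j \<longrightarrow> a i < a j \<and> c i \<noteq> c j) \<and>
     (\<forall>i\<in>{1..m}. \<forall>j\<in>{1..m}. \<forall>k\<in>{1..m}. \<forall>P. i < j \<longrightarrow> j < k \<longrightarrow>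
        \<not> (ell (a i) (c i) P = 0 \<and> ell (a j) (c j) P = 0 \<and> ell (a k) (c k) P = 0)) \<and>
     (\<forall>i\<in>{1..<m}. apex m a c i) \<and>
     (\<exists>\<T>. finite \<T> \<and> (\<forall>T\<in>\<T>. \<exists>i j k. T = {i, j, k} \<and> empty_triangle m a c i j k) \<and> m * (m - 3) \<le> 3 * card \<T>)"

lemma doublable_slopes:
  assumes "doublable m a c" "i \<in> {1..m}" "j \<in> {1..m}" "i < j"
  shows "a i < a j" "c i \<noteq> c j"
proof -
  have "\<forall>i\<in>{1..m}. \<forall>j\<in>{1..m}. i < j \<longrightarrow> a i < a j \<and> c i \<noteq> c j"
    using assms(1) unfolding doublable_def by (elim conjE) assumption
  then show "a i < a j" "c i \<noteq> c j" using assms(2-4) by auto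
qed

lemma doublable_not_concurrent:
  assumes "doublable m a c" "i \<in> {1..m}" "j \<in> {1..m}" "k \<in> {1..m}" "i < j" "j < k"
    "ell (a i) (c i) P = 0" "ell (a j) (c j) P = 0" "ell (a k) (c k) P = 0"
  shows False
proof -
  have "\<forall>i\<in>{1..m}. \<forall>j\<in>{1..m}. \<forall>k\<in>{1..m}. \<forall>P. i < j \<longrightarrow> j < k \<longrightarrow>
        \<not> (ell (a i) (c i) P = 0 \<and> ell (a j) (c j) P = 0 \<and> ell (a k) (c k) P = 0)"
    using assms(1) unfolding doublable_def by (elim conjE) assumption
  from this[rule_format, OF assms(2-6), of P] show False using assms(7-9) by simp
qed

lemma doublable_apex: "doublable m a c \<Longrightarrow> i \<in> {1..<m} \<Longrightarrow> apex m a c i"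
  unfolding doublable_def by (elim conjE) (rule bspec)

lemma doublable_triples:
  assumes "doublable m a c"
  obtains \<T> where "finite \<T>" "\<And>T. T \<in> \<T> \<Longrightarrow> \<exists>i j k. T = {i, j, k} \<and> empty_triangle m a c i j k" "m * (m - 3) \<le> 3 * card \<T>"
proof -
  have "\<exists>\<T>. finite \<T> \<and> (\<forall>T\<in>\<T>. \<exists>i j k. T = {i, j, k} \<and> empty_triangle m a c i j k) \<and> m * (m - 3) \<le> 3 * card \<T>"
    using assms unfolding doublable_def by (elim conjE) assumption
  then show ?thesis using that by (elim exE conjE) (simp add: Ball_def)
qed

section \<open>The doubling step\<close>

text \<open>The steep line j is x = a j + e j * y and the flat line k is y = \<mu> k * (x - b k); flat line 0 is the axis.
  The only combinatorial input is that the flat lines k and l meet strictly between the steep lines J and J + 1,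
  where J = k + l modulo m + 1. This forces every such vertex to be a corner of the two triangles cut off by
  these two steep lines.\<close>

locale doubling =
  fixes m :: nat and a b \<mu> e :: "nat \<Rightarrow> real" and V xP :: "nat \<Rightarrow> nat \<Rightarrow> real"
  assumes even_m: "even m" and m2: "4 \<le> m"
    and mu0: "\<mu> 0 = 0"
    and mu_neg: "k \<in> {1..m} \<Longrightarrow> \<mu> k < 0"
    and mu_inj: "\<lbrakk>k \<le> m; l \<le> m; k \<noteq> l\<rbrakk> \<Longrightarrow> \<mu> k \<noteq> \<mu> l"
    and b_mono: "\<lbrakk>1 \<le> k; k < l; l \<le> m\<rbrakk> \<Longrightarrow> b k < b l"
    and e_pos: "j \<in> {1..m} \<Longrightarrow> 0 < e j"
    and V_sym: "V k l = V l k"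
    and V_0: "k \<in> {1..m} \<Longrightarrow> V 0 k = b k"
    and V_common: "\<lbrakk>k \<le> m; l \<le> m; k \<noteq> l\<rbrakk> \<Longrightarrow> \<mu> k * (V k l - b k) = \<mu> l * (V k l - b l)"
    and xP_on: "\<lbrakk>k \<le> m; j \<in> {1..m}\<rbrakk> \<Longrightarrow> xP k j - a j - e j * (\<mu> k * (xP k j - b k)) = 0"
    and xP_mono: "\<lbrakk>k \<le> m; 1 \<le> i; i < j; j \<le> m\<rbrakk> \<Longrightarrow> xP k i < xP k j"
    and xP_less_V: "\<lbrakk>k \<le> m; l \<le> m; k \<noteq> l; 1 \<le> j; j \<le> (k + l) mod (m + 1)\<rbrakk> \<Longrightarrow> xP k j < V k l"
    and V_less_xP: "\<lbrakk>k \<le> m; l \<le> m; k \<noteq> l; (k + l) mod (m + 1) < j; j \<le> m\<rbrakk> \<Longrightarrow> V k l < xP k j"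
begin

section \<open>Coordinates and signs for flat and steep lines\<close>

definition flat :: "nat \<Rightarrow> real \<Rightarrow> real" where "flat k x = \<mu> k * (x - b k)"
definition g :: "nat \<Rightarrow> real \<times> real \<Rightarrow> real" where "g k P = snd P - flat k (fst P)"
definition L :: "nat \<Rightarrow> real \<times> real \<Rightarrow> real" where "L j P = ell (a j) (e j) P"
text \<open>Odd indices are steep lines and even ones flat lines, meant to interleave on the axis as
  a 1, b 1, a 2, b 2 and so on. For \<open>new_tilt\<close>, y = \<mu> (x - b) is rewritten as x = b
  + y / \<mu>.\<close>

definition new_pos :: "nat \<Rightarrow> real" where "new_pos i = (if odd i then a ((i + 1) div 2) else b (i div 2))"
definition new_tilt :: "nat \<Rightarrow> real" where "new_tilt i = (if odd i then e ((i + 1) div 2) else 1 / \<mu> (i div 2))"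
definition flat_vertex :: "nat \<Rightarrow> nat \<Rightarrow> real \<times> real" where "flat_vertex k l = (V k l, flat k (V k l))"
definition crossing :: "nat \<Rightarrow> nat \<Rightarrow> real \<times> real" where "crossing k j = (xP k j, flat k (xP k j))"

lemma ell_odd: "1 \<le> j \<Longrightarrow> ell (new_pos (2 * j - 1)) (new_tilt (2 * j - 1)) P = L j P"
proof -
  assume "1 \<le> j"
  then obtain i where "j = Suc i" by (cases j) auto
  then show ?thesis by (simp add: new_pos_def new_tilt_def L_def)
qed

text \<open>The factor is positive because \<mu> k < 0, so signs can be tracked through
  \<open>g k\<close>, which unlike the form x = a + c y also covers the axis, as
  \<open>g 0\<close>.\<close>

lemma ell_even: "k \<in> {1..m} \<Longrightarrow> ell (new_pos (2 * k)) (new_tilt (2 * k)) P = (1 / - \<mu> k) * g k P"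
  using mu_neg[of k] by (simp add: new_pos_def new_tilt_def ell_def g_def flat_def field_simps)

lemma index_cases:
  assumes "q \<in> {1..2 * m}"
  obtains (odd) j where "j \<in> {1..m}" "q = 2 * j - 1" | (even) k where "k \<in> {1..m}" "q = 2 * k"
proof (cases "odd q")
  case True
  then obtain i where "q = 2 * i + 1" by (auto elim: oddE)
  then show ?thesis using odd[of "i + 1"] assms by auto
next
  case False
  then obtain i where "q = 2 * i" by (auto elim: evenE)
  then show ?thesis using even[of i] assms by auto
qed

lemma g_0: "g 0 P = snd P" by (simp add: g_def flat_def mu0)

lemma g_on_M: "\<lbrakk>k \<le> m; p \<le> m; k \<noteq> p\<rbrakk> \<Longrightarrow> g p (x, flat k x) = (\<mu> k - \<mu> p) * (x - V k p)"
  using V_common[of k p] by (simp add: g_def flat_def algebra_simps)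

lemma g_self: "g k (x, flat k x) = 0" by (simp add: g_def)

lemma L_on_M:
  assumes "k \<le> m" "j \<in> {1..m}"
  shows "L j (x, flat k x) = (1 - e j * \<mu> k) * (x - xP k j)" and "0 < 1 - e j * \<mu> k"
proof -
  show "L j (x, flat k x) = (1 - e j * \<mu> k) * (x - xP k j)"
    using xP_on[OF assms] by (simp add: L_def ell_def flat_def algebra_simps)
  have "\<mu> k \<le> 0" using mu_neg[of k] mu0 assms by (cases "k = 0") (auto simp: less_imp_le)
  then have "e j * \<mu> k \<le> 0" using e_pos[of j] assms by (simp add: mult_nonneg_nonpos)
  then show "0 < 1 - e j * \<mu> k" by simp
qed

lemma L_crossing:
  assumes "k \<le> m" "j \<in> {1..m}" "i \<in> {1..m}"
  shows "i < j \<Longrightarrow> 0 < L i (crossing k j)" "i = j \<Longrightarrow> L i (crossing k j) = 0" "j < i \<Longrightarrow> L i (crossing k j) < 0"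
  using assms L_on_M[of k i] xP_mono[of k i j] xP_mono[of k j i] unfolding crossing_def
  by (auto simp: mult_less_0_iff)

lemma L_flat_vertex:
  assumes "k \<le> m" "l \<le> m" "k \<noteq> l" "j \<in> {1..m}"
  shows "j \<le> (k + l) mod (m + 1) \<Longrightarrow> 0 < L j (flat_vertex k l)" "(k + l) mod (m + 1) < j \<Longrightarrow> L j (flat_vertex k l) < 0"
  using assms L_on_M[of k j] xP_less_V[of k l j] V_less_xP[of k l j] unfolding flat_vertex_def
  by (auto simp: mult_less_0_iff)

lemma flat_vertex_sym: "\<lbrakk>k \<le> m; l \<le> m\<rbrakk> \<Longrightarrow> flat_vertex k l = flat_vertex l k"
  using V_common[of k l] V_sym[of k l] by (cases "k = l") (auto simp: flat_vertex_def flat_def)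

text \<open>For fixed k, different partners in 0..m, the axis included, meet flat line k in
  different gaps between steep lines.\<close>

lemma mod_add_inj:
  assumes "p \<le> m" "q \<le> m" "(k + p) mod (m + 1) = (k + q) mod (m + 1)"
  shows "p = q"
proof -
  have *: "p = q" if "q \<le> p" "p \<le> m" "(k + p) mod (m + 1) = (k + q) mod (m + 1)" for p q
  proof -
    have "m + 1 dvd (k + p) - (k + q)" using that mod_eq_dvd_iff_nat[of "k + q" "k + p" "m + 1"] by simp
    then have "m + 1 dvd p - q" by simp
    then have "p - q = 0 \<or> m + 1 \<le> p - q" using dvd_imp_le by blast
    then show ?thesis using that by auto
  qed
  show ?thesis using *[of q p] *[of p q] assms by (cases "q \<le> p") auto
qed

text \<open>The steep lines cut flat line k into closed cells, numbered by the steep line on their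
  left; cells 0 and m are unbounded. The vertex with p lies strictly inside its own cell, hence not
  between two points of another cell J.\<close>

lemma V_separated:
  assumes "k \<le> m" "p \<le> m" "k \<noteq> p" and J: "J \<le> m" "(k + p) mod (m + 1) \<noteq> J"
    and x: "J \<noteq> 0 \<Longrightarrow> xP k J \<le> x" "J < m \<Longrightarrow> x \<le> xP k (J + 1)"
    and y: "J \<noteq> 0 \<Longrightarrow> xP k J \<le> y" "J < m \<Longrightarrow> y \<le> xP k (J + 1)"
  shows "V k p < x \<and> V k p < y \<or> x < V k p \<and> y < V k p"
proof -
  let ?K = "(k + p) mod (m + 1)"
  have K: "?K \<le> m" using pos_mod_bound[of "int m + 1"] by (simp add: less_Suc_eq_le[symmetric])
  consider "?K < J" | "J < ?K" using J by linarith
  then show ?thesis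
  proof cases
    case 1
    then have "V k p < xP k J" using V_less_xP[of k p J] assms by auto
    then show ?thesis using x y 1 by auto
  next
    case 2
    then have "xP k (J + 1) < V k p" using xP_less_V[of k p "J + 1"] assms by auto
    then show ?thesis using x y 2 K by auto
  qed
qed

lemma g_same_on_M:
  assumes "k \<le> m" "p \<le> m" "k \<noteq> p" and "V k p < x \<and> V k p < y \<or> x < V k p \<and> y < V k p"
  shows "0 < g p (x, flat k x) * g p (y, flat k y)"
proof -
  have "g p (x, flat k x) * g p (y, flat k y) = (\<mu> k - \<mu> p)\<^sup>2 * ((x - V k p) * (y - V k p))"
    unfolding g_on_M[OF assms(1-3)] by (simp add: power2_eq_square)
  moreover have "0 < (\<mu> k - \<mu> p)\<^sup>2" using mu_inj[OF assms(1-3)] by simp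
  moreover have "0 < (x - V k p) * (y - V k p)" using assms(4) by (auto simp: zero_less_mult_iff)
  ultimately show ?thesis by simp
qed

lemma same_signI: "0 < u * v \<Longrightarrow> 0 < u * w \<Longrightarrow> same_sign u v w"
  by (auto simp: same_sign_def zero_less_mult_iff)

text \<open>On line k the vertex and the crossing with j both lie in the closed cell J, while p
  meets k in a different cell because p is not l. The same argument on line l links the third corner
  through the vertex.\<close>

lemma vertex_triangle_M:
  assumes k: "k \<le> m" "l \<le> m" "k \<noteq> l" and J: "J = (k + l) mod (m + 1)" and j: "j \<in> {1..m}" "j = J \<or> j = J + 1"
    and p: "p \<le> m" "p \<noteq> k" "p \<noteq> l"
  shows "same_sign (g p (flat_vertex k l)) (g p (crossing k j)) (g p (crossing l j))"
proof -
  have Jm: "J \<le> m" unfolding J by (simp add: less_Suc_eq_le[symmetric])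
  have half: "0 < g p (flat_vertex k l) * g p (crossing k j)"
    if k: "k \<le> m" "l \<le> m" "k \<noteq> l" "J = (k + l) mod (m + 1)" "p \<noteq> k" "p \<noteq> l" for k l
    unfolding flat_vertex_def crossing_def
  proof (rule g_same_on_M)
    show "V k p < V k l \<and> V k p < xP k j \<or> V k l < V k p \<and> xP k j < V k p"
    proof (rule V_separated[where J = J])
      show "(k + p) mod (m + 1) \<noteq> J" using mod_add_inj[of p l k] k p by auto
      show "J \<noteq> 0 \<Longrightarrow> xP k J \<le> V k l" using xP_less_V[of k l J] k Jm by force
      show "J < m \<Longrightarrow> V k l \<le> xP k (J + 1)" using V_less_xP[of k l "J + 1"] k by force
      show "J \<noteq> 0 \<Longrightarrow> xP k J \<le> xP k j" using xP_mono[of k J j] k j by fastforce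
      show "J < m \<Longrightarrow> xP k j \<le> xP k (J + 1)" using xP_mono[of k j "J + 1"] k j by fastforce
    qed (use k p Jm in auto)
  qed (use k p in auto)
  have "0 < g p (flat_vertex k l) * g p (crossing k j)" using half[of k l] assms by auto
  moreover have "0 < g p (flat_vertex k l) * g p (crossing l j)"
    using half[of l k] flat_vertex_sym[of k l] assms by (auto simp: add.commute)
  ultimately show ?thesis by (rule same_signI)
qed

lemma vertex_triangle_L:
  assumes k: "k \<le> m" "l \<le> m" "k \<noteq> l" and J: "J = (k + l) mod (m + 1)" and j: "j \<in> {1..m}" "j = J \<or> j = J + 1"
    and q: "q \<in> {1..m}" "q \<noteq> j"
  shows "same_sign (L q (flat_vertex k l)) (L q (crossing k j)) (L q (crossing l j))"
proof (cases "q < j")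
  case True
  then show ?thesis using L_flat_vertex[of k l q] L_crossing[of k j q] L_crossing[of l j q] assms by (auto simp: same_sign_def)
next
  case False
  then show ?thesis using L_flat_vertex[of k l q] L_crossing[of k j q] L_crossing[of l j q] assms by (auto simp: same_sign_def)
qed

text \<open>The other lines split into steep ones, flat ones and the axis; k = 0 is always among the
  lines to be checked because the axis is never a side.\<close>

lemma empty_triangle_newI:
  assumes T: "{x, y, z} \<subseteq> {1..2 * m}" "x \<noteq> y" "y \<noteq> z" "x \<noteq> z"
    and inc: "ell (new_pos y) (new_tilt y) A = 0" "ell (new_pos z) (new_tilt z) A = 0" "ell (new_pos x) (new_tilt x) B = 0"
      "ell (new_pos z) (new_tilt z) B = 0" "ell (new_pos x) (new_tilt x) C = 0" "ell (new_pos y) (new_tilt y) C = 0"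
    and sL: "\<And>j. j \<in> {1..m} \<Longrightarrow> 2 * j - 1 \<notin> {x, y, z} \<Longrightarrow> same_sign (L j A) (L j B) (L j C)"
    and sM: "\<And>k. k \<le> m \<Longrightarrow> k = 0 \<or> 2 * k \<notin> {x, y, z} \<Longrightarrow> same_sign (g k A) (g k B) (g k C)"
  shows "empty_triangle (2 * m) new_pos new_tilt x y z"
  unfolding empty_triangle_def
proof (intro conjI exI ballI)
  show "same_sign (snd A) (snd B) (snd C)" using sM[of 0] by (simp add: g_0)
  fix q assume q: "q \<in> {1..2 * m} - {x, y, z}"
  then have "q \<in> {1..2 * m}" by auto
  then show "same_sign (ell (new_pos q) (new_tilt q) A) (ell (new_pos q) (new_tilt q) B) (ell (new_pos q) (new_tilt q) C)"
  proof (cases rule: index_cases)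
    case (odd j)
    then have "same_sign (L j A) (L j B) (L j C)" "1 \<le> j" using sL[of j] q by auto
    then show ?thesis unfolding odd(2) by (simp only: ell_odd)
  next
    case (even k)
    then have "same_sign (g k A) (g k B) (g k C)" using sM[of k] q by auto
    moreover have "0 < 1 / - \<mu> k" using mu_neg[of k] even by simp
    ultimately show ?thesis using even by (simp only: ell_even same_sign_mult_pos)
  qed
qed (use T inc in auto)

lemma empty_triangle_vertex:
  assumes k: "k \<in> {1..m}" "l \<in> {1..m}" "k \<noteq> l" and j: "j \<in> {1..m}"
    and J: "j = (k + l) mod (m + 1) \<or> j = (k + l) mod (m + 1) + 1"
  shows "empty_triangle (2 * m) new_pos new_tilt (2 * j - 1) (2 * k) (2 * l)"
proof (rule empty_triangle_newI)
  have odd: "2 * j - 1 \<noteq> 2 * r" for r using j by presburger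
  show "{2 * j - 1, 2 * k, 2 * l} \<subseteq> {1..2 * m}" "2 * j - 1 \<noteq> 2 * k" "2 * k \<noteq> 2 * l" "2 * j - 1 \<noteq> 2 * l"
    using k j odd by auto
  have kl: "k \<le> m" "l \<le> m" using k by auto
  have j1: "1 \<le> j" using j by simp
  show "ell (new_pos (2 * k)) (new_tilt (2 * k)) (flat_vertex k l) = 0" "ell (new_pos (2 * l)) (new_tilt (2 * l)) (flat_vertex k l) = 0"
    using k flat_vertex_sym[OF kl] g_self[of k "V k l"] g_self[of l "V l k"] by (auto simp: ell_even flat_vertex_def)
  show "ell (new_pos (2 * j - 1)) (new_tilt (2 * j - 1)) (crossing l j) = 0" "ell (new_pos (2 * l)) (new_tilt (2 * l)) (crossing l j) = 0"
    "ell (new_pos (2 * j - 1)) (new_tilt (2 * j - 1)) (crossing k j) = 0" "ell (new_pos (2 * k)) (new_tilt (2 * k)) (crossing k j) = 0"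
    unfolding ell_odd[OF j1] ell_even[OF k(1)] ell_even[OF k(2)]
    using k j L_crossing(2)[of l j j] L_crossing(2)[of k j j] by (auto simp: crossing_def g_self)
  show "same_sign (L q (flat_vertex k l)) (L q (crossing l j)) (L q (crossing k j))" if "q \<in> {1..m}" "2 * q - 1 \<notin> {2 * j - 1, 2 * k, 2 * l}" for q
    using vertex_triangle_L[of k l "(k + l) mod (m + 1)" j q] that assms by (auto simp: same_sign_def)
  show "same_sign (g p (flat_vertex k l)) (g p (crossing l j)) (g p (crossing k j))" if "p \<le> m" "p = 0 \<or> 2 * p \<notin> {2 * j - 1, 2 * k, 2 * l}" for p
    using vertex_triangle_M[of k l "(k + l) mod (m + 1)" j p] that assms by (auto simp: same_sign_def)
qed

text \<open>The triangle of the axis, flat line l and steep line l or l + 1 is the vertex triangle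
  of the pair 0, l, whose cell is l. At its corner (b l, 0) the signs of the other flat lines follow
  from the order of the points b, and emptiness carries them over to the apex.\<close>

lemma apex_new_vertex:
  assumes l: "l \<in> {1..m}" and j: "j \<in> {1..m}" "j = l \<or> j = l + 1"
  shows "p \<in> {1..m} \<Longrightarrow> p < l \<Longrightarrow> 0 < g p (crossing l j)" "p \<in> {1..m} \<Longrightarrow> l < p \<Longrightarrow> g p (crossing l j) < 0"
    "j = l \<Longrightarrow> 0 < snd (crossing l j)" "j = l + 1 \<Longrightarrow> snd (crossing l j) < 0"
proof -
  have J: "(0 + l) mod (m + 1) = l" using l by simp
  have V: "flat_vertex 0 l = (b l, 0)" using V_0[OF l] by (simp add: flat_vertex_def flat_def mu0)
  have gp: "g p (b l, 0) = - \<mu> p * (b l - b p)" for p by (simp add: g_def flat_def)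
  have s: "same_sign (g p (b l, 0)) (g p (crossing 0 j)) (g p (crossing l j))" if "p \<in> {1..m}" "p \<noteq> l" for p
    using vertex_triangle_M[of 0 l l j p] that l j J V by auto
  show "0 < g p (crossing l j)" if p: "p \<in> {1..m}" "p < l"
  proof -
    have "0 < g p (b l, 0)" unfolding gp using mu_neg[OF p(1)] b_mono[of p l] p l by (simp add: mult_neg_pos)
    then show ?thesis using s[of p] p by (auto simp: same_sign_def)
  qed
  show "g p (crossing l j) < 0" if p: "p \<in> {1..m}" "l < p"
  proof -
    have "g p (b l, 0) < 0" unfolding gp using mu_neg[OF p(1)] b_mono[of l p] p l
      by (simp add: mult_pos_neg mult_neg_neg)
    then show ?thesis using s[of p] p by (auto simp: same_sign_def)
  qed
  have sin_step: "snd (crossing l j) = \<mu> l * (xP l j - b l)" by (simp add: crossing_def flat_def)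
  have Vl: "V l 0 = b l" using V_0[OF l] V_sym[of 0 l] by simp
  show "0 < snd (crossing l j)" if "j = l"
    unfolding sin_step using mu_neg[OF l] xP_less_V[of l 0 l] Vl l that by (auto simp: mult_neg_neg)
  show "snd (crossing l j) < 0" if "j = l + 1"
    unfolding sin_step using mu_neg[OF l] V_less_xP[of l 0 "l + 1"] Vl l j that by (auto simp: mult_neg_pos)
qed

text \<open>Consecutive new lines are flat line l with either steep line l on its left, giving an
  apex above the axis, or steep line l + 1 on its right, giving one below.\<close>

lemma apex_new_arrangement:
  assumes i: "i \<in> {1..<2 * m}"
  shows "apex (2 * m) new_pos new_tilt i"
proof -
  obtain l j where lj: "l \<in> {1..m}" "j \<in> {1..m}" "j = l \<and> i = 2 * l - 1 \<or> j = l + 1 \<and> i = 2 * l"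
  proof -
    from i have "i \<in> {1..2 * m}" by auto
    then show ?thesis
    proof (cases rule: index_cases)
      case (odd j) then show ?thesis using that[of j j] by auto
    next
      case (even k) then show ?thesis using that[of k "k + 1"] i by auto
    qed
  qed
  have j: "j = l \<or> j = l + 1" and j1: "1 \<le> j" using lj by auto
  note A = apex_new_vertex[OF lj(1,2) j]
  have ii: "{i, i + 1} = {2 * l, 2 * j - 1}" using lj by auto
  have inc: "ell (new_pos (2 * l)) (new_tilt (2 * l)) (crossing l j) = 0" "ell (new_pos (2 * j - 1)) (new_tilt (2 * j - 1)) (crossing l j) = 0"
    unfolding ell_odd[OF j1] ell_even[OF lj(1)] using lj L_crossing(2)[of l j j] by (auto simp: crossing_def g_self)
  have "ell (new_pos i) (new_tilt i) (crossing l j) = 0" "ell (new_pos (i + 1)) (new_tilt (i + 1)) (crossing l j) = 0"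
    using inc ii by (metis insert_iff singletonD)+
  moreover have "if odd i then 0 < snd (crossing l j) else snd (crossing l j) < 0"
    using A lj by auto
  moreover have "(q < i \<longrightarrow> 0 < ell (new_pos q) (new_tilt q) (crossing l j)) \<and> (i + 1 < q \<longrightarrow> ell (new_pos q) (new_tilt q) (crossing l j) < 0)"
    if "q \<in> {1..2 * m}" for q
    using that
  proof (cases rule: index_cases)
    case (odd r)
    have "q < i \<Longrightarrow> r < j" "i + 1 < q \<Longrightarrow> j < r" using odd lj by auto
    moreover have "1 \<le> r" using odd by simp
    ultimately show ?thesis unfolding odd(2) ell_odd[OF \<open>1 \<le> r\<close>]
      using L_crossing[of l j r] lj odd by auto
  next
    case (even r)
    have "q < i \<Longrightarrow> r < l" "i + 1 < q \<Longrightarrow> l < r" using even lj by auto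
    then show ?thesis using A(1,2)[of r] even mu_neg[of r] by (auto simp: ell_even divide_less_0_iff zero_less_divide_iff)
  qed
  ultimately show ?thesis unfolding apex_def by blast
qed

text \<open>The flat line with index p, where 2p = i modulo m + 1, is the only one that meets no other flat line
  between the steep lines i and i + 1; hence it is extremal there and takes over the role of the axis in the
  old triangle that the axis formed with these two steep lines.\<close>

lemma empty_triangle_flat_edge:
  assumes i: "i \<in> {1..<m}" and p: "p \<in> {1..m}" "(2 * p) mod (m + 1) = i"
    and W: "L i W = 0" "L (i + 1) W = 0"
      "\<And>q. q \<in> {1..m} \<Longrightarrow> q < i \<Longrightarrow> 0 < L q W" "\<And>q. q \<in> {1..m} \<Longrightarrow> i + 1 < q \<Longrightarrow> L q W < 0"
    and gW: "\<And>q. q \<le> m \<Longrightarrow> if odd i then 0 < g q W else g q W < 0"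
    and x: "xP p i < x" "x < xP p (i + 1)"
    and top: "\<And>q. q \<le> m \<Longrightarrow> q \<noteq> p \<Longrightarrow> if odd i then flat q x < flat p x else flat p x < flat q x"
  shows "empty_triangle (2 * m) new_pos new_tilt (2 * p) (2 * i - 1) (2 * (i + 1) - 1)"
proof (rule empty_triangle_newI)
  have "1 \<le> i" using i by simp
  then have odd: "2 * p \<noteq> 2 * i - 1" "2 * p \<noteq> 2 * (i + 1) - 1" using \<open>1 \<le> i\<close> by presburger+
  show "{2 * p, 2 * i - 1, 2 * (i + 1) - 1} \<subseteq> {1..2 * m}" "2 * p \<noteq> 2 * i - 1" "2 * i - 1 \<noteq> 2 * (i + 1) - 1"
    "2 * p \<noteq> 2 * (i + 1) - 1"
    using i p odd by auto
  have i1: "i \<in> {1..m}" "i + 1 \<in> {1..m}" "1 \<le> i" "1 \<le> i + 1" "p \<le> m" using i p by auto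
  show "ell (new_pos (2 * i - 1)) (new_tilt (2 * i - 1)) W = 0" "ell (new_pos (2 * (i + 1) - 1)) (new_tilt (2 * (i + 1) - 1)) W = 0"
    unfolding ell_odd[OF i1(3)] ell_odd[OF i1(4)] by (fact W)+
  show "ell (new_pos (2 * p)) (new_tilt (2 * p)) (crossing p (i + 1)) = 0" "ell (new_pos (2 * p)) (new_tilt (2 * p)) (crossing p i) = 0"
    unfolding ell_even[OF p(1)] by (auto simp: crossing_def g_self)
  show "ell (new_pos (2 * (i + 1) - 1)) (new_tilt (2 * (i + 1) - 1)) (crossing p (i + 1)) = 0"
    "ell (new_pos (2 * i - 1)) (new_tilt (2 * i - 1)) (crossing p i) = 0"
    unfolding ell_odd[OF i1(3)] ell_odd[OF i1(4)] using L_crossing(2) i1 by auto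
  show "same_sign (L j W) (L j (crossing p (i + 1))) (L j (crossing p i))"
    if "j \<in> {1..m}" "2 * j - 1 \<notin> {2 * p, 2 * i - 1, 2 * (i + 1) - 1}" for j
  proof -
    have "j \<noteq> i" "j \<noteq> i + 1" using that by auto
    then consider "j < i" | "i + 1 < j" by linarith
    then show ?thesis
      using W(3,4)[of j] L_crossing[of p i j] L_crossing[of p "i + 1" j] i1 that by cases (auto simp: same_sign_def)
  qed
  show "same_sign (g q W) (g q (crossing p (i + 1))) (g q (crossing p i))"
    if q: "q \<le> m" "q = 0 \<or> 2 * q \<notin> {2 * p, 2 * i - 1, 2 * (i + 1) - 1}" for q
  proof -
    have qp: "q \<noteq> p" using q p by auto
    have K: "(p + q) mod (m + 1) \<noteq> i" using mod_add_inj[of q p p] q p qp by (auto simp: mult_2)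
    have "xP p i < xP p (i + 1)" using x by simp
    then have sep: "V p q < x \<and> V p q < y \<or> x < V p q \<and> y < V p q" if "y = xP p i \<or> y = xP p (i + 1)" for y
      using that x i i1 q qp K by (intro V_separated[where J = i]) auto
    \<comment> \<open>The sign of \<open>g q\<close> is constant along this edge of the triangle, so
      the single abscissa x decides it at both corners.\<close>
    have gx: "if odd i then 0 < g q (x, flat p x) else g q (x, flat p x) < 0"
      using top[OF q(1) qp] by (auto simp: g_def)
    have "0 < g q (x, flat p x) * g q (crossing p i)" "0 < g q (x, flat p x) * g q (crossing p (i + 1))"
      unfolding crossing_def using sep i1 q qp by (auto intro!: g_same_on_M)
    then show ?thesis using gx gW[OF q(1)] by (auto simp: same_sign_def zero_less_mult_iff split: if_splits)
  qed
qed

section \<open>Excluding concurrent lines\<close>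

lemma not_concurrent_MM:
  assumes "k \<in> {1..m}" "l \<in> {1..m}" "k \<noteq> l" "g k P = 0" "g l P = 0"
  shows "P = flat_vertex k l"
proof -
  have P: "P = (fst P, flat k (fst P))" using assms(4) by (simp add: g_def prod_eq_iff)
  have "g l (fst P, flat k (fst P)) = 0" using P assms(5) by metis
  then have "fst P = V k l" using g_on_M[of k l "fst P"] mu_inj[of k l] assms by auto
  then show ?thesis using P unfolding flat_vertex_def by metis
qed

text \<open>Line k would meet l and q in the same point, although these two vertices lie in
  different cells and a steep line separates them.\<close>

lemma not_concurrent_MMM:
  assumes "k \<in> {1..m}" "l \<in> {1..m}" "q \<in> {1..m}" "k \<noteq> l" "l \<noteq> q" "k \<noteq> q" "g k P = 0" "g l P = 0"
  shows "g q P \<noteq> 0"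
proof
  assume "g q P = 0"
  then have "flat_vertex k l = flat_vertex k q" using not_concurrent_MM[of k l P] not_concurrent_MM[of k q P] assms by simp
  then have e: "V k l = V k q" by (simp add: flat_vertex_def)
  let ?J = "(k + l) mod (m + 1)" and ?K = "(k + q) mod (m + 1)"
  have "?J \<noteq> ?K" using mod_add_inj[of l q k] assms by auto
  moreover have "?J \<le> m" "?K \<le> m" by (simp_all add: less_Suc_eq_le[symmetric])
  ultimately consider "?J < ?K" | "?K < ?J" by linarith
  then show False
    using xP_less_V[of k q ?K] V_less_xP[of k l ?K] xP_less_V[of k l ?J] V_less_xP[of k q ?J] e assms
      \<open>?J \<le> m\<close> \<open>?K \<le> m\<close>
    by cases auto
qed

lemma not_concurrent_MML:
  assumes "k \<in> {1..m}" "l \<in> {1..m}" "k \<noteq> l" "j \<in> {1..m}" "g k P = 0" "g l P = 0"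
  shows "L j P \<noteq> 0"
  using not_concurrent_MM[of k l P] L_flat_vertex[of k l j] assms by (cases "j \<le> (k + l) mod (m + 1)") auto

end

section \<open>Counting the triangles after doubling\<close>

lemma pair_set_card: "2 * card {(k, l). 1 \<le> k \<and> k < l \<and> l \<le> (m::nat)} = m * (m - 1)"
proof (induction m)
  case 0
  have "{(k, l). 1 \<le> k \<and> k < l \<and> l \<le> (0::nat)} = {}" by auto
  then show ?case by (simp only: card.empty)
next
  case (Suc m)
  let ?P = "\<lambda>m. {(k, l). 1 \<le> k \<and> k < l \<and> l \<le> (m::nat)}"
  have "?P (Suc m) = ?P m \<union> {1..m} \<times> {Suc m}" by auto
  moreover have "finite (?P m)" by (rule finite_subset[of _ "{..m} \<times> {..m}"]) auto
  moreover have "?P m \<inter> {1..m} \<times> {Suc m} = {}" by auto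
  ultimately have "card (?P (Suc m)) = card (?P m) + m" by (simp add: card_Un_disjoint card_cartesian_product)
  then have "2 * card (?P (Suc m)) = m * (m - 1) + 2 * m" using Suc by simp
  also have "\<dots> = Suc m * (Suc m - 1)" by (cases m) auto
  finally show ?case .
qed

context doubling
begin

text \<open>Half of i modulo the odd number m + 1, as a representative between 1 and m.\<close>

definition mid_index :: "nat \<Rightarrow> nat" where
  "mid_index i = (if even i then i div 2 else (i + m + 1) div 2)"

lemma mid_index:
  assumes "i \<in> {1..<m}"
  shows "mid_index i \<in> {1..m}" "(2 * mid_index i) mod (m + 1) = i"
proof -
  show "mid_index i \<in> {1..m}" using assms even_m by (auto simp: mid_index_def elim!: evenE oddE)
  show "(2 * mid_index i) mod (m + 1) = i"
  proof (cases "even i")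
    case True then show ?thesis using assms by (simp add: mid_index_def)
  next
    case False
    then have "2 * mid_index i = i + (m + 1)" using even_m by (auto simp: mid_index_def elim!: evenE oddE)
    then have "(2 * mid_index i) mod (m + 1) = i mod (m + 1)" by (simp only: mod_add_self2)
    then show ?thesis using assms by simp
  qed
qed

lemma even_part_subset: "{x \<in> {2 * j - 1, 2 * k, 2 * l}. even x} = {2 * k, 2 * l}" if "1 \<le> j" for j k l :: nat
  using that by auto

definition vertex_set :: "(nat \<times> nat) \<times> nat \<Rightarrow> nat set" where
  "vertex_set = (\<lambda>((k, l), j). {2 * j - 1, 2 * k, 2 * l})"

text \<open>The order k < l lists each vertex once; the bounds on j drop the missing steep neighbour
  of a vertex in one of the two unbounded cells.\<close>

definition vertex_index :: "((nat \<times> nat) \<times> nat) set" where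
  "vertex_index = {((k, l), j). 1 \<le> k \<and> k < l \<and> l \<le> m \<and> 1 \<le> j \<and> j \<le> m \<and>
           (j = (k + l) mod (m + 1) \<or> j = (k + l) mod (m + 1) + 1)}"

lemma inj_on_vertex_set: "inj_on vertex_set vertex_index"
proof (rule inj_onI)
  fix p q assume p: "p \<in> vertex_index" and q: "q \<in> vertex_index" and e: "vertex_set p = vertex_set q"
  obtain k l j where 1: "p = ((k, l), j)" "k < l" "1 \<le> j" using p by (auto simp: vertex_index_def)
  obtain k' l' j' where 2: "q = ((k', l'), j')" "k' < l'" "1 \<le> j'" using q by (auto simp: vertex_index_def)
  have e: "{2 * j - 1, 2 * k, 2 * l} = {2 * j' - 1, 2 * k', 2 * l'}" using e 1 2 by (simp add: vertex_set_def)
  have "{2 * k, 2 * l} = {2 * k', 2 * l'}"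
    using arg_cong[OF e, of "\<lambda>S. {x \<in> S. even x}"] even_part_subset[OF 1(3)] even_part_subset[OF 2(3)] by simp
  then have kl: "k = k'" "l = l'" using 1 2 by (auto simp: doubleton_eq_iff)
  have "2 * j - 1 \<noteq> 2 * r" "2 * j' - 1 \<noteq> 2 * r" for r using 1 2 by presburger+
  then have "2 * j - 1 = 2 * j' - 1" using e by (metis insertE insertI1 singletonD)
  then show "p = q" using 1 2 kl by auto
qed

lemma finite_vertex_index: "finite vertex_index"
  by (rule finite_subset[of _ "({..m} \<times> {..m}) \<times> {..m}"]) (auto simp: vertex_index_def)

text \<open>Each of the m(m - 1)/2 vertices has two steep neighbours, except those in cell 0 (k + l
  = m + 1, m/2 pairs) and in cell m (k + l = m, m/2 - 1 pairs), which lose one. This leaves m(m - 1)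
  - (m - 1).\<close>

lemma card_vertex_index: "(m - 1) * (m - 1) \<le> card vertex_index"
proof -
  let ?P = "{(k, l). 1 \<le> k \<and> k < l \<and> l \<le> m}"
  let ?J = "\<lambda>p. (fst p + snd p) mod (m + 1)"
  define Q1 where "Q1 = {p \<in> ?P. fst p + snd p \<noteq> m + 1}"
  define Q2 where "Q2 = {p \<in> ?P. fst p + snd p \<noteq> m}"
  have finP: "finite ?P" by (rule finite_subset[of _ "{..m} \<times> {..m}"]) auto
  obtain h where h: "m = 2 * h" using even_m by (auto elim: evenE)
  have J: "?J p = (if fst p + snd p \<le> m then fst p + snd p else fst p + snd p - (m + 1))" if "p \<in> ?P" for p
    using that by (auto simp: le_mod_geq split: prod.splits)
  have s1: "(\<lambda>p. (p, ?J p)) ` Q1 \<union> (\<lambda>p. (p, ?J p + 1)) ` Q2 \<subseteq> vertex_index"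
  proof
    fix z assume "z \<in> (\<lambda>p. (p, ?J p)) ` Q1 \<union> (\<lambda>p. (p, ?J p + 1)) ` Q2"
    then show "z \<in> vertex_index"
    proof
      assume "z \<in> (\<lambda>p. (p, ?J p)) ` Q1"
      then obtain p where p: "p \<in> Q1" "z = (p, ?J p)" by auto
      then have "p \<in> ?P" by (auto simp: Q1_def)
      then have "1 \<le> ?J p" "?J p \<le> m" using J[of p] p by (auto simp: Q1_def)
      then show ?thesis using p \<open>p \<in> ?P\<close> by (auto simp: vertex_index_def split: prod.splits)
    next
      assume "z \<in> (\<lambda>p. (p, ?J p + 1)) ` Q2"
      then obtain p where p: "p \<in> Q2" "z = (p, ?J p + 1)" by auto
      then have "p \<in> ?P" by (auto simp: Q2_def)
      then have "?J p + 1 \<le> m" using J[of p] p by (auto simp: Q2_def)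
      then show ?thesis using p \<open>p \<in> ?P\<close> by (auto simp: vertex_index_def split: prod.splits)
    qed
  qed
  have fin: "finite Q1" "finite Q2" using finP by (auto simp: Q1_def Q2_def)
  have "card Q1 + card Q2 = card ((\<lambda>p. (p, ?J p)) ` Q1 \<union> (\<lambda>p. (p, ?J p + 1)) ` Q2)"
    using fin by (subst card_Un_disjoint) (auto simp: card_image inj_on_def)
  also have "\<dots> \<le> card vertex_index" using s1 finite_vertex_index by (rule card_mono[rotated])
  finally have *: "card Q1 + card Q2 \<le> card vertex_index" .
  have c: "card {p \<in> ?P. fst p + snd p = s} \<le> r" if "\<And>p. p \<in> ?P \<Longrightarrow> fst p + snd p = s \<Longrightarrow> fst p \<le> r" for s r
  proof -
    have "card {p \<in> ?P. fst p + snd p = s} \<le> card {1..r}"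
      by (rule card_inj_on_le[of fst]) (use that in \<open>force simp: inj_on_def\<close>)+
    then show ?thesis by simp
  qed
  have split: "card ?P = card {p \<in> ?P. fst p + snd p \<noteq> s} + card {p \<in> ?P. fst p + snd p = s}" for s
  proof -
    have e: "{p \<in> ?P. fst p + snd p \<noteq> s} \<union> {p \<in> ?P. fst p + snd p = s} = ?P" by blast
    have "card ({p \<in> ?P. fst p + snd p \<noteq> s} \<union> {p \<in> ?P. fst p + snd p = s}) =
        card {p \<in> ?P. fst p + snd p \<noteq> s} + card {p \<in> ?P. fst p + snd p = s}"
      by (rule card_Un_disjoint) (use finP in \<open>auto intro: finite_subset\<close>)
    then show ?thesis unfolding e .
  qed
  have "card {p \<in> ?P. fst p + snd p = m + 1} \<le> h" by (rule c) (use h in auto)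
  then have q1: "card ?P \<le> card Q1 + h" using split[of "m + 1"] unfolding Q1_def by linarith
  have "card {p \<in> ?P. fst p + snd p = m} \<le> h - 1" by (rule c) (use h in auto)
  then have q2: "card ?P \<le> card Q2 + (h - 1)" using split[of m] unfolding Q2_def by linarith
  have "2 * card ?P = m * (m - 1)" by (rule pair_set_card)
  then have "m * (m - 1) \<le> card vertex_index + h + (h - 1)" using * q1 q2 by linarith
  moreover have "m * (m - 1) = (m - 1) * (m - 1) + (m - 1)" using m2 by (cases m) auto
  moreover have "h + (h - 1) = m - 1" using h m2 by auto
  ultimately show ?thesis by linarith
qed

text \<open>The old arrangement is moved by an affine map that fixes the axis, shears by K and
  stretches heights by 1 / \<epsilon>. By \<open>far\<close>, every old vertex then lies on the same
  side of each flat line as of the axis, so old triangles stay empty and the apex triangles only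
  change their base.\<close>

lemma doublable_double:
  assumes eps: "0 < \<epsilon>" and e_eq: "\<And>j. j \<in> {1..m} \<Longrightarrow> e j = \<epsilon> * (c j + K)"
    and old: "doublable m a c"
    and far: "\<And>i j k P. \<lbrakk>i \<in> {1..m}; j \<in> {1..m}; i < j; k \<le> m; ell (a i) (c i) P = 0; ell (a j) (c j) P = 0\<rbrakk>
        \<Longrightarrow> 0 < snd P * g k (fst P + K * snd P, snd P / \<epsilon>)"
    and between: "\<And>i p. \<lbrakk>i \<in> {1..<m}; p \<in> {1..m}\<rbrakk> \<Longrightarrow> xP p i < b i \<and> b i < xP p (i + 1)"
    and top: "\<And>i p q. \<lbrakk>i \<in> {1..<m}; p \<in> {1..m}; (2 * p) mod (m + 1) = i; q \<le> m; q \<noteq> p\<rbrakk>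
        \<Longrightarrow> if odd i then flat q (b i) < flat p (b i) else flat p (b i) < flat q (b i)"
    and na_mono: "\<And>i j. \<lbrakk>1 \<le> i; i < j; j \<le> 2 * m\<rbrakk> \<Longrightarrow> new_pos i < new_pos j"
  shows "doublable (2 * m) new_pos new_tilt"
proof -
  \<comment> \<open>This map sends x = a + c y to x = a + \<epsilon> (c + K) y, the steep line of
    tilt e.\<close>
  define \<Phi> where "\<Phi> P = (fst P + K * snd P, snd P / \<epsilon>)" for P :: "real \<times> real"
  define \<Psi> where "\<Psi> Q = (fst Q - K * (\<epsilon> * snd Q), \<epsilon> * snd Q)" for Q :: "real \<times> real"
  have \<Phi>\<Psi>: "\<Phi> (\<Psi> Q) = Q" for Q using eps by (auto simp: \<Phi>_def \<Psi>_def prod_eq_iff)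
  have L\<Phi>: "L j (\<Phi> P) = ell (a j) (c j) P" if "j \<in> {1..m}" for j P
    using e_eq[OF that] eps by (simp add: L_def ell_def \<Phi>_def algebra_simps)
  have far\<Phi>: "0 < snd P * g k (\<Phi> P)" if "i \<in> {1..m}" "j \<in> {1..m}" "i \<noteq> j" "k \<le> m"
    "ell (a i) (c i) P = 0" "ell (a j) (c j) P = 0" for i j k P
    using far[of i j k P] far[of j i k P] that unfolding \<Phi>_def by (cases "i < j") auto
  have farL: "g k Q \<noteq> 0" if "i \<in> {1..m}" "j \<in> {1..m}" "i \<noteq> j" "k \<le> m" "L i Q = 0" "L j Q = 0" for i j k Q
  proof -
    have "ell (a i) (c i) (\<Psi> Q) = 0" "ell (a j) (c j) (\<Psi> Q) = 0"
      using L\<Phi>[of i "\<Psi> Q"] L\<Phi>[of j "\<Psi> Q"] that unfolding \<Phi>\<Psi> by simp_all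
    from far\<Phi>[OF that(1-4) this] show ?thesis unfolding \<Phi>\<Psi> by auto
  qed
  obtain \<T> where \<T>: "finite \<T>" "\<And>T. T \<in> \<T> \<Longrightarrow> \<exists>i j k. T = {i, j, k} \<and> empty_triangle m a c i j k" "m * (m - 3) \<le> 3 * card \<T>"
    using doublable_triples[OF old] by blast
  \<comment> \<open>Steep tilts are positive and flat ones negative, so only two lines of the same
    kind could agree.\<close>
  have c_inj: "new_tilt i \<noteq> new_tilt j" if "i \<in> {1..2 * m}" "j \<in> {1..2 * m}" "i \<noteq> j" for i j
  proof -
    have nc_odd: "new_tilt (2 * r - 1) = e r" if "r \<in> {1..m}" for r
      using that by (cases r) (auto simp: new_tilt_def)
    have nc_even: "new_tilt (2 * r) = 1 / \<mu> r" for r by (simp add: new_tilt_def)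
    have pn: "0 < e r" "1 / \<mu> s < 0" if "r \<in> {1..m}" "s \<in> {1..m}" for r s
      using e_pos mu_neg that by (auto simp: divide_less_0_iff)
    from that(1) show ?thesis
    proof (cases rule: index_cases)
      case i: (odd r)
      from that(2) show ?thesis
      proof (cases rule: index_cases)
        case j: (odd s)
        have "c r \<noteq> c s" using doublable_slopes(2)[OF old, of r s] doublable_slopes(2)[OF old, of s r] i j that(3) by (cases r s rule: linorder_cases) auto
        then have "e r \<noteq> e s" using e_eq[of r] e_eq[of s] i j eps by simp
        then show ?thesis using nc_odd i j by simp
      next
        case j: (even s)
        show ?thesis unfolding i(2) j(2) nc_odd[OF i(1)] nc_even using pn[OF i(1) j(1)] by linarith
      qed
    next
      case i: (even r)
      from that(2) show ?thesis
      proof (cases rule: index_cases)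
        case j: (odd s)
        show ?thesis unfolding i(2) j(2) nc_odd[OF j(1)] nc_even using pn[OF j(1) i(1)] by linarith
      next
        case j: (even s)
        then have "\<mu> r \<noteq> \<mu> s" using mu_inj[of r s] i that(3) by auto
        then show ?thesis unfolding i(2) j(2) nc_even using mu_neg[OF i(1)] mu_neg[OF j(1)] by (simp add: field_simps)
      qed
    qed
  qed
  have conc: False if ijk: "i \<in> {1..2 * m}" "j \<in> {1..2 * m}" "k \<in> {1..2 * m}" "i \<noteq> j" "j \<noteq> k" "i \<noteq> k"
    and z: "ell (new_pos i) (new_tilt i) P = 0" "ell (new_pos j) (new_tilt j) P = 0" "ell (new_pos k) (new_tilt k) P = 0" for i j k P
  proof -
    have cl: "(\<exists>r\<in>{1..m}. i = 2 * r - 1 \<and> L r P = 0) \<or> (\<exists>r\<in>{1..m}. i = 2 * r \<and> g r P = 0)"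
      if "i \<in> {1..2 * m}" "ell (new_pos i) (new_tilt i) P = 0" for i
      using that(1)
    proof (cases rule: index_cases)
      case (odd r)
      then have "1 \<le> r" by simp
      then show ?thesis using that(2) ell_odd[of r P] odd by auto
    next
      case (even r)
      then show ?thesis using that(2) ell_even[of r P] mu_neg[of r] by auto
    qed
    have LLL: False if "r \<in> {1..m}" "s \<in> {1..m}" "t \<in> {1..m}" "r < s" "s < t" "L r P = 0" "L s P = 0" "L t P = 0" for r s t
    proof -
      have "ell (a r) (c r) (\<Psi> P) = 0" "ell (a s) (c s) (\<Psi> P) = 0" "ell (a t) (c t) (\<Psi> P) = 0"
        using L\<Phi>[of r "\<Psi> P"] L\<Phi>[of s "\<Psi> P"] L\<Phi>[of t "\<Psi> P"] that unfolding \<Phi>\<Psi> by simp_all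
      from doublable_not_concurrent[OF old that(1-5) this] show False .
    qed
    have LLL': False if d: "r \<in> {1..m}" "s \<in> {1..m}" "t \<in> {1..m}" "r \<noteq> s" "s \<noteq> t" "r \<noteq> t" "L r P = 0" "L s P = 0" "L t P = 0" for r s t
    proof -
      consider "r < s \<and> s < t" | "r < t \<and> t < s" | "s < r \<and> r < t" | "s < t \<and> t < r" | "t < r \<and> r < s" | "t < s \<and> s < r"
        using d(4-6) by linarith
      then show False using LLL d by cases blast+
    qed
    have LLM: False if "r \<in> {1..m}" "s \<in> {1..m}" "t \<in> {1..m}" "r \<noteq> s" "L r P = 0" "L s P = 0" "g t P = 0" for r s t
      using farL[of r s t P] that by auto
    have LMM: False if "r \<in> {1..m}" "s \<in> {1..m}" "t \<in> {1..m}" "s \<noteq> t" "L r P = 0" "g s P = 0" "g t P = 0" for r s t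
      using not_concurrent_MML[of s t r P] that by auto
    have MMM: False if "r \<in> {1..m}" "s \<in> {1..m}" "t \<in> {1..m}" "r \<noteq> s" "s \<noteq> t" "r \<noteq> t" "g r P = 0" "g s P = 0" "g t P = 0" for r s t
      using not_concurrent_MMM[of r s t P] that by auto
    from cl[OF ijk(1) z(1)] cl[OF ijk(2) z(2)] cl[OF ijk(3) z(3)] show False
    proof (elim disjE bexE conjE)
      fix r s t assume r: "r \<in> {1..m}" "s \<in> {1..m}" "t \<in> {1..m}"
      { assume "i = 2 * r - 1" "L r P = 0" "j = 2 * s - 1" "L s P = 0" "k = 2 * t - 1" "L t P = 0"
        then show False using LLL'[of r s t] r ijk by auto }
      { assume "i = 2 * r - 1" "L r P = 0" "j = 2 * s - 1" "L s P = 0" "k = 2 * t" "g t P = 0"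
        then show False using LLM[of r s t] r ijk by auto }
      { assume "i = 2 * r - 1" "L r P = 0" "j = 2 * s" "g s P = 0" "k = 2 * t - 1" "L t P = 0"
        then show False using LLM[of r t s] r ijk by auto }
      { assume "i = 2 * r - 1" "L r P = 0" "j = 2 * s" "g s P = 0" "k = 2 * t" "g t P = 0"
        then show False using LMM[of r s t] r ijk by auto }
      { assume "i = 2 * r" "g r P = 0" "j = 2 * s - 1" "L s P = 0" "k = 2 * t - 1" "L t P = 0"
        then show False using LLM[of s t r] r ijk by auto }
      { assume "i = 2 * r" "g r P = 0" "j = 2 * s - 1" "L s P = 0" "k = 2 * t" "g t P = 0"
        then show False using LMM[of s r t] r ijk by auto }
      { assume "i = 2 * r" "g r P = 0" "j = 2 * s" "g s P = 0" "k = 2 * t - 1" "L t P = 0"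
        then show False using LMM[of t r s] r ijk by auto }
      { assume "i = 2 * r" "g r P = 0" "j = 2 * s" "g s P = 0" "k = 2 * t" "g t P = 0"
        then show False using MMM[of r s t] r ijk by auto }
    qed
  qed
  have tri_old: "empty_triangle (2 * m) new_pos new_tilt (2 * i - 1) (2 * j - 1) (2 * k - 1)" if t: "empty_triangle m a c i j k" for i j k
  proof -
    from t obtain A B C where sub: "i \<in> {1..m}" "j \<in> {1..m}" "k \<in> {1..m}" and d: "i \<noteq> j" "j \<noteq> k" "i \<noteq> k"
      and inc: "ell (a j) (c j) A = 0" "ell (a k) (c k) A = 0" "ell (a i) (c i) B = 0"
       "ell (a k) (c k) B = 0" "ell (a i) (c i) C = 0" "ell (a j) (c j) C = 0"
      and ss: "same_sign (snd A) (snd B) (snd C)"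
      and sq: "\<And>q. q \<in> {1..m} - {i, j, k} \<Longrightarrow> same_sign (ell (a q) (c q) A) (ell (a q) (c q) B) (ell (a q) (c q) C)"
      unfolding empty_triangle_def by auto
    have ge: "1 \<le> i" "1 \<le> j" "1 \<le> k" using sub by auto
    show ?thesis
    proof (rule empty_triangle_newI[where A = "\<Phi> A" and B = "\<Phi> B" and C = "\<Phi> C"])
      show "{2 * i - 1, 2 * j - 1, 2 * k - 1} \<subseteq> {1..2 * m}" "2 * i - 1 \<noteq> 2 * j - 1" "2 * j - 1 \<noteq> 2 * k - 1"
        "2 * i - 1 \<noteq> 2 * k - 1"
        using sub d by auto
      show "same_sign (L q (\<Phi> A)) (L q (\<Phi> B)) (L q (\<Phi> C))" if "q \<in> {1..m}" "2 * q - 1 \<notin> {2 * i - 1, 2 * j - 1, 2 * k - 1}" for q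
        using sq[of q] that L\<Phi>[of q] by auto
      show "same_sign (g q (\<Phi> A)) (g q (\<Phi> B)) (g q (\<Phi> C))" if "q \<le> m" for q
        using far\<Phi>[of j k q A] far\<Phi>[of i k q B] far\<Phi>[of i j q C] sub d inc ss that
        by (auto simp: same_sign_def zero_less_mult_iff)
    qed (simp_all only: ell_odd[OF ge(1)] ell_odd[OF ge(2)] ell_odd[OF ge(3)] L\<Phi>[OF sub(1)] L\<Phi>[OF sub(2)] L\<Phi>[OF sub(3)] inc)
  qed
  have tri_edge: "empty_triangle (2 * m) new_pos new_tilt (2 * mid_index i) (2 * i - 1) (2 * (i + 1) - 1)" if i: "i \<in> {1..<m}" for i
  proof -
    obtain W where W: "ell (a i) (c i) W = 0" "ell (a (i + 1)) (c (i + 1)) W = 0"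
      "if odd i then 0 < snd W else snd W < 0"
      "\<And>q. q \<in> {1..m} \<Longrightarrow> (q < i \<longrightarrow> 0 < ell (a q) (c q) W) \<and> (i + 1 < q \<longrightarrow> ell (a q) (c q) W < 0)"
      using doublable_apex[OF old i] unfolding apex_def by blast
    have i1: "i \<in> {1..m}" "i + 1 \<in> {1..m}" using i by auto
    show ?thesis
    proof (rule empty_triangle_flat_edge[where W = "\<Phi> W" and x = "b i"])
      show "if odd i then 0 < g q (\<Phi> W) else g q (\<Phi> W) < 0" if "q \<le> m" for q
        using far\<Phi>[of i "i + 1" q W] W i1 that by (auto simp: zero_less_mult_iff split: if_splits)
      show "if odd i then flat q (b i) < flat (mid_index i) (b i) else flat (mid_index i) (b i) < flat q (b i)" if "q \<le> m" "q \<noteq> mid_index i" for q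
        using top[OF i mid_index[OF i] that] .
    qed (use i i1 mid_index[OF i] W L\<Phi> between[OF i, of "mid_index i"] in auto)
  qed
  \<comment> \<open>The families are disjoint because their triples contain 0, 1 and 2 even indices,
    that is, flat lines.\<close>
  define \<T>1 where "\<T>1 = (\<lambda>T. (\<lambda>j. 2 * j - 1) ` T) ` \<T>"
  define \<T>2 where "\<T>2 = (\<lambda>i. {2 * mid_index i, 2 * i - 1, 2 * (i + 1) - 1}) ` {1..<m}"
  define \<T>3 where "\<T>3 = vertex_set ` vertex_index"
  have \<T>sub: "T \<subseteq> {1..m}" if "T \<in> \<T>" for T using \<T>(2)[OF that] by (auto simp: empty_triangle_def)
  have c1: "card \<T>1 = card \<T>"
    unfolding \<T>1_def
  proof (rule card_image, rule inj_onI)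
    fix T T' assume T: "T \<in> \<T>" "T' \<in> \<T>" "(\<lambda>j. 2 * j - 1) ` T = (\<lambda>j. 2 * j - 1) ` T'"
    have "inj_on (\<lambda>j::nat. 2 * j - 1) {1..m}" by (auto simp: inj_on_def)
    from inj_on_image_eq_iff[OF this \<T>sub[OF T(1)] \<T>sub[OF T(2)]] T(3) show "T = T'" by simp
  qed
  have c2: "card \<T>2 = m - 1"
  proof -
    have "inj_on (\<lambda>i. {2 * mid_index i, 2 * i - 1, 2 * (i + 1) - 1}) {1..<m}"
    proof (rule inj_onI)
      fix i i' assume i: "i \<in> {1..<m}" "i' \<in> {1..<m}" "{2 * mid_index i, 2 * i - 1, 2 * (i + 1) - 1} = {2 * mid_index i', 2 * i' - 1, 2 * (i' + 1) - 1}"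
      have "1 \<le> i" "1 \<le> i'" using i by auto
      then have o: "2 * i - 1 \<noteq> 2 * r" "2 * i' - 1 \<noteq> 2 * r" for r by presburger+
      have "2 * i - 1 \<in> {2 * i' - 1, 2 * (i' + 1) - 1}" "2 * i' - 1 \<in> {2 * i - 1, 2 * (i + 1) - 1}"
      proof -
        have "2 * i - 1 \<in> {2 * mid_index i', 2 * i' - 1, 2 * (i' + 1) - 1}" unfolding i(3)[symmetric] by simp
        then show "2 * i - 1 \<in> {2 * i' - 1, 2 * (i' + 1) - 1}" using o(1)[of "mid_index i'"] by simp
        have "2 * i' - 1 \<in> {2 * mid_index i, 2 * i - 1, 2 * (i + 1) - 1}" unfolding i(3) by simp
        then show "2 * i' - 1 \<in> {2 * i - 1, 2 * (i + 1) - 1}" using o(2)[of "mid_index i"] by simp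
      qed
      then show "i = i'" using i(1,2) by auto
    qed
    then show ?thesis unfolding \<T>2_def by (simp add: card_image)
  qed
  have c3: "(m - 1) * (m - 1) \<le> card \<T>3"
    unfolding \<T>3_def using card_vertex_index by (simp add: card_image inj_on_vertex_set)
  have e1: "{x \<in> T. even x} = {}" if "T \<in> \<T>1" for T
  proof -
    obtain S where S: "S \<in> \<T>" "T = (\<lambda>j. 2 * j - 1) ` S" using \<open>T \<in> \<T>1\<close> by (auto simp: \<T>1_def)
    have "odd (2 * j - 1)" if "j \<in> S" for j
    proof -
      have "1 \<le> j" using \<T>sub[OF S(1)] that by auto
      then show ?thesis by simp
    qed
    then show ?thesis unfolding S(2) by blast
  qed
  have e2: "card {x \<in> T. even x} = 1" if t: "T \<in> \<T>2" for T
  proof -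
    obtain i where i: "i \<in> {1..<m}" "T = {2 * mid_index i, 2 * i - 1, 2 * (i + 1) - 1}" using t by (auto simp: \<T>2_def)
    have "{x \<in> T. even x} = {2 * mid_index i}" unfolding i(2) using i(1) by auto
    then show ?thesis by simp
  qed
  have e3: "card {x \<in> T. even x} = 2" if t: "T \<in> \<T>3" for T
  proof -
    obtain k l j where q: "T = {2 * j - 1, 2 * k, 2 * l}" "k < l" "1 \<le> j"
      using t by (auto simp: \<T>3_def vertex_index_def vertex_set_def)
    show ?thesis unfolding q(1) even_part_subset[OF q(3)] using q(2) by simp
  qed
  have fin: "finite \<T>1" "finite \<T>2" "finite \<T>3" using \<T>(1) finite_vertex_index by (auto simp: \<T>1_def \<T>2_def \<T>3_def)
  have dis: "\<T>1 \<inter> \<T>2 = {}" "(\<T>1 \<union> \<T>2) \<inter> \<T>3 = {}"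
  proof -
    have "False" if "T \<in> \<T>1" "T \<in> \<T>2" for T using e2[OF that(2)] unfolding e1[OF that(1)] by simp
    then show "\<T>1 \<inter> \<T>2 = {}" by blast
    have "False" if "T \<in> \<T>1" "T \<in> \<T>3" for T using e3[OF that(2)] unfolding e1[OF that(1)] by simp
    moreover have "False" if "T \<in> \<T>2" "T \<in> \<T>3" for T using e2[OF that(1)] e3[OF that(2)] by simp
    ultimately show "(\<T>1 \<union> \<T>2) \<inter> \<T>3 = {}" by blast
  qed
  have "card (\<T>1 \<union> \<T>2 \<union> \<T>3) = card \<T>1 + card \<T>2 + card \<T>3"
    using fin dis by (simp add: card_Un_disjoint)
  then have "m * (m - 3) + 3 * (m - 1) + 3 * ((m - 1) * (m - 1)) \<le> 3 * card (\<T>1 \<union> \<T>2 \<union> \<T>3)"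
    using c1 c2 c3 \<T>(3) by linarith
  moreover have "m * (m - 3) + 3 * (m - 1) + 3 * ((m - 1) * (m - 1)) = (2 * m) * (2 * m - 3)"
  proof -
    obtain k where "m = k + 4" using m2 by (metis add.commute le_Suc_ex)
    then show ?thesis by (simp add: algebra_simps)
  qed
  ultimately have cT: "(2 * m) * (2 * m - 3) \<le> 3 * card (\<T>1 \<union> \<T>2 \<union> \<T>3)" by simp
  have tT: "\<exists>i j k. T = {i, j, k} \<and> empty_triangle (2 * m) new_pos new_tilt i j k" if "T \<in> \<T>1 \<union> \<T>2 \<union> \<T>3" for T
    using that
  proof (elim UnE)
    assume "T \<in> \<T>1"
    then obtain S where S: "S \<in> \<T>" "T = (\<lambda>j. 2 * j - 1) ` S" by (auto simp: \<T>1_def)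
    obtain i j k where "S = {i, j, k}" "empty_triangle m a c i j k" using \<T>(2)[OF S(1)] by blast
    then have "T = {2 * i - 1, 2 * j - 1, 2 * k - 1}" "empty_triangle (2 * m) new_pos new_tilt (2 * i - 1) (2 * j - 1) (2 * k - 1)"
      using S tri_old by auto
    then show ?thesis by blast
  next
    assume "T \<in> \<T>2"
    then obtain i where i: "i \<in> {1..<m}" "T = {2 * mid_index i, 2 * i - 1, 2 * (i + 1) - 1}" unfolding \<T>2_def by blast
    show ?thesis using tri_edge[OF i(1)] unfolding i(2) by blast
  next
    assume "T \<in> \<T>3"
    then obtain k l j where "((k, l), j) \<in> vertex_index" "T = {2 * j - 1, 2 * k, 2 * l}" by (auto simp: \<T>3_def vertex_set_def)
    moreover from this have "empty_triangle (2 * m) new_pos new_tilt (2 * j - 1) (2 * k) (2 * l)"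
      by (intro empty_triangle_vertex) (auto simp: vertex_index_def)
    ultimately show ?thesis by blast
  qed
  show ?thesis
    unfolding doublable_def
  proof (intro conjI ballI allI impI)
    show "new_pos i < new_pos j" "new_tilt i \<noteq> new_tilt j" if "i \<in> {1..2 * m}" "j \<in> {1..2 * m}" "i < j" for i j
      using na_mono[of i j] c_inj[of i j] that by auto
    show "\<not> (ell (new_pos i) (new_tilt i) P = 0 \<and> ell (new_pos j) (new_tilt j) P = 0 \<and> ell (new_pos k) (new_tilt k) P = 0)"
      if "i \<in> {1..2 * m}" "j \<in> {1..2 * m}" "k \<in> {1..2 * m}" "i < j" "j < k" for i j k P
      using conc[of i j k P] that by auto
    show "apex (2 * m) new_pos new_tilt i" if "i \<in> {1..<2 * m}" for i using apex_new_arrangement that .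
    show "\<exists>\<T>. finite \<T> \<and> (\<forall>T\<in>\<T>. \<exists>i j k. T = {i, j, k} \<and> empty_triangle (2 * m) new_pos new_tilt i j k) \<and> 2 * m * (2 * m - 3) \<le> 3 * card \<T>"
      using fin cT tT by (intro exI[of _ "\<T>1 \<union> \<T>2 \<union> \<T>3"]) auto
  qed
qed

end

section \<open>Regular positions\<close>

text \<open>The points cut out on a line by a pencil of m lines at equal angles pi / m. Angle 0 is
  the point at infinity, and \<rho> tells where it falls between indices 0 and 1.\<close>

definition cot_position :: "nat \<Rightarrow> real \<Rightarrow> nat \<Rightarrow> real" where
  "cot_position m \<rho> j = - cot ((real j - \<rho>) * (pi / real m))"

lemma cot_diff:
  assumes "sin x \<noteq> 0" "sin y \<noteq> (0::real)"
  shows "cot x - cot y = sin (y - x) / (sin x * sin y)"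
  using assms by (simp add: cot_def sin_diff field_simps)

lemma cot_strict_decreasing:
  assumes "0 < x" "x < y" "y < (pi::real)"
  shows "cot y < cot x"
proof -
  have "0 < sin x" "0 < sin y" "0 < sin (y - x)" using assms by (auto intro!: sin_gt_zero)
  then show ?thesis using cot_diff[of x y] by (smt (verit) divide_pos_pos mult_pos_pos)
qed

text \<open>Written with cosines, both products contain the same term cos \<phi>, which cancels.
  This identity factors the height difference of two flat lines, so that its zero and its sign can
  be read off.\<close>

lemma sin_product_diff:
  fixes A B \<phi> :: real
  shows "sin A * sin (\<phi> - A) - sin B * sin (\<phi> - B) = sin (\<phi> - A - B) * sin (A - B)"
proof -
  have s: "sin x * sin y = (cos (x - y) - cos (x + y)) / 2" for x y :: real
    by (simp add: cos_diff cos_add)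
  have "cos (A - (\<phi> - A)) = cos (\<phi> - A - B - (A - B))" "cos (B - (\<phi> - B)) = cos (\<phi> - A - B + (A - B))"
    by (metis (no_types, lifting) cos_minus minus_diff_eq diff_diff_eq diff_diff_eq2 add.commute add.left_commute diff_add_cancel,
        metis (no_types, lifting) cos_minus minus_diff_eq diff_diff_eq diff_diff_eq2 add.commute add.left_commute diff_add_cancel)
  then show ?thesis unfolding s by (simp add: diff_divide_distrib)
qed

lemma cot_position_strict_mono:
  assumes "0 < \<rho>" "\<rho> < 1" "1 \<le> i" "i < j" "j \<le> m"
  shows "cot_position m \<rho> i < cot_position m \<rho> j"
proof -
  have m: "0 < real m" using assms by auto
  have "(real j - \<rho>) * (pi / real m) < real m * (pi / real m)"
    using assms m by (intro mult_strict_right_mono) auto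
  then have "(real j - \<rho>) * (pi / real m) < pi" using m by simp
  moreover have "0 < (real i - \<rho>) * (pi / real m)" using assms m by auto
  moreover have "(real i - \<rho>) * (pi / real m) < (real j - \<rho>) * (pi / real m)"
    using assms m by (intro mult_strict_right_mono) auto
  ultimately show ?thesis unfolding cot_position_def using cot_strict_decreasing by auto
qed

text \<open>In the projective picture where the pencil of vertical lines has its centre at the origin, flat line k is the
  tangent of the unit circle at the angle 2 * \<tau> k, so flat lines k and l meet at the polar angle \<tau> k + \<tau> l.
  For the angles chosen here these vertices lie exactly on the vertical lines through the points a j; tilting the
  steep lines slightly about the points a j resolves all these triple points in the required direction.\<close>

locale regular_positions =
  fixes m :: nat and \<rho> :: real
  assumes even_m: "even m" and m4: "4 \<le> m" and rho: "1/2 < \<rho>" "\<rho> < 1"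
begin

definition h :: real where "h = pi / real m"
text \<open>The axis does not belong to the equally spaced sequence of half-integers; with \<tau> 0
  = 0 the height formulas below hold for it as well.\<close>

definition \<tau> :: "nat \<Rightarrow> real" where "\<tau> k = (if k = 0 then 0 else (real k - 1/2) * h)"
definition \<delta> :: real where "\<delta> = (1 - \<rho>) * h"
definition a :: "nat \<Rightarrow> real" where "a j = - cot ((real j - \<rho>) * h)"
text \<open>The angular midpoint between a k and a (k + 1), so that both sequences together are
  again regularly spaced.\<close>

definition b :: "nat \<Rightarrow> real" where "b k = - cot ((real k + 1/2 - \<rho>) * h)"
definition \<mu> :: "nat \<Rightarrow> real" where "\<mu> k = - 2 * sin (\<tau> k) * sin (\<tau> k + \<delta>)"
text \<open>For k, l \<ge> 1 the vertex has angle \<tau> k + \<tau> l + \<delta> = (k + l - \<rho>)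
  h, reduced by pi once the index exceeds m.\<close>

definition V :: "nat \<Rightarrow> nat \<Rightarrow> real" where
  "V k l = (if k = 0 then b l else if l = 0 then b k else if k + l \<le> m then a (k + l) else a (k + l - m))"

lemma hpos: "0 < h" and mh: "real m * h = pi"
  using m4 by (auto simp: h_def)

lemma sin_h_pos: "0 < r \<Longrightarrow> r < real m \<Longrightarrow> 0 < sin (r * h)"
  using hpos mh by (intro sin_gt_zero) (auto simp flip: mh)

lemma sin_h_neg: "- real m < r \<Longrightarrow> r < 0 \<Longrightarrow> sin (r * h) < 0"
  using sin_h_pos[of "- r"] by simp

lemma sin_h_pos2: "- 2 * real m < r \<Longrightarrow> r < - real m \<Longrightarrow> 0 < sin (r * h)"
proof -
  assume r: "- 2 * real m < r" "r < - real m"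
  have "sin (r * h) = - sin ((r + real m) * h)" by (simp add: distrib_right mh sin_periodic_pi)
  then show ?thesis using sin_h_neg[of "r + real m"] r by simp
qed

lemma tau_delta: "k \<noteq> 0 \<Longrightarrow> \<tau> k + \<delta> = (real k + 1/2 - \<rho>) * h"
  by (simp add: \<tau>_def \<delta>_def algebra_simps)

text \<open>The height of flat line k at angle \<psi>. The factor sin (\<tau> k + \<delta>) of
  \<open>\<mu> k\<close> cancels the denominator of b k and leaves a product fit for
  \<open>sin_product_diff\<close>.\<close>

lemma M_value:
  assumes "k \<le> m" "sin \<psi> \<noteq> 0"
  shows "\<mu> k * (- cot \<psi> - b k) = - 2 * sin (\<tau> k) * sin (\<psi> - \<delta> - \<tau> k) / sin \<psi>"
proof (cases "k = 0")
  case False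
  let ?\<beta> = "\<tau> k + \<delta>"
  have b: "b k = - cot ?\<beta>" using tau_delta[OF False] by (simp add: b_def)
  \<comment> \<open>For k = m the angle (m + 1/2 - \<rho>) h stays below pi because \<rho> >
    1/2.\<close>
  have "0 < sin ?\<beta>" unfolding tau_delta[OF False] using assms rho False by (intro sin_h_pos) auto
  then have e: "sin ?\<beta> * (- cot \<psi> + cot ?\<beta>) = sin (\<psi> - ?\<beta>) / sin \<psi>"
    using assms(2) by (simp add: cot_def sin_diff field_simps)
  have "\<mu> k * (- cot \<psi> - b k) = - 2 * sin (\<tau> k) * (sin ?\<beta> * (- cot \<psi> + cot ?\<beta>))"
    by (simp add: \<mu>_def b)
  also have "\<dots> = - 2 * sin (\<tau> k) * sin (\<psi> - \<delta> - \<tau> k) / sin \<psi>"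
    unfolding e by (simp add: diff_diff_eq add.commute)
  finally show ?thesis .
qed (simp add: \<mu>_def \<tau>_def)

lemma M_diff:
  assumes "p \<le> m" "q \<le> m" "sin \<psi> \<noteq> 0"
  shows "\<mu> p * (- cot \<psi> - b p) - \<mu> q * (- cot \<psi> - b q) =
    - 2 * (sin (\<psi> - \<delta> - \<tau> p - \<tau> q) * sin (\<tau> p - \<tau> q)) / sin \<psi>"
proof -
  have "\<mu> p * (- cot \<psi> - b p) - \<mu> q * (- cot \<psi> - b q) =
    - 2 * (sin (\<tau> p) * sin (\<psi> - \<delta> - \<tau> p) - sin (\<tau> q) * sin (\<psi> - \<delta> - \<tau> q)) / sin \<psi>"
    unfolding M_value[OF assms(1,3)] M_value[OF assms(2,3)]
    by (simp add: diff_divide_distrib[symmetric] algebra_simps)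
  then show ?thesis unfolding sin_product_diff .
qed

text \<open>The same factorisation at \<psi> = 0, the point at infinity, where slopes replace
  heights.\<close>

lemma mu_diff: "\<mu> p - \<mu> q = - 2 * (sin (\<tau> p + \<tau> q + \<delta>) * sin (\<tau> p - \<tau> q))"
proof -
  have "\<mu> p - \<mu> q = 2 * (sin (\<tau> p) * sin (- \<delta> - \<tau> p) - sin (\<tau> q) * sin (- \<delta> - \<tau> q))"
  proof -
    have "sin (- \<delta> - x) = - sin (x + \<delta>)" for x by (metis sin_minus minus_add_distrib add.commute uminus_add_conv_diff diff_conv_add_uminus)
    then show ?thesis by (simp add: \<mu>_def)
  qed
  also have "\<dots> = 2 * (sin (- \<delta> - \<tau> p - \<tau> q) * sin (\<tau> p - \<tau> q))" unfolding sin_product_diff ..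
  also have "sin (- \<delta> - \<tau> p - \<tau> q) = - sin (\<tau> p + \<tau> q + \<delta>)"
    unfolding sin_minus[symmetric] by (rule arg_cong[of _ _ sin]) simp
  finally show ?thesis by simp
qed

lemma tau_diff_pos: "q < p \<Longrightarrow> p \<le> m \<Longrightarrow> 0 < sin (\<tau> p - \<tau> q)"
proof -
  assume pq: "q < p" "p \<le> m"
  have "\<tau> p - \<tau> q = (if q = 0 then real p - 1/2 else real p - real q) * h" using pq by (simp add: \<tau>_def algebra_simps)
  then show ?thesis using pq by (auto intro!: sin_h_pos)
qed

lemma tau_diff_neg: "p < q \<Longrightarrow> q \<le> m \<Longrightarrow> sin (\<tau> p - \<tau> q) < 0"
  using tau_diff_pos[of p q] sin_minus[of "\<tau> q - \<tau> p"] by simp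

lemma sin_tau_pos: "1 \<le> k \<Longrightarrow> k \<le> m \<Longrightarrow> 0 < sin (\<tau> k)"
  using tau_diff_pos[of 0 k] by (simp add: \<tau>_def)

lemma mu_0: "\<mu> 0 = 0" by (simp add: \<mu>_def \<tau>_def)

lemma mu_neg: "k \<in> {1..m} \<Longrightarrow> \<mu> k < 0"
proof -
  assume k: "k \<in> {1..m}"
  have "0 < sin (\<tau> k + \<delta>)" using tau_delta[of k] k rho by (auto intro!: sin_h_pos)
  then show ?thesis using sin_tau_pos[of k] k by (simp add: \<mu>_def)
qed

lemma mu_inj:
  assumes "k \<le> m" "l \<le> m" "k \<noteq> l"
  shows "\<mu> k \<noteq> \<mu> l"
proof -
  have *: "\<mu> k \<noteq> \<mu> l" if "k \<le> m" "l < k" for k l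
  proof -
    have "sin (\<tau> k + \<tau> l + \<delta>) \<noteq> 0"
    proof (cases "l = 0")
      case True
      then have "\<tau> k + \<tau> l + \<delta> = (real k + 1/2 - \<rho>) * h" using tau_delta[of k] that by (simp add: \<tau>_def)
      then show ?thesis using sin_h_pos[of "real k + 1/2 - \<rho>"] that rho by auto
    next
      case False
      then have e: "\<tau> k + \<tau> l + \<delta> = (real (k + l) - \<rho>) * h" using that by (simp add: \<tau>_def \<delta>_def algebra_simps)
      show ?thesis
      proof (cases "k + l \<le> m")
        case True
        then have "0 < sin ((real (k + l) - \<rho>) * h)" using that rho False by (intro sin_h_pos) linarith+
        then show ?thesis unfolding e by simp
      next
        case F: False
        have "real (k + l) - \<rho> < 2 * real m" "real m < real (k + l) - \<rho>" using that rho F by linarith+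
        then have "0 < sin (- (real (k + l) - \<rho>) * h)" by (intro sin_h_pos2) linarith+
        then show ?thesis unfolding e by (metis less_irrefl minus_mult_left neg_equal_0_iff_equal sin_minus)
      qed
    qed
    then show ?thesis using mu_diff[of k l] tau_diff_pos[of l k] that by auto
  qed
  show ?thesis using *[of k l] *[of l k] assms by (cases "l < k") auto
qed

lemma a_less_b: "i \<in> {1..m} \<Longrightarrow> a i < b i" and b_less_a: "i \<in> {1..<m} \<Longrightarrow> b i < a (i + 1)"
proof -
  have mono: "- cot (r * h) < - cot (s * h)" if "0 < r" "r < s" "s < real m" for r s
  proof -
    have "s * h < real m * h" using that hpos by simp
    then show ?thesis using that hpos mh cot_strict_decreasing[of "r * h" "s * h"] by auto
  qed
  show "i \<in> {1..m} \<Longrightarrow> a i < b i" unfolding a_def b_def using rho by (intro mono) auto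
  show "i \<in> {1..<m} \<Longrightarrow> b i < a (i + 1)" unfolding a_def b_def using rho by (intro mono) auto
qed

lemma sin_a_pos: "j \<in> {1..m} \<Longrightarrow> 0 < sin ((real j - \<rho>) * h)"
  using rho by (intro sin_h_pos) auto

text \<open>The height is a product of sines, and passing index m shifts one angle by pi and flips
  its sign. Once the steep lines are tilted, this sign decides on which side of its steep line the
  vertex falls.\<close>

lemma V_value:
  assumes "k \<in> {1..m}" "l \<in> {1..m}" "k \<noteq> l"
  shows "k + l \<le> m \<Longrightarrow> \<mu> k * (V k l - b k) < 0" "m < k + l \<Longrightarrow> 0 < \<mu> k * (V k l - b k)"
proof -
  have s: "0 < sin (\<tau> k)" "0 < sin (\<tau> l)" using sin_tau_pos assms by auto
  show "\<mu> k * (V k l - b k) < 0" if "k + l \<le> m"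
  proof -
    have V: "V k l = - cot ((real (k + l) - \<rho>) * h)" using assms that by (simp add: V_def a_def)
    have p: "0 < sin ((real (k + l) - \<rho>) * h)" using assms that by (intro sin_a_pos) auto
    have e: "(real (k + l) - \<rho>) * h - \<delta> - \<tau> k = \<tau> l" using assms by (simp add: \<tau>_def \<delta>_def algebra_simps)
    have "\<mu> k * (V k l - b k) = - 2 * sin (\<tau> k) * sin (\<tau> l) / sin ((real (k + l) - \<rho>) * h)"
      using M_value[of k "(real (k + l) - \<rho>) * h"] p assms unfolding e V by simp
    moreover have "- 2 * sin (\<tau> k) * sin (\<tau> l) < 0" using s by simp
    ultimately show ?thesis using p by (simp only: divide_neg_pos)
  qed
  show "0 < \<mu> k * (V k l - b k)" if "m < k + l"
  proof -
    have V: "V k l = - cot ((real (k + l - m) - \<rho>) * h)" using assms that by (simp add: V_def a_def)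
    have p: "0 < sin ((real (k + l - m) - \<rho>) * h)" using assms that by (intro sin_a_pos) auto
    have e: "(real (k + l - m) - \<rho>) * h - \<delta> - \<tau> k = \<tau> l - pi"
      using assms that by (simp add: \<tau>_def \<delta>_def of_nat_diff algebra_simps mh)
    have "\<mu> k * (V k l - b k) = - 2 * sin (\<tau> k) * sin (\<tau> l - pi) / sin ((real (k + l - m) - \<rho>) * h)"
      using M_value[of k "(real (k + l - m) - \<rho>) * h"] p assms unfolding e V by simp
    moreover have "0 < - 2 * sin (\<tau> k) * sin (\<tau> l - pi)" using s by (simp add: sin_diff)
    ultimately show ?thesis using p by (simp only: divide_pos_pos)
  qed
qed

lemma V_common:
  assumes "k \<le> m" "l \<le> m" "k \<noteq> l"
  shows "\<mu> k * (V k l - b k) = \<mu> l * (V k l - b l)"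
proof -
  consider "k = 0" | "l = 0" "k \<noteq> 0" | "k \<noteq> 0" "l \<noteq> 0" "k + l \<le> m" | "k \<noteq> 0" "l \<noteq> 0" "m < k + l" by linarith
  then show ?thesis
  proof cases
    case 3
    have V: "V k l = - cot ((real (k + l) - \<rho>) * h)" using 3 by (simp add: V_def a_def)
    have p: "sin ((real (k + l) - \<rho>) * h) \<noteq> 0" using sin_a_pos[of "k + l"] 3 by auto
    have e: "(real (k + l) - \<rho>) * h - \<delta> - \<tau> k - \<tau> l = 0" using 3 by (simp add: \<tau>_def \<delta>_def algebra_simps)
    show ?thesis using M_diff[OF assms(1,2) p] unfolding e V by simp
  next
    case 4
    have V: "V k l = - cot ((real (k + l - m) - \<rho>) * h)" using 4 by (simp add: V_def a_def)
    have "k + l - m \<in> {1..m}" using 4 assms by auto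
    from sin_a_pos[OF this] have p: "sin ((real (k + l - m) - \<rho>) * h) \<noteq> 0" by (rule less_imp_neq[THEN not_sym])
    have e: "(real (k + l - m) - \<rho>) * h - \<delta> - \<tau> k - \<tau> l = - pi"
      using 4 by (simp add: \<tau>_def \<delta>_def of_nat_diff algebra_simps mh)
    show ?thesis using M_diff[OF assms(1,2) p] unfolding e V by simp
  qed (simp_all add: V_def mu_0)
qed

text \<open>By \<open>M_diff\<close> the height difference has the sign of - sin (r h) sin (\<tau> p
  - \<tau> q). Both sines change sign as q passes p: for 2 p = i because r passes 0, for 2 p = i + m
  + 1 because r passes - m. So line p is extremal.\<close>

lemma top:
  assumes i: "i \<in> {1..<m}" and p: "p \<in> {1..m}" "(2 * p) mod (m + 1) = i" and q: "q \<le> m" "q \<noteq> p"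
  shows "if odd i then \<mu> q * (b i - b q) < \<mu> p * (b i - b p) else \<mu> p * (b i - b p) < \<mu> q * (b i - b q)"
proof -
  let ?\<psi> = "(real i + 1/2 - \<rho>) * h"
  have ps: "0 < sin ?\<psi>" using i rho by (intro sin_h_pos) auto
  have bi: "b i = - cot ?\<psi>" by (simp add: b_def)
  have p2: "2 * p = i \<or> 2 * p = i + (m + 1)"
    using p by (cases "2 * p < m + 1") (auto simp: mod_if le_mod_geq split: if_splits)
  have par: "odd i \<Longrightarrow> 2 * p = i + (m + 1)" "even i \<Longrightarrow> 2 * p = i"
    using p2 even_m by (auto, presburger)
  define r where "r = (if q = 0 then real i - real p else real i + 1/2 - real p - real q)"
  have e: "?\<psi> - \<delta> - \<tau> p - \<tau> q = r * h" using p by (simp add: r_def \<tau>_def \<delta>_def algebra_simps)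
  have D: "\<mu> p * (b i - b p) - \<mu> q * (b i - b q) = - 2 * (sin (r * h) * sin (\<tau> p - \<tau> q)) / sin ?\<psi>"
    unfolding bi using M_diff[of p q ?\<psi>] p q ps unfolding e by simp
  show ?thesis
  proof (cases "odd i")
    case True
    then have pp: "2 * real p = real i + real m + 1" using par by (metis of_nat_add of_nat_mult of_nat_numeral of_nat_1 add.assoc)
    have "sin (r * h) * sin (\<tau> p - \<tau> q) < 0"
    proof (cases "q < p")
      case lt: True
      then have "real q + 1 \<le> real p" by linarith
      then have "sin (r * h) < 0" using pp lt i p by (intro sin_h_neg) (auto simp: r_def)
      then show ?thesis using tau_diff_pos[OF lt] p by (simp add: mult_neg_pos)
    next
      case False
      then have gt: "p < q" using q by simp
      then have "real p + 1 \<le> real q" by linarith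
      then have "0 < sin (r * h)" using pp gt i p q by (intro sin_h_pos2) (auto simp: r_def)
      then show ?thesis using tau_diff_neg[OF gt q(1)] by (simp add: mult_pos_neg)
    qed
    then have "0 < - 2 * (sin (r * h) * sin (\<tau> p - \<tau> q)) / sin ?\<psi>" using ps by (intro divide_pos_pos) linarith+
    then show ?thesis using D True by simp
  next
    case False
    then have pp: "2 * real p = real i" using par by (metis of_nat_mult of_nat_numeral)
    have "0 < sin (r * h) * sin (\<tau> p - \<tau> q)"
    proof (cases "q < p")
      case lt: True
      then have "real q + 1 \<le> real p" by linarith
      then have "0 < sin (r * h)" using pp lt i p by (intro sin_h_pos) (auto simp: r_def)
      then show ?thesis using tau_diff_pos[OF lt] p by simp
    next
      case ge: False
      then have gt: "p < q" using q by simp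
      then have "real p + 1 \<le> real q" "real i < real m" using i by auto
      then have "sin (r * h) < 0" using pp gt i p q by (intro sin_h_neg) (auto simp: r_def)
      then show ?thesis using tau_diff_neg[OF gt q(1)] by (simp add: mult_neg_neg)
    qed
    then have "- 2 * (sin (r * h) * sin (\<tau> p - \<tau> q)) / sin ?\<psi> < 0" using ps by (intro divide_neg_pos) linarith+
    then show ?thesis using D False by simp
  qed
qed


lemma V_sym: "V k l = V l k"
  by (simp add: V_def add.commute)

lemma cot_position_a: "cot_position m \<rho> = a"
  by (rule ext) (simp add: cot_position_def a_def h_def)

lemma a_mono: "\<lbrakk>1 \<le> i; i < j; j \<le> m\<rbrakk> \<Longrightarrow> a i < a j"
  using cot_position_strict_mono[of \<rho> i j m] rho unfolding cot_position_a by simp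

lemma b_mono: "\<lbrakk>1 \<le> k; k < l; l \<le> m\<rbrakk> \<Longrightarrow> b k < b l"
proof -
  assume k: "1 \<le> k" "k < l" "l \<le> m"
  then have "b k < a (k + 1)" "a l < b l" using b_less_a[of k] a_less_b[of l] by auto
  moreover have "a (k + 1) \<le> a l" using a_mono[of "k + 1" l] k by (cases "k + 1 = l") auto
  ultimately show ?thesis by simp
qed

text \<open>At \<epsilon> = 0 all order relations are strict except at the triple points, which
  \<open>V_value\<close> resolves for every positive tilt. The strict ones are finitely many and
  persist for small \<epsilon>.\<close>

lemma doublable_step:
  assumes old: "doublable m (cot_position m \<rho>) c"
  shows "\<exists>c'. doublable (2 * m) (cot_position (2 * m) (2 * \<rho> - 1)) c'"
proof -
  have old: "doublable m a c" using old by (simp add: cot_position_a)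
  \<comment> \<open>Larger than every absolute value of c j, which makes all sheared tilts c j + K
    positive.\<close>
  define K where "K = 1 + (\<Sum>j\<in>{1..m}. \<bar>c j\<bar>)"
  have cK: "0 < c j + K" if "j \<in> {1..m}" for j
  proof -
    have "\<bar>c j\<bar> \<le> (\<Sum>j\<in>{1..m}. \<bar>c j\<bar>)" using that by (intro member_le_sum) auto
    then show ?thesis unfolding K_def by linarith
  qed
  \<comment> \<open>The abscissa where flat line k meets the steep line of tilt \<epsilon> (c j +
    K); it tends to a j with \<epsilon>.\<close>
  define X where "X \<epsilon> k j = (a j - \<epsilon> * (c j + K) * \<mu> k * b k) / (1 - \<epsilon> * (c j + K) * \<mu> k)" for \<epsilon> k j
  \<comment> \<open>(x i j, y i j) is the common point of the old lines i and j.\<close>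
  define y where "y i j = (a j - a i) / (c i - c j)" for i j
  define x where "x i j = a i + c i * y i j" for i j
  \<comment> \<open>A margin smaller than all gaps between neighbouring points a and b: crossings
    closer than d to a j keep the order.\<close>
  have "\<exists>d>0. \<forall>i\<in>{1..m}. a i + d < b i \<and> (i < m \<longrightarrow> b i + d < a (i + 1))"
  proof -
    have "\<forall>i\<in>{1..m}. \<forall>\<^sub>F d in at_right 0. a i + d < b i \<and> (i < m \<longrightarrow> b i + d < a (i + 1))"
    proof
      fix i assume i: "i \<in> {1..m}"
      have "((\<lambda>d. a i + d) \<longlongrightarrow> a i + 0) (at_right 0)" "((\<lambda>d. b i + d) \<longlongrightarrow> b i + 0) (at_right 0)"
        by (intro tendsto_intros)+
      then have "\<forall>\<^sub>F d in at_right 0. a i + d < b i" "\<forall>\<^sub>F d in at_right 0. i < m \<longrightarrow> b i + d < a (i + 1)"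
        using a_less_b[OF i] b_less_a[of i] i by (auto dest: order_tendstoD)
      then show "\<forall>\<^sub>F d in at_right 0. a i + d < b i \<and> (i < m \<longrightarrow> b i + d < a (i + 1))"
        by (rule eventually_conj)
    qed
    then have "\<forall>\<^sub>F d in at_right 0. \<forall>i\<in>{1..m}. a i + d < b i \<and> (i < m \<longrightarrow> b i + d < a (i + 1))"
      by (intro eventually_ball_finite) auto
    moreover have "\<forall>\<^sub>F d in at_right (0::real). 0 < d" by (rule eventually_at_right_less)
    ultimately have "\<forall>\<^sub>F d in at_right 0. 0 < d \<and> (\<forall>i\<in>{1..m}. a i + d < b i \<and> (i < m \<longrightarrow> b i + d < a (i + 1)))"
      by (intro eventually_conj)
    then show ?thesis by (rule eventually_happens'[OF trivial_limit_at_right_real])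
  qed
  then obtain d where d: "0 < d" "\<And>i. i \<in> {1..m} \<Longrightarrow> a i + d < b i" "\<And>i. i \<in> {1..<m} \<Longrightarrow> b i + d < a (i + 1)"
    by auto
  have "\<forall>\<^sub>F \<epsilon> in at_right 0. \<forall>k\<in>{..m}. \<forall>j\<in>{1..m}. \<bar>X \<epsilon> k j - a j\<bar> < d"
  proof (intro eventually_ball_finite ballI)
    fix k j
    have "((\<lambda>\<epsilon>. X \<epsilon> k j) \<longlongrightarrow> (a j - 0 * (c j + K) * \<mu> k * b k) / (1 - 0 * (c j + K) * \<mu> k)) (at_right 0)"
      unfolding X_def by (intro tendsto_intros) simp
    then have "((\<lambda>\<epsilon>. X \<epsilon> k j) \<longlongrightarrow> a j) (at_right 0)" by simp
    then show "\<forall>\<^sub>F \<epsilon> in at_right 0. \<bar>X \<epsilon> k j - a j\<bar> < d" using d(1) by (auto dest: tendstoD simp: dist_real_def)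
  qed auto
  moreover have "\<forall>\<^sub>F \<epsilon> in at_right 0. \<forall>i\<in>{1..m}. \<forall>j\<in>{i<..m}. \<forall>k\<in>{..m}.
      0 < y i j * (y i j - \<epsilon> * (\<mu> k * (x i j + K * y i j - b k)))"
  proof (intro eventually_ball_finite ballI)
    fix i j k assume ij: "i \<in> {1..m}" "j \<in> {i<..m}"
    have "y i j \<noteq> 0" using doublable_slopes[OF old, of i j] ij by (auto simp: y_def)
    then have "0 < y i j * (y i j - 0 * (\<mu> k * (x i j + K * y i j - b k)))" by (auto simp: zero_less_mult_iff)
    moreover have "((\<lambda>\<epsilon>. y i j * (y i j - \<epsilon> * (\<mu> k * (x i j + K * y i j - b k)))) \<longlongrightarrow>
       y i j * (y i j - 0 * (\<mu> k * (x i j + K * y i j - b k)))) (at_right 0)"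
      by (intro tendsto_intros)
    ultimately show "\<forall>\<^sub>F \<epsilon> in at_right 0. 0 < y i j * (y i j - \<epsilon> * (\<mu> k * (x i j + K * y i j - b k)))"
      by (rule order_tendstoD(1)[rotated])
  qed auto
  moreover have "\<forall>\<^sub>F \<epsilon> in at_right (0::real). 0 < \<epsilon>" by (rule eventually_at_right_less)
  ultimately have "\<forall>\<^sub>F \<epsilon> in at_right 0. (\<forall>k\<in>{..m}. \<forall>j\<in>{1..m}. \<bar>X \<epsilon> k j - a j\<bar> < d) \<and>
     (\<forall>i\<in>{1..m}. \<forall>j\<in>{i<..m}. \<forall>k\<in>{..m}. 0 < y i j * (y i j - \<epsilon> * (\<mu> k * (x i j + K * y i j - b k)))) \<and> 0 < \<epsilon>"
    by (intro eventually_conj)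
  from eventually_happens'[OF trivial_limit_at_right_real this]
  obtain \<epsilon> where E: "\<forall>k\<in>{..m}. \<forall>j\<in>{1..m}. \<bar>X \<epsilon> k j - a j\<bar> < d"
     "\<forall>i\<in>{1..m}. \<forall>j\<in>{i<..m}. \<forall>k\<in>{..m}. 0 < y i j * (y i j - \<epsilon> * (\<mu> k * (x i j + K * y i j - b k)))"
     and eps: "0 < \<epsilon>"
    by (elim exE conjE)
  have near: "\<bar>X \<epsilon> k j - a j\<bar> < d" if "k \<le> m" "j \<in> {1..m}" for k j
    using E(1) that by simp
  have fary: "0 < y i j * (y i j - \<epsilon> * (\<mu> k * (x i j + K * y i j - b k)))"
    if "i \<in> {1..m}" "j \<in> {1..m}" "i < j" "k \<le> m" for i j k
    using E(2) that by simp
  define e where "e j = \<epsilon> * (c j + K)" for j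
  define xP where "xP = X \<epsilon>"
  have e_pos: "0 < e j" if "j \<in> {1..m}" for j using cK[OF that] eps by (simp add: e_def)
  have mu_le: "\<mu> k \<le> 0" if "k \<le> m" for k using mu_neg[of k] mu_0 that by (cases "k = 0") (auto simp: less_imp_le)
  have den: "0 < 1 - e j * \<mu> k" if "k \<le> m" "j \<in> {1..m}" for k j
    using mult_nonneg_nonpos[OF less_imp_le[OF e_pos[OF that(2)]] mu_le[OF that(1)]] by simp
  have xP_on: "z - a j - e j * (\<mu> k * (z - b k)) = (1 - e j * \<mu> k) * (z - xP k j)" if "k \<le> m" "j \<in> {1..m}" for k j z
  proof -
    have "xP k j = (a j - e j * \<mu> k * b k) / (1 - e j * \<mu> k)" by (simp add: xP_def X_def e_def mult.assoc)
    then have "(1 - e j * \<mu> k) * xP k j = a j - e j * \<mu> k * b k" using den[OF that] by simp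
    then show ?thesis by (simp add: algebra_simps)
  qed
  have ab: "a i + d < b j" if "1 \<le> i" "i \<le> j" "j \<le> m" for i j
    using d(2)[of i] b_mono[of i j] that by (cases "i = j") auto
  have ba: "b i + d < a j" if "1 \<le> i" "i < j" "j \<le> m" for i j
  proof -
    have "a (i + 1) \<le> a j" using a_mono[of "i + 1" j] that by (cases "i + 1 = j") auto
    then show ?thesis using d(3)[of i] that by simp
  qed
  have aa: "a i + 2 * d < a j" if "1 \<le> i" "i < j" "j \<le> m" for i j
    using ab[of i i] ba[of i j] that by simp
  have near': "a j - d < xP k j" "xP k j < a j + d" if "k \<le> m" "j \<in> {1..m}" for k j
    using near[OF that] by (auto simp: xP_def abs_less_iff)
  have sgn_xP: "xP k j < z \<longleftrightarrow> 0 < z - a j - e j * (\<mu> k * (z - b k))" "z < xP k j \<longleftrightarrow> z - a j - e j * (\<mu> k * (z - b k)) < 0"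
    if "k \<le> m" "j \<in> {1..m}" for k j z
    unfolding xP_on[OF that] using den[OF that] by (auto simp: zero_less_mult_iff mult_less_0_iff)
  have V_order: "if j \<le> (k + l) mod (m + 1) then xP k j < V k l else V k l < xP k j"
    if kl: "k \<le> m" "l \<le> m" "k \<noteq> l" and j: "j \<in> {1..m}" for k l j
  proof -
    consider "k = 0" | "l = 0" "k \<noteq> 0" | "k \<noteq> 0" "l \<noteq> 0" "k + l \<le> m" | "k \<noteq> 0" "l \<noteq> 0" "m < k + l" by linarith
    then show ?thesis
    proof cases
      case 1
      then show ?thesis using kl j near'[of k j] ab[of j l] ba[of l j] by (cases "j \<le> l") (auto simp: V_def)
    next
      case 2
      then show ?thesis using kl j near'[of k j] ab[of j k] ba[of k j] by (cases "j \<le> k") (auto simp: V_def)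
    next
      case 3
      \<comment> \<open>Below the axis a line of positive tilt runs to the left of its axis point.
        The vertex over a (k + l) is thus to the right of steep line k + l, in cell k + l.\<close>
      have V: "V k l = a (k + l)" and md: "(k + l) mod (m + 1) = k + l" using 3 by (auto simp: V_def)
      have "\<mu> k * (V k l - b k) < 0" using V_value(1)[of k l] 3 kl by auto
      then have "e j * (\<mu> k * (V k l - b k)) < 0" using e_pos[OF j] by (simp add: mult_pos_neg)
      then have "xP k j < V k l" if "j = k + l" using sgn_xP(1)[OF kl(1) j, of "V k l"] V that by simp
      moreover have "xP k j < V k l" if "j < k + l" using near'[OF kl(1) j] aa[of j "k + l"] 3 j d(1) that V by auto
      moreover have "V k l < xP k j" if "k + l < j" using near'[OF kl(1) j] aa[of "k + l" j] 3 j d(1) that V by auto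
      ultimately show ?thesis unfolding md by (cases j "k + l" rule: linorder_cases) auto
    next
      case 4
      \<comment> \<open>Here the vertex is above the axis, hence to the left of steep line s. Its
        cell is s - 1 = k + l - (m + 1): this turns the sum modulo m into a sum modulo m +
        1.\<close>
      define s where "s = k + l - m"
      have s: "1 \<le> s" "s \<le> m" using 4 kl by (auto simp: s_def)
      have V: "V k l = a s" using 4 by (auto simp: V_def s_def)
      have "k + l = (s - 1) + (m + 1)" using 4 by (simp add: s_def)
      then have "(k + l) mod (m + 1) = (s - 1) mod (m + 1)" by (simp only: mod_add_self2)
      then have md: "(k + l) mod (m + 1) = s - 1" using s by simp
      have "0 < \<mu> k * (V k l - b k)" using V_value(2)[of k l] 4 kl by auto
      then have "0 < e j * (\<mu> k * (V k l - b k))" using e_pos[OF j] by simp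
      then have "V k l < xP k j" if "j = s" using sgn_xP(2)[OF kl(1) j, of "V k l"] V that by simp
      moreover have "xP k j < V k l" if "j < s" using near'[OF kl(1) j] aa[of j s] s j d(1) that V by auto
      moreover have "V k l < xP k j" if "s < j" using near'[OF kl(1) j] aa[of s j] s j d(1) that V by auto
      ultimately show ?thesis unfolding md using s by (cases j s rule: linorder_cases) auto
    qed
  qed
  interpret D: doubling m a b \<mu> e V xP
  proof
    show "xP k j - a j - e j * (\<mu> k * (xP k j - b k)) = 0" if "k \<le> m" "j \<in> {1..m}" for k j
      unfolding xP_on[OF that] by simp
    show "xP k i < xP k j" if "k \<le> m" "1 \<le> i" "i < j" "j \<le> m" for k i j
      using near'[of k i] near'[of k j] aa[of i j] that by auto
    show "xP k j < V k l" if "k \<le> m" "l \<le> m" "k \<noteq> l" "1 \<le> j" "j \<le> (k + l) mod (m + 1)" for k l j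
    proof -
      have "(k + l) mod (m + 1) < m + 1" by (rule mod_less_divisor) simp
      then have "j \<in> {1..m}" using that(4,5) unfolding atLeastAtMost_iff by linarith
      then show ?thesis using V_order[OF that(1-3), of j] that by simp
    qed
    show "V k l < xP k j" if "k \<le> m" "l \<le> m" "k \<noteq> l" "(k + l) mod (m + 1) < j" "j \<le> m" for k l j
      using V_order[OF that(1-3), of j] that by simp
    show "V 0 k = b k" for k by (simp add: V_def)
  qed (use even_m m4 mu_0 mu_neg mu_inj b_mono e_pos V_sym V_common in auto)
  have new_pos: "D.new_pos = cot_position (2 * m) (2 * \<rho> - 1)"
  proof
    fix i
    \<comment> \<open>With the angular unit halved, j - \<rho> becomes (2 j - 1) - (2 \<rho> - 1)
      and k + 1/2 - \<rho> becomes 2 k - (2 \<rho> - 1).\<close>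
    have h: "r * h = 2 * r * (pi / real (2 * m))" for r by (simp add: h_def)
    show "D.new_pos i = cot_position (2 * m) (2 * \<rho> - 1) i"
    proof (cases "odd i")
      case True
      then obtain j where "i = 2 * j + 1" by (auto elim: oddE)
      then show ?thesis unfolding D.new_pos_def cot_position_def a_def h by (simp add: algebra_simps)
    next
      case False
      then obtain j where "i = 2 * j" by (auto elim: evenE)
      then show ?thesis unfolding D.new_pos_def cot_position_def b_def h by (simp add: algebra_simps)
    qed
  qed
  have "doublable (2 * m) D.new_pos D.new_tilt"
  proof (rule D.doublable_double[OF eps _ old])
    show "e j = \<epsilon> * (c j + K)" for j by (simp add: e_def)
    show "0 < snd P * D.g k (fst P + K * snd P, snd P / \<epsilon>)"
      if ij: "i \<in> {1..m}" "j \<in> {1..m}" "i < j" "k \<le> m" "ell (a i) (c i) P = 0" "ell (a j) (c j) P = 0" for i j k P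
    proof -
      have c: "c i \<noteq> c j" using doublable_slopes[OF old] ij by blast
      have "(c i - c j) * snd P = a j - a i" using ij(5,6) by (simp add: ell_def algebra_simps)
      then have y: "snd P = y i j" using c by (simp add: y_def field_simps)
      then have x: "fst P = x i j" using ij(5) by (simp add: x_def ell_def)
      have "snd P * D.g k (fst P + K * snd P, snd P / \<epsilon>) =
          (y i j * (y i j - \<epsilon> * (\<mu> k * (x i j + K * y i j - b k)))) / \<epsilon>"
        using eps unfolding x y D.g_def D.flat_def by (simp add: field_simps)
      then show ?thesis using fary[OF ij(1-4)] eps by simp
    qed
    show "xP p i < b i \<and> b i < xP p (i + 1)" if "i \<in> {1..<m}" "p \<in> {1..m}" for i p
      using near'[of p i] near'[of p "i + 1"] d(2)[of i] d(3)[of i] that by auto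
    show "if odd i then D.flat q (b i) < D.flat p (b i) else D.flat p (b i) < D.flat q (b i)"
      if "i \<in> {1..<m}" "p \<in> {1..m}" "(2 * p) mod (m + 1) = i" "q \<le> m" "q \<noteq> p" for i p q
      using top[OF that] unfolding D.flat_def .
    show "D.new_pos i < D.new_pos j" if "1 \<le> i" "i < j" "j \<le> 2 * m" for i j
      unfolding new_pos using rho that by (intro cot_position_strict_mono) auto
  qed
  then show ?thesis unfolding new_pos by blast
qed

end

section \<open>The initial arrangement of 19 lines\<close>

text \<open>Writing c j = base_offset j / sin ((j - \<rho>) * pi / 18), the orientation of three lines is the sign of a
  linear form in the offsets with coefficients sin (n * pi / 18), independently of \<rho>. The index 0 stands for the
  line at infinity in the limit \<rho> \<rightarrow> 0. The offsets are a rounded solution of the linear program given by the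
  combinatorial type.\<close>

definition base_offset :: "int \<Rightarrow> int" where
  "base_offset i = (if i < 10 then if i < 5 then if i < 2 then if i = 0 then 0 else - 135 else if i = 2 then - 3851 else if i = 3 then 1651 else - 100
     else if i < 7 then if i = 5 then 5000 else - 254 else if i = 7 then 978 else if i = 8 then - 1523 else 418
   else if i < 14 then if i < 12 then if i = 10 then - 1054 else 461 else if i = 12 then - 1726 else - 116
     else if i < 16 then if i = 14 then - 1003 else 534 else if i = 16 then - 1456 else if i = 17 then 1131 else - 761)"

definition sin_step :: "int \<Rightarrow> real" where "sin_step n = sin (of_int n * (pi / 18))"

text \<open>For 0 \<le> n \<le> 18, 100000 times the sine lies between this integer and the integer
  plus 2. Width 2 lets the exact values 0, 1/2 and 1 sit in the middle of their intervals.\<close>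

definition sin_lower :: "int \<Rightarrow> int" where
  "sin_lower n = (let k = (if n \<le> 9 then n else 18 - n) in
     if k < 5 then if k < 2 then if k = 0 then - 1 else 17364 else if k = 2 then 34201 else if k = 3 then 49999 else 64278
     else if k < 7 then if k = 5 then 76603 else 86602 else if k = 7 then 93968 else if k = 8 then 98480 else 99999)"

text \<open>Interval arithmetic: the end of the enclosure is chosen by the sign of d, which gives a
  lower bound for 100000 d sin (n pi / 18).\<close>

definition prod_lower :: "int \<Rightarrow> int \<Rightarrow> int" where
  "prod_lower d n = (if 0 \<le> d then d * sin_lower n else d * (sin_lower n + 2))"

text \<open>A sufficient certificate for a positive \<open>base_det\<close>, as
  \<open>neg_orient\<close> is for a negative one. Since each sorted triple has one of the two,
  failure of \<open>pos_orient\<close> may be read as negative.\<close>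

definition pos_orient :: "int \<Rightarrow> int \<Rightarrow> int \<Rightarrow> bool" where
  "pos_orient i j k \<longleftrightarrow> 0 < prod_lower (base_offset i) (k - j) + prod_lower (- base_offset j) (k - i) + prod_lower (base_offset k) (j - i)"

definition neg_orient :: "int \<Rightarrow> int \<Rightarrow> int \<Rightarrow> bool" where
  "neg_orient i j k \<longleftrightarrow> 0 < prod_lower (- base_offset i) (k - j) + prod_lower (base_offset j) (k - i) + prod_lower (- base_offset k) (j - i)"

definition base_det :: "int \<Rightarrow> int \<Rightarrow> int \<Rightarrow> real" where
  "base_det i j k = base_offset i * sin_step (k - j) - base_offset j * sin_step (k - i) + base_offset k * sin_step (j - i)"

text \<open>Whether the common point of lines i < j lies to the right of line q: the orientation of
  the sorted triple, negated when sorting takes one swap, times the sign of c j - c i. Equality of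
  truth values is the product of signs.\<close>

definition pos_side :: "int \<Rightarrow> int \<Rightarrow> int \<Rightarrow> bool" where
  "pos_side i j q \<longleftrightarrow> (if q < i then pos_orient q i j else if q < j then \<not> pos_orient i q j else pos_orient i j q) = pos_orient 0 i j"

text \<open>The 18 (18 - 3) / 3 = 90 empty triangles away from the axis that the invariant requires
  for m = 18.\<close>

definition base_triples :: "(int \<times> int \<times> int) list" where
  "base_triples = [(1,2,18), (1,3,5), (1,3,17), (1,4,11), (1,4,13), (1,6,13), (1,7,15), (1,7,17), (1,8,12),
     (1,8,14), (1,9,11), (1,9,15), (1,10,14), (1,16,18), (2,3,5), (2,4,5), (2,4,7), (2,6,7), (2,6,9), (2,8,9),
     (2,8,11), (2,10,11), (2,10,13), (2,12,13), (2,12,15), (2,14,15), (2,14,17), (2,16,17), (3,4,8), (3,6,8),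
     (3,6,12), (3,7,13), (3,7,14), (3,9,14), (3,9,16), (3,10,12), (3,10,16), (3,11,13), (3,11,18), (3,15,18),
     (4,6,14), (4,7,17), (4,8,16), (4,9,15), (4,9,17), (4,10,14), (4,10,18), (4,11,15), (4,12,16), (4,12,18),
     (5,6,8), (5,7,8), (5,7,10), (5,9,10), (5,9,12), (5,11,12), (5,11,14), (5,13,14), (5,13,16), (5,15,16),
     (5,15,18), (5,17,18), (6,9,17), (6,10,16), (6,10,18), (6,11,15), (6,11,17), (6,12,16), (6,13,15),
     (6,14,18), (7,9,12), (7,9,16), (7,10,12), (7,11,18), (7,13,18), (7,14,16), (8,10,15), (8,11,17),
     (8,12,18), (8,13,15), (8,13,17), (8,16,18), (9,13,18), (9,14,18), (10,13,17), (10,15,17), (11,13,16),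
     (11,14,16), (12,14,17), (12,15,17)]"

text \<open>The enclosures are sharp enough to decide every orientation; in particular none
  vanishes.\<close>

lemma dichotomy_check:
  "list_all (\<lambda>i. list_all (\<lambda>j. list_all (\<lambda>k. pos_orient i j k \<or> neg_orient i j k) [j + 1..18]) [i + 1..18]) [0..18]"
  by code_simp

text \<open>\<open>pos_orient 0 i (i + 1)\<close> stands for c i < c (i + 1), which puts the common
  point below the axis.\<close>

lemma apex_check:
  "list_all (\<lambda>i. pos_orient 0 i (i + 1) = (i mod 2 = 0) \<and>
     list_all (\<lambda>q. q = i \<or> q = i + 1 \<or> pos_side i (i + 1) q = (q < i)) [1..18]) [1..17]"
  by code_simp

lemma base_triples_check:
  "list_all (\<lambda>(i, j, k). 1 \<le> i \<and> i < j \<and> j < k \<and> k \<le> 18 \<and>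
     pos_orient 0 i j = pos_orient 0 i k \<and> pos_orient 0 i k = pos_orient 0 j k \<and>
     list_all (\<lambda>q. q = i \<or> q = j \<or> q = k \<or> pos_side i j q = pos_side i k q \<and> pos_side i k q = pos_side j k q) [1..18]) base_triples"
  by code_simp

lemma base_triples_facts:
  assumes "(i, j, k) \<in> set base_triples"
  shows "1 \<le> i" "i < j" "j < k" "k \<le> 18" "pos_orient 0 i j = pos_orient 0 i k" "pos_orient 0 i k = pos_orient 0 j k"
    "\<And>q. \<lbrakk>1 \<le> q; q \<le> 18; q \<noteq> i; q \<noteq> j; q \<noteq> k\<rbrakk> \<Longrightarrow> pos_side i j q = pos_side i k q \<and> pos_side i k q = pos_side j k q"
proof -
  from bspec[OF base_triples_check[unfolded list_all_iff] assms]
  have "1 \<le> i \<and> i < j \<and> j < k \<and> k \<le> 18 \<and> pos_orient 0 i j = pos_orient 0 i k \<and> pos_orient 0 i k = pos_orient 0 j k \<and>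
     (\<forall>q\<in>set [1..18]. q = i \<or> q = j \<or> q = k \<or> pos_side i j q = pos_side i k q \<and> pos_side i k q = pos_side j k q)"
    unfolding prod.case .
  then show "1 \<le> i" "i < j" "j < k" "k \<le> 18" "pos_orient 0 i j = pos_orient 0 i k" "pos_orient 0 i k = pos_orient 0 j k"
    "\<And>q. \<lbrakk>1 \<le> q; q \<le> 18; q \<noteq> i; q \<noteq> j; q \<noteq> k\<rbrakk> \<Longrightarrow> pos_side i j q = pos_side i k q \<and> pos_side i k q = pos_side j k q"
    by (simp_all add: Ball_def) blast
qed

lemma sorted_triple_eq:
  fixes i j k :: "'a::linorder"
  assumes e: "{i, j, k} = {i', j', k'}" and o: "i < j" "j < k" "i' < j'" "j' < k'"
  shows "i = i'" "j = j'" "k = k'"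
proof -
  have m: "Min {i, j, k} = i" "Min {i', j', k'} = i'" "Max {i, j, k} = k" "Max {i', j', k'} = k'"
    using o by (auto simp: min_def max_def)
  show i: "i = i'" using arg_cong[OF e, of Min] unfolding m .
  show k: "k = k'" using arg_cong[OF e, of Max] unfolding m .
  have "j \<in> {i', j', k'}" unfolding e[symmetric] by simp
  then show "j = j'" using i k o by auto
qed

lemma base_triples_distinct: "distinct base_triples" "length base_triples = 90"
  unfolding base_triples_def by simp_all

text \<open>With x = sin 10 degrees, the triple angle formula gives 3 x - 4 x^3 = 1/2; the cosine
  follows by Pythagoras, and the remaining values from 30, 60 and 90 degrees plus or minus
  10.\<close>

lemma sin_step_bounds:
  assumes "0 \<le> n" "n \<le> 18"
  shows "of_int (sin_lower n) \<le> 100000 * sin_step n" "100000 * sin_step n \<le> of_int (sin_lower n + 2)"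
proof -
  define x y z :: real where "x = sin (pi / 18)" and "y = cos (pi / 18)" and "z = sqrt 3 / 2"
  have x0: "0 < x" unfolding x_def by (rule sin_gt_zero) auto
  have y0: "0 < y" unfolding y_def by (rule cos_gt_zero) auto
  have "x < sin (pi / 6)" unfolding x_def by (rule sin_monotone_2pi) auto
  then have x2: "x < 1/2" by (simp add: sin_30)
  have yy: "y * y = 1 - x * x"
    using sin_cos_squared_add[of "pi / 18"] by (simp add: x_def y_def power2_eq_square)
  have "sin (pi / 18 + (pi / 18 + pi / 18)) = x * (y * y - x * x) + y * (x * y + y * x)"
    by (simp only: sin_add cos_add x_def y_def)
  also have "\<dots> = x * (y * y - x * x) + 2 * x * (y * y)" by simp
  also have "\<dots> = 3 * x - 4 * x ^ 3" unfolding yy by (simp add: power3_eq_cube algebra_simps)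
  also have "pi / 18 + (pi / 18 + pi / 18) = pi / 6" by simp
  finally have cubic: "3 * x - 4 * x ^ 3 = 1/2" by (simp add: sin_30)
  \<comment> \<open>The cubic increases on (0, 1/2), so comparing its values at two decimals
    encloses x.\<close>
  have incr: "3 * u - 4 * u ^ 3 < 3 * v - 4 * v ^ 3" if "0 < u" "u < v" "v < 1/2" for u v :: real
  proof -
    have "u * u < 1/2 * (1/2)" "u * v < 1/2 * (1/2)" "v * v < 1/2 * (1/2)"
      using that by (intro mult_strict_mono; simp)+
    then have "0 < (v - u) * (3 - 4 * (v * v + u * v + u * u))" using that by (intro mult_pos_pos) auto
    then show ?thesis by (simp add: power3_eq_cube algebra_simps)
  qed
  have incr_le: "3 * u - 4 * u ^ 3 \<le> 3 * v - 4 * v ^ 3" if "0 < u" "u \<le> v" "v < 1/2" for u v :: real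
    using incr[of u v] that by (cases "u = v") auto
  have xl: "(173648/1000000) < x"
  proof (rule ccontr)
    assume "\<not> ?thesis"
    then have "3 * x - 4 * x ^ 3 \<le> 3 * (173648/1000000) - 4 * (173648/1000000) ^ 3"
      using x0 by (intro incr_le) auto
    then show False using cubic by (simp add: power3_eq_cube)
  qed
  have xu: "x < (173649/1000000)"
  proof (rule ccontr)
    assume "\<not> ?thesis"
    then have "3 * (173649/1000000) - 4 * (173649/1000000) ^ 3 \<le> 3 * x - 4 * x ^ 3"
      using x2 by (intro incr_le) auto
    then show False using cubic by (simp add: power3_eq_cube)
  qed
  have y2: "y\<^sup>2 = 1 - x\<^sup>2" unfolding x_def y_def by (simp add: cos_squared_eq)
  have xx: "(173648/1000000)\<^sup>2 < x\<^sup>2" "x\<^sup>2 < (173649/1000000)\<^sup>2" using xl xu x0 by (auto intro!: power_strict_mono)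
  have yl: "(984807/1000000) < y" by (rule power_less_imp_less_base[of _ 2]) (use y2 xx y0 in \<open>auto simp: power2_eq_square\<close>)
  have yu: "y < (984809/1000000)" by (rule power_less_imp_less_base[of _ 2]) (use y2 xx y0 in \<open>auto simp: power2_eq_square\<close>)
  have z2: "z\<^sup>2 = 3/4" and z0: "0 < z" by (auto simp: z_def power_divide)
  have zl: "(866025/1000000) < z" by (rule power_less_imp_less_base[of _ 2]) (use z2 z0 in \<open>auto simp: power2_eq_square\<close>)
  have zu: "z < (866026/1000000)" by (rule power_less_imp_less_base[of _ 2]) (use z2 z0 in \<open>auto simp: power2_eq_square\<close>)
  define P Q where "P = x * z" and "Q = y * z"
  have P: "150383 / 1000000 < P" "P < 150385 / 1000000"
  proof -
    have "173648 / 1000000 * (866025 / 1000000) < P" "P < 173649 / 1000000 * (866026 / 1000000)"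
      unfolding P_def using xl xu zl zu by (intro mult_strict_mono; simp)+
    then show "150383 / 1000000 < P" "P < 150385 / 1000000" by simp_all
  qed
  have Q: "852867 / 1000000 < Q" "Q < 852871 / 1000000"
  proof -
    have "984807 / 1000000 * (866025 / 1000000) < Q" "Q < 984809 / 1000000 * (866026 / 1000000)"
      unfolding Q_def using yl yu zl zu by (intro mult_strict_mono; simp)+
    then show "852867 / 1000000 < Q" "Q < 852871 / 1000000" by simp_all
  qed
  have s: "sin (pi / 6) = 1/2" "cos (pi / 6) = z" "sin (pi / 3) = z" "cos (pi / 3) = 1/2"
    by (auto simp: sin_30 cos_30 sin_60 cos_60 z_def)
  have S: "sin_step 0 = 0" "sin_step 1 = x" "sin_step 2 = y / 2 - P" "sin_step 3 = 1/2" "sin_step 4 = y / 2 + P" "sin_step 5 = Q - x / 2"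
    "sin_step 6 = z" "sin_step 7 = Q + x / 2" "sin_step 8 = y" "sin_step 9 = 1"
  proof -
    have "2 * (pi / 18) = pi / 6 - pi / 18" "4 * (pi / 18) = pi / 6 + pi / 18" "5 * (pi / 18) = pi / 3 - pi / 18"
      "7 * (pi / 18) = pi / 3 + pi / 18" "8 * (pi / 18) = pi / 2 - pi / 18" by auto
    note e = this
    show "sin_step 2 = y / 2 - P" "sin_step 4 = y / 2 + P" "sin_step 5 = Q - x / 2" "sin_step 7 = Q + x / 2" "sin_step 8 = y"
      unfolding sin_step_def of_int_numeral e sin_diff sin_add s by (simp_all add: x_def y_def P_def Q_def)
    show "sin_step 0 = 0" "sin_step 1 = x" "sin_step 3 = 1/2" "sin_step 6 = z" "sin_step 9 = 1"
      by (auto simp: sin_step_def x_def s)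
  qed
  have L: "sin_lower 0 = - 1" "sin_lower 1 = 17364" "sin_lower 2 = 34201" "sin_lower 3 = 49999" "sin_lower 4 = 64278" "sin_lower 5 = 76603"
    "sin_lower 6 = 86602" "sin_lower 7 = 93968" "sin_lower 8 = 98480" "sin_lower 9 = 99999"
    by (simp_all add: sin_lower_def)
  have lower: "- 1 \<le> 100000 * sin_step 0" "17364 \<le> 100000 * sin_step 1" "34201 \<le> 100000 * sin_step 2" "49999 \<le> 100000 * sin_step 3"
    "64278 \<le> 100000 * sin_step 4" "76603 \<le> 100000 * sin_step 5" "86602 \<le> 100000 * sin_step 6" "93968 \<le> 100000 * sin_step 7"
    "98480 \<le> 100000 * sin_step 8" "99999 \<le> 100000 * sin_step 9"
    unfolding S using xl xu yl yu zl zu P Q by (simp_all add: field_simps)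
  have upper: "100000 * sin_step 0 \<le> 1" "100000 * sin_step 1 \<le> 17366" "100000 * sin_step 2 \<le> 34203" "100000 * sin_step 3 \<le> 50001"
    "100000 * sin_step 4 \<le> 64280" "100000 * sin_step 5 \<le> 76605" "100000 * sin_step 6 \<le> 86604" "100000 * sin_step 7 \<le> 93970"
    "100000 * sin_step 8 \<le> 98482" "100000 * sin_step 9 \<le> 100001"
    unfolding S using xl xu yl yu zl zu P Q by (simp_all add: field_simps)
  have refl: "sin_step n = sin_step (18 - n)" for n
  proof -
    have e: "of_int n * (pi / 18) = pi - of_int (18 - n) * (pi / 18)" by (simp add: algebra_simps)
    show ?thesis unfolding sin_step_def by (subst e, rule sin_pi_minus)
  qed
  have small: "of_int (sin_lower k) \<le> 100000 * sin_step k \<and> 100000 * sin_step k \<le> of_int (sin_lower k + 2)" if kk: "0 \<le> k" "k \<le> 9" for k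
  proof -
    have "k = 0 \<or> k = 1 \<or> k = 2 \<or> k = 3 \<or> k = 4 \<or> k = 5 \<or> k = 6 \<or> k = 7 \<or> k = 8 \<or> k = 9"
      using kk by presburger
    then show ?thesis
      by (elim disjE) (simp_all add: L lower upper)
  qed
  have "sin_lower n = sin_lower (18 - n)" by (simp add: sin_lower_def Let_def)
  then have "of_int (sin_lower n) \<le> 100000 * sin_step n \<and> 100000 * sin_step n \<le> of_int (sin_lower n + 2)"
    using small[of n] small[of "18 - n"] refl[of n] assms by (cases "n \<le> 9") auto
  then show "of_int (sin_lower n) \<le> 100000 * sin_step n" "100000 * sin_step n \<le> of_int (sin_lower n + 2)" by auto
qed

lemma prod_lower_le:
  assumes "0 \<le> n" "n \<le> 18"
  shows "of_int (prod_lower d n) \<le> 100000 * (of_int d * sin_step n)"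
proof (cases "0 \<le> d")
  case True
  then have "of_int d * of_int (sin_lower n) \<le> of_int d * (100000 * sin_step n)"
    using sin_step_bounds(1)[OF assms] by (intro mult_left_mono) auto
  then show ?thesis using True by (simp add: prod_lower_def algebra_simps)
next
  case False
  then have "of_int d * of_int (sin_lower n + 2) \<le> of_int d * (100000 * sin_step n)"
    using sin_step_bounds(2)[OF assms] by (intro mult_left_mono_neg) auto
  then show ?thesis using False by (simp add: prod_lower_def algebra_simps)
qed

lemma base_det_sign:
  assumes "0 \<le> i" "i < j" "j < k" "k \<le> 18"
  shows "0 < base_det i j k \<longleftrightarrow> pos_orient i j k" "base_det i j k \<noteq> 0"
proof -
  have b: "0 \<le> k - j" "k - j \<le> 18" "0 \<le> k - i" "k - i \<le> 18" "0 \<le> j - i" "j - i \<le> 18" using assms by auto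
  have P: "0 < base_det i j k" if l: "pos_orient i j k"
  proof -
    have "0 < (of_int (prod_lower (base_offset i) (k - j) + prod_lower (- base_offset j) (k - i) + prod_lower (base_offset k) (j - i)) :: real)"
      using l unfolding pos_orient_def of_int_0_less_iff .
    also have "\<dots> \<le> 100000 * base_det i j k"
      using prod_lower_le[OF b(1,2), of "base_offset i"] prod_lower_le[OF b(3,4), of "- base_offset j"] prod_lower_le[OF b(5,6), of "base_offset k"]
      by (simp add: base_det_def)
    finally show ?thesis by simp
  qed
  have N: "base_det i j k < 0" if l: "neg_orient i j k"
  proof -
    have "0 < (of_int (prod_lower (- base_offset i) (k - j) + prod_lower (base_offset j) (k - i) + prod_lower (- base_offset k) (j - i)) :: real)"
      using l unfolding neg_orient_def of_int_0_less_iff .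
    also have "\<dots> \<le> - (100000 * base_det i j k)"
      using prod_lower_le[OF b(1,2), of "- base_offset i"] prod_lower_le[OF b(3,4), of "base_offset j"] prod_lower_le[OF b(5,6), of "- base_offset k"]
      by (simp add: base_det_def)
    finally show ?thesis by simp
  qed
  have "pos_orient i j k \<or> neg_orient i j k"
    using dichotomy_check assms by (simp add: list_all_iff)
  then show "0 < base_det i j k \<longleftrightarrow> pos_orient i j k" "base_det i j k \<noteq> 0" using P N by force+
qed

text \<open>Only orientations matter: at the common point of i and j, the form of line q equals dt i
  j q / (c j - c i). The checked sign patterns therefore settle every condition.\<close>

lemma doublable_base:
  fixes a c :: "nat \<Rightarrow> real"
  defines "dt i j k \<equiv> (a k - a j) * c i + (a i - a k) * c j + (a j - a i) * c k"
  assumes a: "\<And>i j. \<lbrakk>1 \<le> i; i < j; j \<le> 18\<rbrakk> \<Longrightarrow> a i < a j"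
    and c: "\<And>i j. \<lbrakk>1 \<le> i; i < j; j \<le> 18\<rbrakk> \<Longrightarrow> (c i < c j \<longleftrightarrow> pos_orient 0 (int i) (int j)) \<and> c i \<noteq> c j"
    and dt: "\<And>i j k. \<lbrakk>1 \<le> i; i < j; j < k; k \<le> 18\<rbrakk> \<Longrightarrow> (0 < dt i j k \<longleftrightarrow> pos_orient (int i) (int j) (int k)) \<and> dt i j k \<noteq> 0"
  shows "doublable 18 a c"
proof -
  define y where "y i j = (a j - a i) / (c i - c j)" for i j
  define W where "W i j = (a i + c i * y i j, y i j)" for i j
  have cne: "c i \<noteq> c j" if "1 \<le> i" "i < j" "j \<le> 18" for i j using c that by blast
  have ellW: "ell (a q) (c q) (W i j) = dt i j q / (c j - c i)" if "1 \<le> i" "i < j" "j \<le> 18" for i j q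
  proof -
    have "c i - c j \<noteq> 0" using cne[OF that] by simp
    then have "(c j - c i) * y i j = a i - a j" by (simp add: y_def field_simps)
    then have Y: "(c j - c i) * y i j = a i - a j" .
    have "(c j - c i) * ell (a q) (c q) (W i j) = (c j - c i) * (a i - a q) + (c i - c q) * ((c j - c i) * y i j)"
      by (simp add: ell_def W_def algebra_simps)
    also have "\<dots> = dt i j q" unfolding Y by (simp add: dt_def algebra_simps)
    finally have "(c j - c i) * ell (a q) (c q) (W i j) = dt i j q" .
    then show ?thesis using cne[OF that] by (simp add: field_simps)
  qed
  have onW: "ell (a i) (c i) (W i j) = 0" "ell (a j) (c j) (W i j) = 0" if "1 \<le> i" "i < j" "j \<le> 18" for i j
    using ellW[OF that, of i] ellW[OF that, of j] by (simp_all add: dt_def algebra_simps)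
  have uniqW: "P = W i j" if ij: "1 \<le> i" "i < j" "j \<le> 18" and P: "ell (a i) (c i) P = 0" "ell (a j) (c j) P = 0" for i j P
  proof -
    have "(c i - c j) * snd P = a j - a i" using P by (simp add: ell_def algebra_simps)
    then have "snd P = y i j" using cne[OF ij] by (simp add: y_def field_simps)
    then show ?thesis using P(1) by (auto simp: W_def ell_def prod_eq_iff)
  qed
  have anti: "dt i j q = dt q i j" "dt i j q = - dt i q j" for i j q by (auto simp: dt_def algebra_simps)
  have sideW: "0 < ell (a q) (c q) (W i j) \<longleftrightarrow> pos_side (int i) (int j) (int q)" "ell (a q) (c q) (W i j) \<noteq> 0"
    if ij: "1 \<le> i" "i < j" "j \<le> 18" and q: "1 \<le> q" "q \<le> 18" "q \<noteq> i" "q \<noteq> j" for i j q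
  proof -
    define s where "s = (if int q < int i then pos_orient (int q) (int i) (int j)
        else if int q < int j then \<not> pos_orient (int i) (int q) (int j) else pos_orient (int i) (int j) (int q))"
    have d: "(0 < dt i j q \<longleftrightarrow> s) \<and> dt i j q \<noteq> 0"
    proof -
      consider "q < i" | "i < q" "q < j" | "j < q" using q by linarith
      then show ?thesis
      proof cases
        case 1 then show ?thesis using dt[of q i j] anti(1)[of i j q] ij q by (simp add: s_def)
      next
        case 2 then show ?thesis using dt[of i q j] anti(2)[of i j q] ij q by (auto simp: s_def)
      next
        case 3 then show ?thesis using dt[of i j q] ij q by (simp add: s_def)
      qed
    qed
    have "pos_side (int i) (int j) (int q) \<longleftrightarrow> (s = pos_orient 0 (int i) (int j))" unfolding pos_side_def s_def ..
    then show "0 < ell (a q) (c q) (W i j) \<longleftrightarrow> pos_side (int i) (int j) (int q)" "ell (a q) (c q) (W i j) \<noteq> 0"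
      unfolding ellW[OF ij] using d c[OF ij] by (auto simp: zero_less_divide_iff)
  qed
  have sndW: "0 < snd (W i j) \<longleftrightarrow> \<not> pos_orient 0 (int i) (int j)" "snd (W i j) \<noteq> 0" if "1 \<le> i" "i < j" "j \<le> 18" for i j
    using c[OF that] a[OF that] by (auto simp: W_def y_def zero_less_divide_iff)
  have empty_triangle: "empty_triangle 18 a c (nat i) (nat j) (nat k)" if t: "(i, j, k) \<in> set base_triples" for i j k
  proof -
    note T = base_triples_facts[OF t]
    define I J K where "I = nat i" and "J = nat j" and "K = nat k"
    have n: "int I = i" "int J = j" "int K = k" "1 \<le> I" "I < J" "J < K" "K \<le> 18" "1 \<le> J" "I < K" "J \<le> 18"
      using T by (auto simp: I_def J_def K_def)
    have "empty_triangle 18 a c I J K"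
      unfolding empty_triangle_def
    proof (intro conjI exI ballI)
      show "same_sign (snd (W J K)) (snd (W I K)) (snd (W I J))"
        using sndW[of I J] sndW[of I K] sndW[of J K] n T by (auto simp: same_sign_def)
      fix q assume "q \<in> {1..18} - {I, J, K}"
      then have q: "1 \<le> q" "q \<le> 18" "q \<noteq> I" "q \<noteq> J" "q \<noteq> K" by auto
      then have "pos_side i j (int q) = pos_side i k (int q) \<and> pos_side i k (int q) = pos_side j k (int q)"
        using T(7)[of "int q"] n by auto
      then show "same_sign (ell (a q) (c q) (W J K)) (ell (a q) (c q) (W I K)) (ell (a q) (c q) (W I J))"
        using sideW[of I J q] sideW[of I K q] sideW[of J K q] q n by (auto simp: same_sign_def)
    qed (use onW n in auto)
    then show ?thesis by (simp add: I_def J_def K_def)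
  qed
  define f where "f = (\<lambda>(i, j, k). {nat i, nat j, nat k})"
  have inj: "inj_on f (set base_triples)"
  proof (rule inj_onI)
    fix p q assume p: "p \<in> set base_triples" "q \<in> set base_triples" "f p = f q"
    obtain i j k where 1: "p = (i, j, k)" by (cases p)
    obtain i' j' k' where 2: "q = (i', j', k')" by (cases q)
    have o: "1 \<le> i" "i < j" "j < k" "1 \<le> i'" "i' < j'" "j' < k'"
      using base_triples_facts[of i j k] base_triples_facts[of i' j' k'] p 1 2 by auto
    have e: "{nat i, nat j, nat k} = {nat i', nat j', nat k'}" using p 1 2 by (simp add: f_def)
    have "nat i < nat j" "nat j < nat k" "nat i' < nat j'" "nat j' < nat k'" using o by auto
    from sorted_triple_eq[OF e this] have "i = i' \<and> j = j' \<and> k = k'" using o by auto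
    then show "p = q" using 1 2 by simp
  qed
  have "card (f ` set base_triples) = 90" using inj base_triples_distinct by (simp add: card_image distinct_card)
  then have cT: "18 * (18 - 3) \<le> 3 * card (f ` set base_triples)" by simp
  show ?thesis
    unfolding doublable_def
  proof (intro conjI ballI allI impI)
    show "a i < a j" "c i \<noteq> c j" if "i \<in> {1..18}" "j \<in> {1..18}" "i < j" for i j using a cne that by auto
    show "\<not> (ell (a i) (c i) P = 0 \<and> ell (a j) (c j) P = 0 \<and> ell (a k) (c k) P = 0)"
      if "i \<in> {1..18}" "j \<in> {1..18}" "k \<in> {1..18}" "i < j" "j < k" for i j k P
      using uniqW[of i j P] sideW(2)[of i j k] that by auto
    show "apex 18 a c i" if "i \<in> {1..<18}" for i
    proof -
      have i: "1 \<le> i" "i < i + 1" "i + 1 \<le> 18" using that by auto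
      have mem: "int i \<in> set [1..17]" and i1: "int (i + 1) = int i + 1" using i by simp_all
      from bspec[OF apex_check[unfolded list_all_iff] mem]
      have AC': "pos_orient 0 (int i) (int i + 1) = (int i mod 2 = 0) \<and>
        (\<forall>q\<in>set [1..18]. q = int i \<or> q = int i + 1 \<or> pos_side (int i) (int i + 1) q = (q < int i))" .
      note AC = conjunct1[OF AC'] conjunct2[OF AC']
      have A: "pos_orient 0 (int i) (int (i + 1)) = (int i mod 2 = 0)" unfolding i1 by (fact AC(1))
      have A2: "pos_side (int i) (int (i + 1)) (int q) = (q < i)" if "1 \<le> q" "q \<le> 18" "q \<noteq> i" "q \<noteq> i + 1" for q
      proof -
        have q: "int q \<in> set [1..18]" "int q \<noteq> int i" "int q \<noteq> int i + 1" using that by auto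
        from bspec[OF AC(2) q(1)] q(2,3) show ?thesis unfolding i1 by simp
      qed
      have "int i mod 2 = 0 \<longleftrightarrow> even i" by presburger
      then have "if odd i then 0 < snd (W i (i + 1)) else snd (W i (i + 1)) < 0"
        using sndW[OF i] A by (auto simp: not_less order_le_less)
      moreover have "(q < i \<longrightarrow> 0 < ell (a q) (c q) (W i (i + 1))) \<and> (i + 1 < q \<longrightarrow> ell (a q) (c q) (W i (i + 1)) < 0)"
        if "q \<in> {1..18}" for q
        using sideW[OF i, of q] A2[of q] that by (auto simp: not_less order_le_less)
      ultimately show ?thesis unfolding apex_def using onW[OF i] by blast
    qed
    show "\<exists>\<T>. finite \<T> \<and> (\<forall>T\<in>\<T>. \<exists>i j k. T = {i, j, k} \<and> empty_triangle 18 a c i j k) \<and> 18 * (18 - 3) \<le> 3 * card \<T>"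
    proof (intro exI[of _ "f ` set base_triples"] conjI ballI)
      fix T assume "T \<in> f ` set base_triples"
      then obtain i j k where "(i, j, k) \<in> set base_triples" "T = {nat i, nat j, nat k}" by (auto simp: f_def)
      then show "\<exists>i j k. T = {i, j, k} \<and> empty_triangle 18 a c i j k" using empty_triangle by blast
    qed (use cT in auto)
  qed
qed

text \<open>Orientations of three lines do not depend on \<rho>, and the sign of c j - c i is that
  of \<open>base_det 0 i j\<close> once \<rho> is small. The values 1 / (3 2^k) become arbitrarily
  small and are not dyadic.\<close>

lemma doublable_base_exists:
  "\<exists>\<rho> c. 0 < \<rho> \<and> \<rho> < 1 \<and> (\<forall>j::nat. \<rho> * 2 ^ j \<notin> \<int>) \<and> doublable 18 (cot_position 18 \<rho>) c"
proof -
  \<comment> \<open>The numerator of c j - c i over the denominator s i s j; it still makes sense at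
    \<rho> = 0, where s 18 vanishes.\<close>
  define N where "N i j \<rho> = base_offset (int j) * sin ((real i - \<rho>) * (pi / 18)) - base_offset (int i) * sin ((real j - \<rho>) * (pi / 18))" for i j \<rho>
  define r where "r k = 1 / (3 * 2 ^ k :: real)" for k :: nat
  have r0: "r \<longlonglongrightarrow> 0"
  proof -
    have "(\<lambda>k. (1/3) * (1/2) ^ k) \<longlonglongrightarrow> (1/3) * (0::real)" by (intro tendsto_intros) auto
    then show ?thesis unfolding r_def by (simp add: power_divide)
  qed
  have N0: "N i j 0 = base_det 0 (int i) (int j)" for i j
    by (simp add: N_def base_det_def sin_step_def base_offset_def)
  have "\<forall>\<^sub>F k in sequentially. \<forall>i\<in>{1..18}. \<forall>j\<in>{i<..18}. 0 < N i j (r k) * N i j 0"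
  proof (intro eventually_ball_finite ballI)
    fix i j :: nat assume ij: "i \<in> {1..18}" "j \<in> {i<..18}"
    have "N i j 0 \<noteq> 0" unfolding N0 using base_det_sign(2)[of 0 "int i" "int j"] ij by auto
    then have "0 < N i j 0 * N i j 0" by (auto simp: zero_less_mult_iff)
    moreover have "(\<lambda>k. N i j (r k) * N i j 0) \<longlonglongrightarrow> N i j 0 * N i j 0"
      unfolding N_def by (intro tendsto_intros r0)
    ultimately show "\<forall>\<^sub>F k in sequentially. 0 < N i j (r k) * N i j 0" by (rule order_tendstoD(1)[rotated])
  qed auto
  then obtain k where k: "\<forall>i\<in>{1..18}. \<forall>j\<in>{i<..18}. 0 < N i j (r k) * N i j 0"
    using eventually_happens'[OF sequentially_bot] by blast
  define \<rho> where "\<rho> = r k"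
  have rho: "0 < \<rho>" "\<rho> < 1"
  proof -
    have "(1::real) \<le> 2 ^ k" by simp
    then have "(1::real) < 3 * 2 ^ k" by linarith
    then show "0 < \<rho>" "\<rho> < 1" by (auto simp: \<rho>_def r_def)
  qed
  have irr: "\<rho> * 2 ^ j \<notin> \<int>" for j :: nat
  proof
    assume "\<rho> * 2 ^ j \<in> \<int>"
    then obtain z where "\<rho> * 2 ^ j = of_int z" by (auto elim: Ints_cases)
    then have "(2::real) ^ j = of_int z * (3 * 2 ^ k)" by (simp add: \<rho>_def r_def field_simps)
    then have "real_of_int (2 ^ j) = of_int (z * (3 * 2 ^ k))" by simp
    then have "(2::int) ^ j = z * (3 * 2 ^ k)" by (simp only: of_int_eq_iff)
    then have "(3::int) dvd 2 ^ j" by simp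
    moreover have "\<not> (3::int) dvd 2 ^ j"
    proof (induction j)
      case (Suc j)
      have "\<not> 3 dvd 2 * x" if "\<not> 3 dvd x" for x :: int using that by presburger
      then show ?case using Suc by simp
    qed simp
    ultimately show False by simp
  qed
  define s where "s i = sin ((real i - \<rho>) * (pi / 18))" for i
  define c where "c i = base_offset (int i) / s i" for i
  have s: "0 < s i" if "1 \<le> i" "i \<le> 18" for i
    unfolding s_def
  proof (rule sin_gt_zero)
    show "0 < (real i - \<rho>) * (pi / 18)" using that rho by simp
    have "(real i - \<rho>) * (pi / 18) < 18 * (pi / 18)" using that rho by (intro mult_strict_right_mono) auto
    then show "(real i - \<rho>) * (pi / 18) < pi" by simp
  qed
  have ad: "cot_position 18 \<rho> j - cot_position 18 \<rho> i = sin_step (int j - int i) / (s i * s j)" if "1 \<le> i" "i \<le> 18" "1 \<le> j" "j \<le> 18" for i j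
  proof -
    have e: "(real j - \<rho>) * (pi / 18) - (real i - \<rho>) * (pi / 18) = of_int (int j - int i) * (pi / 18)"
      by (simp add: field_simps)
    have "sin ((real i - \<rho>) * (pi / 18)) \<noteq> 0" "sin ((real j - \<rho>) * (pi / 18)) \<noteq> 0"
      using s[of i] s[of j] that unfolding s_def by linarith+
    from cot_diff[OF this] show ?thesis unfolding e by (simp add: cot_position_def s_def sin_step_def)
  qed
  have "doublable 18 (cot_position 18 \<rho>) c"
  proof (rule doublable_base)
    show "cot_position 18 \<rho> i < cot_position 18 \<rho> j" if "1 \<le> i" "i < j" "j \<le> 18" for i j
      using cot_position_strict_mono rho that by blast
    show "(c i < c j \<longleftrightarrow> pos_orient 0 (int i) (int j)) \<and> c i \<noteq> c j" if ij: "1 \<le> i" "i < j" "j \<le> 18" for i j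
    proof -
      have si: "0 < s i" "0 < s j" using s ij by auto
      have "N i j \<rho> = base_offset (int j) * s i - base_offset (int i) * s j" by (simp only: N_def s_def)
      then have d: "c j - c i = N i j \<rho> / (s i * s j)" using si by (simp add: c_def field_simps)
      have "0 < N i j \<rho> * base_det 0 (int i) (int j)" using k ij unfolding \<rho>_def N0[symmetric] by auto
      then have "(0 < N i j \<rho> \<longleftrightarrow> pos_orient 0 (int i) (int j)) \<and> N i j \<rho> \<noteq> 0"
        using base_det_sign[of 0 "int i" "int j"] ij by (auto simp: zero_less_mult_iff)
      then have "(0 < c j - c i \<longleftrightarrow> pos_orient 0 (int i) (int j)) \<and> c j - c i \<noteq> 0"
        unfolding d using mult_pos_pos[OF si] by (auto simp: zero_less_divide_iff)
      then show ?thesis by auto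
    qed
    fix i j k :: nat assume ijk: "1 \<le> i" "i < j" "j < k" "k \<le> 18"
    have sp: "0 < s i" "0 < s j" "0 < s k" using s ijk by auto
    have sym: "cot_position 18 \<rho> i - cot_position 18 \<rho> k = - (cot_position 18 \<rho> k - cot_position 18 \<rho> i)" by simp
    have "(cot_position 18 \<rho> k - cot_position 18 \<rho> j) * c i + (cot_position 18 \<rho> i - cot_position 18 \<rho> k) * c j + (cot_position 18 \<rho> j - cot_position 18 \<rho> i) * c k
      = base_det (int i) (int j) (int k) / (s i * s j * s k)"
      unfolding sym using ijk by (simp add: ad c_def base_det_def add_divide_distrib diff_divide_distrib mult_ac)
    then show "(0 < (cot_position 18 \<rho> k - cot_position 18 \<rho> j) * c i + (cot_position 18 \<rho> i - cot_position 18 \<rho> k) * c j + (cot_position 18 \<rho> j - cot_position 18 \<rho> i) * c k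
        \<longleftrightarrow> pos_orient (int i) (int j) (int k)) \<and>
      (cot_position 18 \<rho> k - cot_position 18 \<rho> j) * c i + (cot_position 18 \<rho> i - cot_position 18 \<rho> k) * c j + (cot_position 18 \<rho> j - cot_position 18 \<rho> i) * c k \<noteq> 0"
      using base_det_sign[of "int i" "int j" "int k"] ijk mult_pos_pos[OF mult_pos_pos[OF sp(1,2)] sp(3)]
      by (auto simp: zero_less_divide_iff)
  qed
  then show ?thesis using rho irr by blast
qed

section \<open>Reflection and conclusion\<close>

text \<open>The mirror image x to - x with reversed indices. Heights are unchanged, and apex i comes
  from apex m - i, of the same parity because m is even.\<close>

lemma doublable_reflect:
  assumes "even m" and old: "doublable m a c"
    and a': "\<And>i. i \<in> {1..m} \<Longrightarrow> a' i = - a (m + 1 - i)" and c': "\<And>i. i \<in> {1..m} \<Longrightarrow> c' i = - c (m + 1 - i)"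
  shows "doublable m a' c'"
proof -
  define \<sigma> where "\<sigma> i = m + 1 - i" for i
  define R where "R P = (- fst P, snd P)" for P :: "real \<times> real"
  have \<sigma>: "\<sigma> i \<in> {1..m}" "\<sigma> (\<sigma> i) = i" if "i \<in> {1..m}" for i using that by (auto simp: \<sigma>_def)
  have \<sigma>_less: "\<sigma> j < \<sigma> i \<longleftrightarrow> i < j" if "i \<in> {1..m}" "j \<in> {1..m}" for i j using that by (auto simp: \<sigma>_def)
  have RR: "R (R P) = P" for P by (simp add: R_def)
  have ellR: "ell (a' i) (c' i) (R P) = - ell (a (\<sigma> i)) (c (\<sigma> i)) P" if "i \<in> {1..m}" for i P
    using a'[OF that] c'[OF that] by (simp add: ell_def R_def \<sigma>_def)
  have ss: "same_sign (- u) (- v) (- w) \<longleftrightarrow> same_sign u v w" for u v w by (auto simp: same_sign_def)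
  have triR: "empty_triangle m a' c' (\<sigma> i) (\<sigma> j) (\<sigma> k)" if t: "empty_triangle m a c i j k" for i j k
  proof -
    from t obtain A B C where sub: "i \<in> {1..m}" "j \<in> {1..m}" "k \<in> {1..m}" and d: "i \<noteq> j" "j \<noteq> k" "i \<noteq> k"
      and inc: "ell (a j) (c j) A = 0" "ell (a k) (c k) A = 0" "ell (a i) (c i) B = 0"
       "ell (a k) (c k) B = 0" "ell (a i) (c i) C = 0" "ell (a j) (c j) C = 0"
      and sy: "same_sign (snd A) (snd B) (snd C)"
      and sq: "\<And>q. q \<in> {1..m} - {i, j, k} \<Longrightarrow> same_sign (ell (a q) (c q) A) (ell (a q) (c q) B) (ell (a q) (c q) C)"
      unfolding empty_triangle_def by auto
    note s = \<sigma>[OF sub(1)] \<sigma>[OF sub(2)] \<sigma>[OF sub(3)]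
    have ds: "\<sigma> i \<noteq> \<sigma> j" "\<sigma> j \<noteq> \<sigma> k" "\<sigma> i \<noteq> \<sigma> k" using d s by metis+
    show ?thesis
    proof (rule empty_triangleI[where A = "R A" and B = "R B" and C = "R C"])
      show "same_sign (snd (R A)) (snd (R B)) (snd (R C))" using sy by (simp add: R_def)
      fix q assume q: "q \<in> {1..m} - {\<sigma> i, \<sigma> j, \<sigma> k}"
      then have "\<sigma> q \<in> {1..m} - {i, j, k}" using \<sigma>[of q] by auto
      then show "same_sign (ell (a' q) (c' q) (R A)) (ell (a' q) (c' q) (R B)) (ell (a' q) (c' q) (R C))"
        using q sq by (simp add: ellR ss)
    qed (use s ds inc in \<open>simp_all add: ellR\<close>)
  qed
  obtain \<T> where \<T>: "finite \<T>" "\<And>T. T \<in> \<T> \<Longrightarrow> \<exists>i j k. T = {i, j, k} \<and> empty_triangle m a c i j k" "m * (m - 3) \<le> 3 * card \<T>"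
    using doublable_triples[OF old] by blast
  have \<T>sub: "T \<subseteq> {1..m}" if "T \<in> \<T>" for T using \<T>(2)[OF that] by (auto simp: empty_triangle_def)
  have inj: "inj_on ((`) \<sigma>) \<T>"
  proof (rule inj_onI)
    fix T T' assume T: "T \<in> \<T>" "T' \<in> \<T>" "\<sigma> ` T = \<sigma> ` T'"
    have "inj_on \<sigma> {1..m}" by (rule inj_on_inverseI[of _ \<sigma>]) (rule \<sigma>(2))
    from inj_on_image_eq_iff[OF this \<T>sub[OF T(1)] \<T>sub[OF T(2)]] T(3) show "T = T'" by simp
  qed
  show ?thesis
    unfolding doublable_def
  proof (intro conjI ballI allI impI)
    fix i j assume ij: "i \<in> {1..m}" "j \<in> {1..m}" "i < j"
    have "\<sigma> j < \<sigma> i" using \<sigma>_less ij by simp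
    from doublable_slopes[OF old \<sigma>(1)[OF ij(2)] \<sigma>(1)[OF ij(1)] this]
    show "a' i < a' j" "c' i \<noteq> c' j" using a' c' ij by (auto simp: \<sigma>_def)
  next
    fix i j k P assume ij: "i \<in> {1..m}" "j \<in> {1..m}" and k: "k \<in> {1..m}" "j < k" and "i < j"
    then have "\<sigma> j < \<sigma> i" using \<sigma>_less by simp
    have "\<sigma> k < \<sigma> j" using \<sigma>_less ij k by simp
    show "\<not> (ell (a' i) (c' i) P = 0 \<and> ell (a' j) (c' j) P = 0 \<and> ell (a' k) (c' k) P = 0)"
      using doublable_not_concurrent[OF old \<sigma>(1)[OF k(1)] \<sigma>(1)[OF ij(2)] \<sigma>(1)[OF ij(1)] \<open>\<sigma> k < \<sigma> j\<close> \<open>\<sigma> j < \<sigma> i\<close>, of "R P"]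
        ellR[OF ij(1), of "R P"] ellR[OF ij(2), of "R P"] ellR[OF k(1), of "R P"] unfolding RR by auto
  next
    fix i assume i: "i \<in> {1..<m}"
    define j where "j = m - i"
    have j: "j \<in> {1..<m}" "\<sigma> i = j + 1" "\<sigma> (i + 1) = j" using i by (auto simp: j_def \<sigma>_def)
    have par: "odd j \<longleftrightarrow> odd i" using \<open>even m\<close> i by (auto simp: j_def)
    obtain W where W: "ell (a j) (c j) W = 0" "ell (a (j + 1)) (c (j + 1)) W = 0"
      "if odd j then 0 < snd W else snd W < 0"
      "\<And>q. q \<in> {1..m} \<Longrightarrow> (q < j \<longrightarrow> 0 < ell (a q) (c q) W) \<and> (j + 1 < q \<longrightarrow> ell (a q) (c q) W < 0)"
      using doublable_apex[OF old j(1)] unfolding apex_def by blast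
    have i2: "i \<in> {1..m}" "i + 1 \<in> {1..m}" using i by auto
    have "ell (a' i) (c' i) (R W) = 0" "ell (a' (i + 1)) (c' (i + 1)) (R W) = 0"
      unfolding ellR[OF i2(1)] ellR[OF i2(2)] j using W by auto
    moreover have "if odd i then 0 < snd (R W) else snd (R W) < 0" using W(3) par by (simp add: R_def)
    moreover have "(q < i \<longrightarrow> 0 < ell (a' q) (c' q) (R W)) \<and> (i + 1 < q \<longrightarrow> ell (a' q) (c' q) (R W) < 0)" if "q \<in> {1..m}" for q
    proof -
      have "q < i \<Longrightarrow> j + 1 < \<sigma> q" "i + 1 < q \<Longrightarrow> \<sigma> q < j" using i that by (auto simp: \<sigma>_def j_def)
      then show ?thesis using W(4)[OF \<sigma>(1)[OF that]] unfolding ellR[OF that] by auto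
    qed
    ultimately show "apex m a' c' i" unfolding apex_def by blast
  next
    show "\<exists>\<T>. finite \<T> \<and> (\<forall>T\<in>\<T>. \<exists>i j k. T = {i, j, k} \<and> empty_triangle m a' c' i j k) \<and> m * (m - 3) \<le> 3 * card \<T>"
    proof (intro exI[of _ "(`) \<sigma> ` \<T>"] conjI ballI)
      show "finite ((`) \<sigma> ` \<T>)" using \<T>(1) by simp
      show "m * (m - 3) \<le> 3 * card ((`) \<sigma> ` \<T>)" using \<T>(3) inj by (simp add: card_image)
      fix T assume "T \<in> (`) \<sigma> ` \<T>"
      then obtain S where S: "S \<in> \<T>" "T = \<sigma> ` S" by blast
      obtain i j k where "S = {i, j, k}" "empty_triangle m a c i j k" using \<T>(2)[OF S(1)] by blast
      then have "T = {\<sigma> i, \<sigma> j, \<sigma> k}" "empty_triangle m a' c' (\<sigma> i) (\<sigma> j) (\<sigma> k)" using S triR by auto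
      then show "\<exists>i j k. T = {i, j, k} \<and> empty_triangle m a' c' i j k" by blast
    qed
  qed
qed

text \<open>Index 0 is the axis. The counted triples avoid 0 and the m - 1 apex triples contain it,
  so the two families add up; the upper estimate is the general one for m + 1 lines.\<close>

lemma doublable_arrangement:
  assumes doublable: "doublable m a c" and m: "4 \<le> m"
  shows "\<exists>\<A>. simple_arrangement \<A> \<and> card \<A> = m + 1 \<and>
    m * (m - 3) + 3 * (m - 1) \<le> 3 * card (bounded_triangular_faces \<A>) \<and>
    3 * card (bounded_triangular_faces \<A>) \<le> (m + 1) * (m - 1)"
proof -
  define F :: "nat \<Rightarrow> lin" where "F i = (if i = 0 then (vector [0, 1], 0) else (vector [1, - c i], a i))" for i
  have ev0: "ev (F 0) p = p $ 2" for p by (simp add: ev_def F_def inner_plane)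
  have evF: "ev (F i) p = ell (a i) (c i) (p $ 1, p $ 2)" if "i \<noteq> 0" for i p
    using that by (simp add: ev_def F_def inner_plane ell_def)
  have a_inj: "a i \<noteq> a j" if "i \<in> {1..m}" "j \<in> {1..m}" "i \<noteq> j" for i j
    using doublable_slopes(1)[OF doublable, of i j] doublable_slopes(1)[OF doublable, of j i] that by (cases i j rule: linorder_cases) auto
  have c_inj: "c i \<noteq> c j" if "i \<in> {1..m}" "j \<in> {1..m}" "i \<noteq> j" for i j
    using doublable_slopes(2)[OF doublable, of i j] doublable_slopes(2)[OF doublable, of j i] that by (cases i j rule: linorder_cases) auto
  have conc0: False if "i \<in> {1..m}" "j \<in> {1..m}" "i \<noteq> j" "ev (F 0) p = 0" "ev (F i) p = 0" "ev (F j) p = 0" for i j p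
    using a_inj[OF that(1-3)] that by (auto simp: ev0 evF ell_def)
  have conc: False if d: "i \<in> {1..m}" "j \<in> {1..m}" "k \<in> {1..m}" "i \<noteq> j" "j \<noteq> k" "i \<noteq> k"
    and z: "ev (F i) p = 0" "ev (F j) p = 0" "ev (F k) p = 0" for i j k p
  proof -
    have *: False if "i \<in> {1..m}" "j \<in> {1..m}" "k \<in> {1..m}" "i < j" "j < k"
      "ev (F i) p = 0" "ev (F j) p = 0" "ev (F k) p = 0" for i j k
      using doublable_not_concurrent[OF doublable that(1-5), of "(p $ 1, p $ 2)"] that by (auto simp: evF)
    consider "i < j \<and> j < k" | "i < k \<and> k < j" | "j < i \<and> i < k" | "j < k \<and> k < i" | "k < i \<and> i < j" | "k < j \<and> j < i"
      using d(4-6) by linarith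
    then show False using * d z by cases blast+
  qed
  interpret simple_family F "{0..m}"
  proof
    show "finite {0..m}" by simp
    show "fst (F i) \<noteq> 0" for i by (auto simp: F_def vec_eq_iff forall_2)
    show "det2 (fst (F i)) (fst (F j)) \<noteq> 0" if "i \<in> {0..m}" "j \<in> {0..m}" "i \<noteq> j" for i j
      using c_inj[of i j] that by (auto simp: F_def det2_def)
    show False if "i \<in> {0..m}" "j \<in> {0..m}" "k \<in> {0..m}" "i \<noteq> j" "j \<noteq> k" "i \<noteq> k"
      "ev (F i) A = 0" "ev (F j) A = 0" "ev (F k) A = 0" for i j k A
    proof -
      consider "i = 0" | "j = 0" | "k = 0" | "i \<noteq> 0" "j \<noteq> 0" "k \<noteq> 0" by blast
      then show False
        using conc0[of j k A] conc0[of i k A] conc0[of i j A] conc[of i j k A] that by cases auto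
    qed
  qed
  obtain \<T> where \<T>: "finite \<T>" "\<And>T. T \<in> \<T> \<Longrightarrow> \<exists>i j k. T = {i, j, k} \<and> empty_triangle m a c i j k" "m * (m - 3) \<le> 3 * card \<T>"
    using doublable_triples[OF doublable] by blast
  define pt :: "real \<times> real \<Rightarrow> plane" where "pt P = vector [fst P, snd P]" for P
  have evpt: "ev (F 0) (pt P) = snd P" "i \<noteq> 0 \<Longrightarrow> ev (F i) (pt P) = ell (a i) (c i) P" for i P
    by (simp_all add: ev0 evF pt_def)
  have sub1: "\<T> \<subseteq> empty_triples"
  proof
    fix T assume "T \<in> \<T>"
    then obtain i j k where T: "T = {i, j, k}" and t: "empty_triangle m a c i j k" using \<T>(2) by blast
    obtain A B C where sub: "i \<in> {1..m}" "j \<in> {1..m}" "k \<in> {1..m}" and d: "i \<noteq> j" "j \<noteq> k" "i \<noteq> k"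
      and inc: "ell (a j) (c j) A = 0" "ell (a k) (c k) A = 0" "ell (a i) (c i) B = 0"
       "ell (a k) (c k) B = 0" "ell (a i) (c i) C = 0" "ell (a j) (c j) C = 0"
      and sy: "same_sign (snd A) (snd B) (snd C)"
      and sq: "\<And>q. q \<in> {1..m} - {i, j, k} \<Longrightarrow> same_sign (ell (a q) (c q) A) (ell (a q) (c q) B) (ell (a q) (c q) C)"
      using t unfolding empty_triangle_def by auto
    have nz: "i \<noteq> 0" "j \<noteq> 0" "k \<noteq> 0" using sub by auto
    have "triangle i j k (pt A) (pt B) (pt C)"
      unfolding triangle_def
    proof (intro conjI ballI)
      fix q assume q: "q \<in> {0..m} - {i, j, k}"
      show "(0 < ev (F q) (pt A) \<and> 0 < ev (F q) (pt B) \<and> 0 < ev (F q) (pt C)) \<or>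
         (ev (F q) (pt A) < 0 \<and> ev (F q) (pt B) < 0 \<and> ev (F q) (pt C) < 0)"
      proof (cases "q = 0")
        case True then show ?thesis using sy by (simp add: evpt same_sign_def)
      next
        case False
        then have "same_sign (ell (a q) (c q) A) (ell (a q) (c q) B) (ell (a q) (c q) C)" using q by (intro sq) auto
        then show ?thesis using False by (simp add: evpt same_sign_def)
      qed
    qed (use sub d inc nz in \<open>simp_all add: evpt\<close>)
    then show "T \<in> empty_triples" unfolding empty_triples_def T by blast
  qed
  have sub2: "(\<lambda>i. {0, i, i + 1}) ` {1..<m} \<subseteq> empty_triples"
  proof
    fix T assume "T \<in> (\<lambda>i. {0, i, i + 1}) ` {1..<m}"
    then obtain i where i: "i \<in> {1..<m}" and T: "T = {0, i, i + 1}" by blast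
    obtain W where W: "ell (a i) (c i) W = 0" "ell (a (i + 1)) (c (i + 1)) W = 0"
      "\<And>q. q \<in> {1..m} \<Longrightarrow> (q < i \<longrightarrow> 0 < ell (a q) (c q) W) \<and> (i + 1 < q \<longrightarrow> ell (a q) (c q) W < 0)"
      using doublable_apex[OF doublable i] unfolding apex_def by blast
    have "triangle 0 i (i + 1) (pt W) (pt (a (i + 1), 0)) (pt (a i, 0))"
      unfolding triangle_def
    proof (intro conjI ballI)
      fix q assume q: "q \<in> {0..m} - {0, i, i + 1}"
      then have q1: "q \<in> {1..m}" "q \<noteq> 0" "q \<noteq> i" "q \<noteq> i + 1" by auto
      have e: "ev (F q) (pt (a (i + 1), 0)) = a (i + 1) - a q" "ev (F q) (pt (a i, 0)) = a i - a q" "ev (F q) (pt W) = ell (a q) (c q) W"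
        using q1 by (simp_all add: evpt ell_def)
      have "i \<in> {1..m}" "i + 1 \<in> {1..m}" using i by auto
      note am = doublable_slopes(1)[OF doublable]
      consider "q < i" | "i + 1 < q" using q1 by linarith
      then show "(0 < ev (F q) (pt W) \<and> 0 < ev (F q) (pt (a (i + 1), 0)) \<and> 0 < ev (F q) (pt (a i, 0))) \<or>
         (ev (F q) (pt W) < 0 \<and> ev (F q) (pt (a (i + 1), 0)) < 0 \<and> ev (F q) (pt (a i, 0)) < 0)"
        unfolding e using W(3)[OF q1(1)] am[of q i] am[of q "i + 1"] am[of i q] am[of "i + 1" q] q1 i by cases auto
    qed (use i W in \<open>simp_all add: evpt ell_def\<close>)
    then show "T \<in> empty_triples" unfolding empty_triples_def T by blast
  qed
  have dis: "\<T> \<inter> (\<lambda>i. {0, i, i + 1}) ` {1..<m} = {}"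
  proof -
    have "0 \<notin> T" if "T \<in> \<T>" for T using \<T>(2)[OF that] by (auto simp: empty_triangle_def)
    then show ?thesis by fastforce
  qed
  have inj: "inj_on (\<lambda>i. {0, i, i + 1}) {1..<m}"
  proof (rule inj_onI)
    fix i j assume ij: "i \<in> {1..<m}" "j \<in> {1..<m}" "{0, i, i + 1} = {0, j, j + 1}"
    have "{0, i, i + 1} \<subseteq> {0, j, j + 1}" "{0, j, j + 1} \<subseteq> {0, i, i + 1}"
      using equalityD1[OF ij(3)] equalityD2[OF ij(3)] .
    then show "i = j" using ij(1,2) by auto
  qed
  have ci: "card ((\<lambda>i. {0, i, i + 1}) ` {1..<m}) = m - 1" by (subst card_image[OF inj]) simp
  have "card (\<T> \<union> (\<lambda>i. {0, i, i + 1}) ` {1..<m}) = card \<T> + card ((\<lambda>i. {0, i, i + 1}) ` {1..<m})"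
    by (rule card_Un_disjoint[OF \<T>(1) _ dis]) simp
  then have "card \<T> + (m - 1) = card (\<T> \<union> (\<lambda>i. {0, i, i + 1}) ` {1..<m})" unfolding ci by simp
  also have "\<dots> \<le> card empty_triples" using sub1 sub2 finite_empty_triples by (intro card_mono) auto
  finally have "m * (m - 3) + 3 * (m - 1) \<le> 3 * card (bounded_triangular_faces arr)"
    using \<T>(3) unfolding card_bounded_triangular_faces by linarith
  moreover have "3 * card (bounded_triangular_faces arr) \<le> (m + 1) * (m - 1)"
    using card_empty_triples_le unfolding card_bounded_triangular_faces by simp
  ultimately show ?thesis using simple_arrangement_arr card_arr by (intro exI[of _ arr]) simp
qed

section \<open>Iterating the doubling with a phase that is never dyadic\<close>

lemma cot_position_reflect:
  assumes "i \<in> {1..m}"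
  shows "cot_position m (1 - \<rho>) i = - cot_position m \<rho> (m + 1 - i)"
proof -
  have "m \<noteq> 0" using assms by auto
  then have e: "(real i - (1 - \<rho>)) * (pi / real m) = pi - (real (m + 1 - i) - \<rho>) * (pi / real m)"
    using assms by (simp add: of_nat_diff field_simps)
  have "cot (pi - x) = - cot x" for x :: real by (simp add: cot_def)
  then show ?thesis unfolding cot_position_def e by simp
qed

lemma not_dyadic_half: "(\<forall>j::nat. \<rho> * 2 ^ j \<notin> \<int>) \<Longrightarrow> \<rho> \<noteq> (1 / 2 :: real)"
proof
  assume "\<forall>j::nat. \<rho> * 2 ^ j \<notin> \<int>" "\<rho> = 1 / 2"
  then have "(1 / 2 :: real) * 2 ^ (1::nat) \<notin> \<int>" by blast
  then show False by simp
qed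

lemma not_dyadic_reflect:
  assumes "\<And>j::nat. \<rho> * 2 ^ j \<notin> (\<int> :: real set)"
  shows "(1 - \<rho>) * 2 ^ j \<notin> \<int>"
proof
  assume "(1 - \<rho>) * 2 ^ j \<in> \<int>"
  moreover have "2 ^ j \<in> (\<int> :: real set)" by simp
  ultimately have "2 ^ j - (1 - \<rho>) * 2 ^ j \<in> \<int>" by (intro Ints_diff)
  then show False using assms[of j] by (simp add: algebra_simps)
qed

lemma not_dyadic_double:
  assumes "\<And>j::nat. \<rho> * 2 ^ j \<notin> (\<int> :: real set)"
  shows "(2 * \<rho> - 1) * 2 ^ j \<notin> \<int>"
proof
  assume "(2 * \<rho> - 1) * 2 ^ j \<in> \<int>"
  moreover have "2 ^ j \<in> (\<int> :: real set)" by simp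
  ultimately have "(2 * \<rho> - 1) * 2 ^ j + 2 ^ j \<in> \<int>" by (intro Ints_add)
  then show False using assms[of "Suc j"] by (simp add: algebra_simps)
qed

lemma floor_triangle_bound:
  fixes t n :: nat
  assumes n: "n = 18 * 2 ^ t + 1"
  shows "\<lfloor>real n * (real n - 2) / 3\<rfloor> = 108 * 4 ^ t - 1"
proof -
  have sq: "(2::real) ^ t * 2 ^ t = 4 ^ t" by (simp flip: power_mult_distrib)
  have "real n * (real n - 2) = 324 * (2 ^ t * 2 ^ t) - 1" by (simp add: n algebra_simps)
  then have "real n * (real n - 2) / 3 = of_int (108 * 4 ^ t - 1) + 2 / 3" unfolding sq by simp
  then show ?thesis by (simp add: floor_unique)
qed

text \<open>As m^2 is divisible by 3, the range from m^2 - 3 to m^2 - 1 contains a single multiple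
  of 3.\<close>

lemma triangle_count_unique:
  fixes t m N :: nat
  assumes m: "m = 18 * 2 ^ t" and N: "m * (m - 3) + 3 * (m - 1) \<le> 3 * N" "3 * N \<le> (m + 1) * (m - 1)"
  shows "int N = 108 * 4 ^ t - 1"
proof -
  have sq: "(2::int) ^ t * 2 ^ t = 4 ^ t" by (simp flip: power_mult_distrib)
  have m18: "18 \<le> m" by (simp add: m)
  then obtain k where k: "m = 3 + k" using le_Suc_ex[of 3 m] by auto
  have e: "int (m * (m - 3) + 3 * (m - 1)) = int m * int m - 3" "int ((m + 1) * (m - 1)) = int m * int m - 1"
    by (auto simp: k algebra_simps)
  have mm: "int m * int m = 324 * 4 ^ t" unfolding m by (simp add: algebra_simps flip: sq)
  have "324 * 4 ^ t - 3 \<le> 3 * int N" "3 * int N \<le> 324 * 4 ^ t - 1"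
    using N e mm by linarith+
  moreover have "N' = 108 * X - 1" if "324 * X - 3 \<le> 3 * N'" "3 * N' \<le> 324 * X - 1" for N' X :: int
    using that by presburger
  ultimately show ?thesis by blast
qed

text \<open>Doubling requires \<rho> > 1/2, and smaller values are reflected first. The value 1/2 is
  excluded by the condition on all 2^j, which must be quantified over j to survive both the
  reflection and the doubling.\<close>

lemma doublable_family:
  "\<exists>\<rho> c. 0 < \<rho> \<and> \<rho> < 1 \<and> (\<forall>j::nat. \<rho> * 2 ^ j \<notin> \<int>) \<and> doublable (18 * 2 ^ t) (cot_position (18 * 2 ^ t) \<rho>) c"
proof (induction t)
  case 0
  show ?case using doublable_base_exists by simp
next
  case (Suc t)
  define m :: nat where "m = 18 * 2 ^ t"
  have "(1::nat) \<le> 2 ^ t" by simp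
  then have m: "even m" "4 \<le> m" unfolding m_def by (simp, linarith)
  have step: "\<exists>\<rho>' c'. 0 < \<rho>' \<and> \<rho>' < 1 \<and> (\<forall>j::nat. \<rho>' * 2 ^ j \<notin> \<int>) \<and> doublable (2 * m) (cot_position (2 * m) \<rho>') c'"
    if r: "1/2 < \<rho>" "\<rho> < 1" "\<And>j::nat. \<rho> * 2 ^ j \<notin> \<int>" "doublable m (cot_position m \<rho>) c" for \<rho> c
  proof -
    interpret regular_positions m \<rho> using m r by unfold_locales auto
    obtain c' where "doublable (2 * m) (cot_position (2 * m) (2 * \<rho> - 1)) c'" using doublable_step[OF r(4)] by blast
    moreover have "0 < 2 * \<rho> - 1" "2 * \<rho> - 1 < 1" using r by auto
    ultimately show ?thesis using not_dyadic_double[OF r(3)] by blast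
  qed
  obtain \<rho> c where r: "0 < \<rho>" "\<rho> < 1" "\<And>j::nat. \<rho> * 2 ^ j \<notin> \<int>" "doublable m (cot_position m \<rho>) c"
    using Suc unfolding m_def by blast
  have "\<rho> \<noteq> 1/2" using not_dyadic_half r(3) by blast
  then consider "1/2 < \<rho>" | "\<rho> < 1/2" by linarith
  then have "\<exists>\<rho>' c'. 0 < \<rho>' \<and> \<rho>' < 1 \<and> (\<forall>j::nat. \<rho>' * 2 ^ j \<notin> \<int>) \<and> doublable (2 * m) (cot_position (2 * m) \<rho>') c'"
  proof cases
    case 1
    then show ?thesis using step r by blast
  next
    case 2
    have "doublable m (cot_position m (1 - \<rho>)) (\<lambda>i. - c (m + 1 - i))"
      by (rule doublable_reflect[OF m(1) r(4)]) (simp_all only: cot_position_reflect)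
    moreover have "1/2 < 1 - \<rho>" "1 - \<rho> < 1" using 2 r by auto
    ultimately show ?thesis using step not_dyadic_reflect[OF r(3)] by blast
  qed
  then show ?case by (simp add: m_def mult.left_commute)
qed

theorem theorem5p1:
  fixes t n :: nat
  assumes "n = 18 * 2 ^ t + 1"
  shows "(\<exists>\<A>. simple_arrangement \<A> \<and> card \<A> = n \<and>
            int (card (bounded_triangular_faces \<A>)) = \<lfloor>real n * (real n - 2) / 3\<rfloor>) \<and>
         \<lfloor>real n * (real n - 2) / 3\<rfloor> = 108 * 4 ^ t - 1"
proof -
  define m :: nat where "m = 18 * 2 ^ t"
  have "(1::nat) \<le> 2 ^ t" by simp
  then have m: "4 \<le> m" unfolding m_def by linarith
  obtain \<rho> c where "doublable m (cot_position m \<rho>) c" using doublable_family[of t] unfolding m_def by blast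
  from doublable_arrangement[OF this m] obtain \<A> where \<A>: "simple_arrangement \<A>" "card \<A> = m + 1"
    "m * (m - 3) + 3 * (m - 1) \<le> 3 * card (bounded_triangular_faces \<A>)"
    "3 * card (bounded_triangular_faces \<A>) \<le> (m + 1) * (m - 1)"
    by blast
  have "int (card (bounded_triangular_faces \<A>)) = 108 * 4 ^ t - 1"
    by (rule triangle_count_unique[OF m_def \<A>(3,4)])
  then show ?thesis using \<A>(1,2) floor_triangle_bound[OF assms] assms unfolding m_def by auto
qed

end
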